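(* Let $\alpha\in(0,2]$, $\beta\in(0,1)$, $\nu>0$, let $d\ge1$ be an integer with $d<\min\{2,\beta^{-1}\}\alpha$, and let $u_0:\mathbb{R}^d\to\mathbb{R}$ be measurable and bounded with $\inf_{x\in\mathbb{R}^d}u_0(x)>0$. Suppose there exist constants $L>0$, $\rho>1$, $\kappa>0$ and a positive function $\overline J$ on $\mathbb{R}^d$ such that $|\sigma(x,h)|\ge L\overline J(h)|x|^\rho$ for all $x\in\mathbb{R}$, $h\in\mathbb{R}^d$, and $\int_{\mathbb{R}^d}\overline J(h)^2\mu(dh)\ge\kappa$. Then there is no random field solution to $$\frac{\partial^\beta u}{\partial t^\beta}+\nu(-\Delta)^{\alpha/2}u=I_t^{1-\beta}\Big[\int_{\mathbb{R}^d}\sigma(u(t,x),h)\,\dot{\tilde N}(t,x,h)\Big]$$ with initial condition $u_0$.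
   Context: Noise: $\mu$ is a Lévy measure on $\mathbb{R}^d$, i.e. $\int_{\mathbb{R}^d}(1\wedge|h|^2)\mu(dh)<\infty$. $N$ is a Poisson random measure on $\mathbb{R}_+\times\mathbb{R}^d\times\mathbb{R}^d$ with intensity $dt\,dx\,\mu(dh)$, and $\tilde N(ds\,dx\,dh)=N(ds\,dx\,dh)-ds\,dx\,\mu(dh)$. Predictability is with respect to the filtration generated by $N$. For predictable $X$ with $\int_0^T\int\int \mathbb{E}|X(s,x,h)|^2\,ds\,dx\,\mu(dh)<\infty$, the integral $\int_0^T\int\int X\,d\tilde N$ is defined and satisfies $\mathbb{E}|\int X\,d\tilde N|^2=\int_0^T\int\int\mathbb{E}X^2\,ds\,dx\,\mu(dh)$. The function $\sigma:\mathbb{R}\times\mathbb{R}^d\to\mathbb{R}$ is jointly measurable. Kernel: $G_t(x)=G(t,x)=\int_0^\infty p_{X(s)}(x)f_{E_t}(s)\,ds$, where $p_{X(s)}$ is the density with Fourier transform $\widehat{p_{X(s)}}(\xi)=e^{-s\nu|\xi|^\alpha}$ (isotropic $\alpha$-stable process on $\mathbb{R}^d$) and $f_{E_t}(s)=t\beta^{-1}s^{-1-1/\beta}g_\beta(ts^{-1/\beta})$ is the density of the inverse $\beta$-stable subordinator $E_t$, $g_\beta$ being the density of $D_1$ for the $\beta$-stable subordinator $D$ with $\mathbb{E}e^{-\lambda D_1}=e^{-\lambda^\beta}$. It is the fundamental solution of $\partial_t^\beta G_t=-\nu(-\Delta)^{\alpha/2}G_t$ (Caputo derivative). The equation is interpreted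 in the mild sense. A (predictable) random field $\{u(t,x)\}_{t>0,x\in\mathbb{R}^d}$ is a mild solution with initial condition $u_0$ if, for all $t,x$, a.s., $$u(t,x)=\int_{\mathbb{R}^d}G(t,x-y)u_0(y)\,dy+\int_0^t\int_{\mathbb{R}^d}\int_{\mathbb{R}^d}G(t-s,x-y)\sigma(u(s,y),h)\,\tilde N(ds\,dy\,dh),$$ the stochastic integrand being square integrable in the sense that $\int_0^t\int_{\mathbb{R}^d}\int_{\mathbb{R}^d}G(t-s,x-y)^2\,\mathbb{E}|\sigma(u(s,y),h)|^2\,ds\,dy\,\mu(dh)<\infty$. It is a random field solution if moreover $\sup_{0\le t\le T}\sup_{x\in\mathbb{R}^d}\mathbb{E}|u(t,x)|^2<\infty$ for all $T>0$. *)

theory Defs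
  imports "HOL-Probability.Probability"
begin

section \<open>The kernel\<close>

text \<open>
  The transition densities \<open>p s\<close>, \<open>s > 0\<close>, of the isotropic \<open>\<alpha>\<close>-stable process and the density
  \<open>g\<close> of the \<open>\<beta>\<close>-stable subordinator at time 1 are described by their Fourier and
  Laplace transforms. These determine \<open>p s\<close> and \<open>g\<close> up to null sets, which are immaterial
  for the kernel integrated below.
\<close>

definition stable_densities ::
    "real \<Rightarrow> real \<Rightarrow> (real \<Rightarrow> 'a::euclidean_space \<Rightarrow> real) \<Rightarrow> bool" where
  "stable_densities \<alpha> \<nu> p \<longleftrightarrow>
     (\<lambda>(s, x). p s x) \<in> borel_measurable borel \<and>
     (\<forall>s>0. (\<forall>x. 0 \<le> p s x) \<and> integrable lborel (p s) \<and>
        (\<forall>\<xi>. (CLINT x|lborel. cis (\<xi> \<bullet> x) * complex_of_real (p s x)) =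
             complex_of_real (exp (- s * \<nu> * norm \<xi> powr \<alpha>))))"

definition subordinator_density :: "real \<Rightarrow> (real \<Rightarrow> real) \<Rightarrow> bool" where
  "subordinator_density \<beta> g \<longleftrightarrow>
     g \<in> borel_measurable borel \<and> (\<forall>x. 0 \<le> g x) \<and>
     (\<forall>r\<ge>0. (\<integral>\<^sup>+x\<in>{0<..}. ennreal (exp (- r * x) * g x) \<partial>lborel) = ennreal (exp (- (r powr \<beta>))))"

definition inverse_subordinator_density ::
    "real \<Rightarrow> (real \<Rightarrow> real) \<Rightarrow> real \<Rightarrow> real \<Rightarrow> real" where
  "inverse_subordinator_density \<beta> g t s =
     t / \<beta> * s powr (- 1 - 1 / \<beta>) * g (t * s powr (- 1 / \<beta>))"

definition fractional_kernel ::
    "real \<Rightarrow> (real \<Rightarrow> 'a \<Rightarrow> real) \<Rightarrow> (real \<Rightarrow> real) \<Rightarrow> real \<Rightarrow> 'a::euclidean_space \<Rightarrow> real" where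
  "fractional_kernel \<beta> p g t x =
     (LINT s:{0<..}|lborel. p s x * inverse_subordinator_density \<beta> g t s)"


section \<open>Poisson random measures and the compensated integral\<close>

text \<open>
  Given the integrability condition, sigma-finiteness says exactly that \<open>\<mu> {0}\<close> is finite. It
  holds in particular under the common convention \<open>\<mu> {0} = 0\<close>, which is not imposed here.
\<close>

definition levy_measure :: "'a::euclidean_space measure \<Rightarrow> bool" where
  "levy_measure \<mu> \<longleftrightarrow> sets \<mu> = sets borel \<and> sigma_finite_measure \<mu> \<and>
     (\<integral>\<^sup>+h. ennreal (min 1 ((norm h)\<^sup>2)) \<partial>\<mu>) < \<infinity>"

definition poisson_random_measure ::
    "'w measure \<Rightarrow> 'e measure \<Rightarrow> ('w \<Rightarrow> 'e measure) \<Rightarrow> bool" where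
  "poisson_random_measure M m N \<longleftrightarrow>
     (\<forall>\<omega>\<in>space M. sets (N \<omega>) = sets m) \<and>
     (\<forall>B\<in>sets m. (\<lambda>\<omega>. emeasure (N \<omega>) B) \<in> borel_measurable M) \<and>
     (\<forall>B\<in>sets m. emeasure m B < \<infinity> \<longrightarrow>
        (\<forall>k::nat. measure M {\<omega>\<in>space M. emeasure (N \<omega>) B = of_nat k} =
           exp (- measure m B) * measure m B ^ k / fact k)) \<and>
     (\<forall>B\<in>sets m. emeasure m B = \<infinity> \<longrightarrow> (AE \<omega> in M. emeasure (N \<omega>) B = \<infinity>)) \<and>
     (\<forall>(B :: nat \<Rightarrow> 'e set) I. finite I \<longrightarrow> B ` I \<subseteq> sets m \<longrightarrow> disjoint_family_on B I \<longrightarrow>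
        prob_space.indep_vars M (\<lambda>_. borel) (\<lambda>i \<omega>. emeasure (N \<omega>) (B i)) I)"

text \<open>
  Below, \<open>K\<close> is the measure on the mark space; for the equation it is \<open>dx \<mu>(dh)\<close> on pairs
  \<open>(x, h)\<close>.
\<close>

definition intensity :: "'k measure \<Rightarrow> (real \<times> 'k) measure" where
  "intensity K = restrict_space lborel {0..} \<Otimes>\<^sub>M K"

definition noise_filtration ::
    "'w measure \<Rightarrow> 'k measure \<Rightarrow> ('w \<Rightarrow> (real \<times> 'k) measure) \<Rightarrow> real \<Rightarrow> 'w measure" where
  "noise_filtration M K N t = sigma (space M)
     {(\<lambda>\<omega>. emeasure (N \<omega>) B) -` A \<inter> space M | A B.
        A \<in> sets borel \<and> B \<in> sets (intensity K) \<and> B \<subseteq> {0..t} \<times> space K}"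

text \<open>
  The predictable sigma-algebra for the filtration \<open>F\<close>, times the measurable sets of \<open>L\<close>;
  the time set is the open half-line, as time 0 plays no role in the stochastic integral.
\<close>

definition predictable_algebra ::
    "(real \<Rightarrow> 'w measure) \<Rightarrow> 'w set \<Rightarrow> 'l measure \<Rightarrow> ('w \<times> real \<times> 'l) measure" where
  "predictable_algebra F \<Omega> L = sigma (\<Omega> \<times> {0<..} \<times> space L)
     {A \<times> {a<..b} \<times> B | A a b B. 0 \<le> a \<and> a \<le> b \<and> A \<in> sets (F a) \<and> B \<in> sets L}"

text \<open>
  A list of tuples \<open>(\<xi>, a, b, B)\<close> represents the simple predictable integrand that is the sum of
  the terms \<open>\<xi>(\<omega>) 1\<^bsub>(a,b]\<^esub>(s) 1\<^bsub>B\<^esub>(k)\<close>.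
\<close>

type_synonym ('w, 'k) simple_integrand = "(('w \<Rightarrow> real) \<times> real \<times> real \<times> 'k set) list"

definition simple_predictable ::
    "(real \<Rightarrow> 'w measure) \<Rightarrow> 'w set \<Rightarrow> 'k measure \<Rightarrow> ('w, 'k) simple_integrand \<Rightarrow> bool" where
  "simple_predictable F \<Omega> K S \<longleftrightarrow>
     (\<forall>(\<xi>, a, b, B)\<in>set S. 0 \<le> a \<and> a \<le> b \<and> \<xi> \<in> borel_measurable (F a) \<and> bounded (\<xi> ` \<Omega>) \<and>
        B \<in> sets K \<and> emeasure K B < \<infinity>)"

definition simple_value :: "('w, 'k) simple_integrand \<Rightarrow> 'w \<Rightarrow> real \<Rightarrow> 'k \<Rightarrow> real" where
  "simple_value S \<omega> s k = (\<Sum>(\<xi>, a, b, B)\<leftarrow>S. \<xi> \<omega> * indicator {a<..b} s * indicator B k)"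

definition simple_integral ::
    "'k measure \<Rightarrow> ('w \<Rightarrow> (real \<times> 'k) measure) \<Rightarrow> ('w, 'k) simple_integrand \<Rightarrow> 'w \<Rightarrow> real" where
  "simple_integral K N S \<omega> =
     (\<Sum>(\<xi>, a, b, B)\<leftarrow>S. \<xi> \<omega> * (measure (N \<omega>) ({a<..b} \<times> B) - (b - a) * measure K B))"

text \<open>
  \<open>Z\<close> is a version of the integral of the predictable, square integrable \<open>X\<close> against the
  compensated measure: the limit in mean square of the integrals of simple predictable integrands
  approximating \<open>X\<close>. An integral up to time \<open>t\<close> is obtained by putting an indicator into \<open>X\<close>.
\<close>

definition has_compensated_integral ::
    "'w measure \<Rightarrow> 'k measure \<Rightarrow> ('w \<Rightarrow> (real \<times> 'k) measure) \<Rightarrow>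
     ('w \<Rightarrow> real \<Rightarrow> 'k \<Rightarrow> real) \<Rightarrow> ('w \<Rightarrow> real) \<Rightarrow> bool" where
  "has_compensated_integral M K N X Z \<longleftrightarrow>
     (\<lambda>(\<omega>, s, k). X \<omega> s k) \<in>
       borel_measurable (predictable_algebra (noise_filtration M K N) (space M) K) \<and>
     (\<integral>\<^sup>+(s, k). (\<integral>\<^sup>+\<omega>. ennreal ((X \<omega> s k)\<^sup>2) \<partial>M) \<partial>intensity K) < \<infinity> \<and>
     Z \<in> borel_measurable M \<and>
     (\<exists>S. (\<forall>n::nat. simple_predictable (noise_filtration M K N) (space M) K (S n)) \<and>
        (\<lambda>n. \<integral>\<^sup>+(s, k). (\<integral>\<^sup>+\<omega>. ennreal ((simple_value (S n) \<omega> s k - X \<omega> s k)\<^sup>2) \<partial>M) \<partial>intensity K)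
          \<longlonglongrightarrow> 0 \<and>
        (\<lambda>n. \<integral>\<^sup>+\<omega>. ennreal ((simple_integral K N (S n) \<omega> - Z \<omega>)\<^sup>2) \<partial>M) \<longlonglongrightarrow> 0)"


section \<open>Solutions\<close>

text \<open>
  The equation enters through its fundamental solution \<open>G\<close>. Only the values \<open>u t x\<close> with
  \<open>t > 0\<close> matter.
\<close>

definition mild_solution ::
    "'w measure \<Rightarrow> 'a measure \<Rightarrow> ('w \<Rightarrow> (real \<times> 'a \<times> 'a) measure) \<Rightarrow>
     (real \<Rightarrow> 'a \<Rightarrow> real) \<Rightarrow> (real \<Rightarrow> 'a \<Rightarrow> real) \<Rightarrow> ('a \<Rightarrow> real) \<Rightarrow>
     (real \<Rightarrow> 'a::euclidean_space \<Rightarrow> 'w \<Rightarrow> real) \<Rightarrow> bool" where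
  "mild_solution M \<mu> N G \<sigma> u\<^sub>0 u \<longleftrightarrow>
     (\<lambda>(\<omega>, t, x). u t x \<omega>) \<in>
       borel_measurable
         (predictable_algebra (noise_filtration M (lborel \<Otimes>\<^sub>M \<mu>) N) (space M) borel) \<and>
     (\<forall>t>0. \<forall>x.
        (\<integral>\<^sup>+s\<in>{0<..<t}. (\<integral>\<^sup>+y. (\<integral>\<^sup>+h. ennreal ((G (t - s) (x - y))\<^sup>2) *
            (\<integral>\<^sup>+\<omega>. ennreal ((\<sigma> (u s y \<omega>) h)\<^sup>2) \<partial>M) \<partial>\<mu>) \<partial>lborel) \<partial>lborel) < \<infinity> \<and>
        (\<exists>Z. has_compensated_integral M (lborel \<Otimes>\<^sub>M \<mu>) N
               (\<lambda>\<omega> s (y, h). indicator {0<..<t} s * G (t - s) (x - y) * \<sigma> (u s y \<omega>) h) Z \<and>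
             (AE \<omega> in M. u t x \<omega> = (LINT y|lborel. G t (x - y) * u\<^sub>0 y) + Z \<omega>)))"

text \<open>
  The supremum is over positive times, the index set of \<open>u\<close>; at time 0 the field is the
  initial condition.
\<close>

definition random_field_solution ::
    "'w measure \<Rightarrow> 'a measure \<Rightarrow> ('w \<Rightarrow> (real \<times> 'a \<times> 'a) measure) \<Rightarrow>
     (real \<Rightarrow> 'a \<Rightarrow> real) \<Rightarrow> (real \<Rightarrow> 'a \<Rightarrow> real) \<Rightarrow> ('a \<Rightarrow> real) \<Rightarrow>
     (real \<Rightarrow> 'a::euclidean_space \<Rightarrow> 'w \<Rightarrow> real) \<Rightarrow> bool" where
  "random_field_solution M \<mu> N G \<sigma> u\<^sub>0 u \<longleftrightarrow>
     mild_solution M \<mu> N G \<sigma> u\<^sub>0 u \<and>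
     (\<forall>T>0. (SUP t\<in>{0<..T}. SUP x. \<integral>\<^sup>+\<omega>. ennreal ((u t x \<omega>)\<^sup>2) \<partial>M) < \<infinity>)"

end

theory Submission
  imports Defs
begin

text \<open>
  By the isometry for the compensated integral, the second moment \<open>U t x\<close> of a solution is the
  square of the deterministic term plus the integral of \<open>G\<^sup>2 \<sigma>\<^sup>2\<close>. The first is bounded below by a
  positive constant; for the second, a weak form of Jensen's inequality and \<open>\<integral> (G t)\<^sup>2 \<ge> C t\<^bsup>-\<gamma>\<^esup>\<close> with
  \<open>\<gamma> = \<beta> d / \<alpha> < 1\<close> show that \<open>U \<ge> a\<close> on a time interval \<open>(r, t)\<close>, \<open>t \<le> T\<close>, implies
  \<open>U t x \<ge> k T\<^bsup>-\<gamma>\<^esup> a\<^bsup>\<rho>\<^esup> (t - r)\<close>. So \<open>U\<close> doubles after time steps that decrease geometrically, as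
  \<open>\<rho> > 1\<close>, with a sum of order \<open>T\<^bsup>\<gamma>\<^esup>\<close>, which is less than \<open>T\<close> for large \<open>T\<close>: the second moment
  is infinite at time \<open>T\<close>.
\<close>

section \<open>Poisson random measures\<close>

text \<open>The isometry is not built into the definitions: the noise offers only Poisson counts
  that are independent over finitely many disjoint sets, and the integral is a mean square limit.
  Independence has to be carried from single counts to the whole past and future of a time point,
  where the predictable coefficients live. For lower bounds one inequality of the isometry suffices,
  and only that one is carried to the limit. The kernel is known through Fourier and Laplace
  transforms and not by pointwise estimates; its square integral is bounded below by locating a
  fixed share of its mass in a cube whose volume grows like \<open>t powr \<gamma>\<close>. The
  initial value may be small, so blow-up cannot be forced by large data, only by a long horizon
  \<open>T\<close>. Within it \<open>(t - s) powr (- \<gamma>)\<close> is replaced by its lower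
  bound \<open>T powr (- \<gamma>)\<close>, which turns the convolution in time into growth linear
  in the elapsed time. Moments take values in \<open>ennreal\<close>, so the iteration runs without
  any finiteness.\<close>

lemma finite_disjoint_refinement:
  assumes "finite C" "C \<subseteq> sets m"
  obtains D where "finite D" "D \<subseteq> sets m" "disjoint D" "{} \<notin> D" "\<Union>D = \<Union>C"
    "\<And>B. B \<in> C \<Longrightarrow> \<exists>D'\<subseteq>D. B = \<Union>D'"
proof -
  \<comment> \<open>\<open>cell x\<close> is the atom of \<open>x\<close> in the set algebra
    generated by \<open>C\<close> on \<open>\<Union>C\<close>; for \<open>x\<close> outside that
    union it is empty.\<close>
  define cell where "cell x = {y \<in> \<Union>C. \<forall>B\<in>C. y \<in> B \<longleftrightarrow> x \<in> B}" for x
  define D where "D = cell ` \<Union>C"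
  \<comment> \<open>A cell depends only on which members of \<open>C\<close> contain its point, so
    there are at most as many cells as subsets of \<open>C\<close>.\<close>
  have "cell x = {y \<in> \<Union>C. \<forall>B\<in>C. y \<in> B \<longleftrightarrow> B \<in> {B\<in>C. x \<in> B}}" for x
    by (auto simp: cell_def)
  then have "D \<subseteq> (\<lambda>S. {y \<in> \<Union>C. \<forall>B\<in>C. y \<in> B \<longleftrightarrow> B \<in> S}) ` Pow C"
    unfolding D_def by blast
  then have fin: "finite D"
    using assms(1) by (meson finite_Pow_iff finite_imageI finite_subset)
  have "cell x \<in> sets m" for x
  proof -
    have "cell x = \<Union>C - (\<Union>B\<in>C. if x \<in> B then \<Union>C - B else B)"
      unfolding cell_def by (auto split: if_splits)
    moreover have "\<Union>C \<in> sets m"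
      using assms by (intro sets.finite_Union) auto
    moreover have "(\<Union>B\<in>C. if x \<in> B then \<Union>C - B else B) \<in> sets m"
      using assms \<open>\<Union>C \<in> sets m\<close> by (intro sets.finite_UN) auto
    ultimately show ?thesis
      by auto
  qed
  then have sets: "D \<subseteq> sets m"
    by (auto simp: D_def)
  have disj: "disjoint D"
    by (auto simp: D_def disjoint_def cell_def)
  have self: "x \<in> cell x" if "x \<in> \<Union>C" for x
    using that by (auto simp: cell_def)
  then have ne: "{} \<notin> D" and Un: "\<Union>D = \<Union>C"
    by (auto simp: D_def cell_def)
  have split: "\<exists>D'\<subseteq>D. B = \<Union>D'" if "B \<in> C" for B
  proof (intro exI[of _ "cell ` B"] conjI)
    show "cell ` B \<subseteq> D"
      using that by (auto simp: D_def)
    show "B = \<Union>(cell ` B)"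
      using that self by (auto simp: cell_def)
  qed
  show ?thesis
    by (rule that[OF fin sets disj ne Un split])
qed

text \<open>Mass, mean and second moment of the Poisson law. Shifting the index cancels one factor
  \<open>k\<close> against the factorial, and the factor \<open>Suc k\<close> that remains in the
  second moment splits into the two earlier sums.\<close>

lemma poisson_moment_sums:
  fixes r :: real
  shows "(\<lambda>k. exp (- r) * r ^ k / fact k) sums 1"
    and "(\<lambda>k. real k * (exp (- r) * r ^ k / fact k)) sums r"
    and "(\<lambda>k. (real k)\<^sup>2 * (exp (- r) * r ^ k / fact k)) sums (r\<^sup>2 + r)"
proof -
  show s0: "(\<lambda>k. exp (- r) * r ^ k / fact k) sums 1"
    using sums_mult[OF exp_converges[of r], of "exp (- r)"]
    by (simp add: field_simps exp_minus)
  have "(\<lambda>k. real (Suc k) * (exp (- r) * r ^ Suc k / fact (Suc k))) sums (r * 1)"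
    using sums_mult[OF s0, of r] by (simp add: field_simps del: of_nat_Suc)
  then show s1: "(\<lambda>k. real k * (exp (- r) * r ^ k / fact k)) sums r"
    by (subst (asm) sums_Suc_iff) simp
  have eq: "(real (Suc k))\<^sup>2 * (exp (- r) * r ^ Suc k / fact (Suc k))
      = r * (real k * (exp (- r) * r ^ k / fact k) + exp (- r) * r ^ k / fact k)" for k
  proof -
    have "(real (Suc k))\<^sup>2 * (exp (- r) * r ^ Suc k / fact (Suc k))
        = real (Suc k) * (r * (exp (- r) * r ^ k / fact k))"
      by (simp add: field_simps power2_eq_square del: of_nat_Suc)
    then show ?thesis
      by (simp add: algebra_simps add_divide_distrib)
  qed
  have "(\<lambda>k. (real (Suc k))\<^sup>2 * (exp (- r) * r ^ Suc k / fact (Suc k))) sums (r * (r + 1))"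
    unfolding eq by (intro sums_mult sums_add s0 s1)
  then show "(\<lambda>k. (real k)\<^sup>2 * (exp (- r) * r ^ k / fact k)) sums (r\<^sup>2 + r)"
    by (subst (asm) sums_Suc_iff) (simp add: algebra_simps power2_eq_square)
qed

section \<open>Independence of the noise over disjoint regions\<close>

locale poisson_random = prob_space M for M :: "'w measure" +
  fixes m :: "'e measure" and N :: "'w \<Rightarrow> 'e measure"
  assumes prm: "poisson_random_measure M m N"
begin

lemma sets_N: "\<omega> \<in> space M \<Longrightarrow> sets (N \<omega>) = sets m"
  using prm[unfolded poisson_random_measure_def, THEN conjunct1] by (rule bspec)

lemma measurable_emeasure_N: "B \<in> sets m \<Longrightarrow> (\<lambda>\<omega>. emeasure (N \<omega>) B) \<in> borel_measurable M"
  using prm[unfolded poisson_random_measure_def, THEN conjunct2, THEN conjunct1] by (rule bspec)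

lemma prob_N_eq:
  assumes "B \<in> sets m" "emeasure m B < \<infinity>"
  shows "prob {\<omega>\<in>space M. emeasure (N \<omega>) B = of_nat k} = exp (- measure m B) * measure m B ^ k / fact k"
  using prm[unfolded poisson_random_measure_def, THEN conjunct2, THEN conjunct2, THEN conjunct1] assms
  by simp

lemma indep_N:
  assumes "finite I" "(B :: nat \<Rightarrow> 'e set) ` I \<subseteq> sets m" "disjoint_family_on B I"
  shows "indep_vars (\<lambda>_. borel) (\<lambda>i \<omega>. emeasure (N \<omega>) (B i)) I"
  using prm[unfolded poisson_random_measure_def, THEN conjunct2, THEN conjunct2, THEN conjunct2, THEN conjunct2]
    assms by (elim allE impE)

text \<open>Bare set systems are used here and in the next two definitions because
  \<open>indep_sets\<close> and \<open>indep_set\<close> take such systems;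
  \<open>region_algebra\<close> repackages the last one as a measure, so that functions can be
  called measurable for it.\<close>

definition count_events :: "'e set \<Rightarrow> 'w set set" where
  "count_events B = {(\<lambda>\<omega>. emeasure (N \<omega>) B) -` A \<inter> space M | A. A \<in> sets borel}"

definition family_events :: "'e set set \<Rightarrow> 'w set set" where
  "family_events C = sigma_sets (space M) (\<Union>B\<in>C. count_events B)"

definition region_events :: "'e set \<Rightarrow> 'w set set" where
  "region_events P = sigma_sets (space M) (\<Union>B\<in>{B\<in>sets m. B \<subseteq> P}. count_events B)"

lemma count_events_subset: "count_events B \<subseteq> Pow (space M)"
  by (auto simp: count_events_def)

lemma count_events_subset_events: "B \<in> sets m \<Longrightarrow> count_events B \<subseteq> events"
  using measurable_sets[OF measurable_emeasure_N[of B]] unfolding count_events_def by blast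

lemma family_events_subset_events: "C \<subseteq> sets m \<Longrightarrow> family_events C \<subseteq> events"
  unfolding family_events_def
  by (intro sets.sigma_sets_subset UN_least count_events_subset_events) auto

lemma region_events_subset_events: "region_events P \<subseteq> events"
  unfolding region_events_def
  by (intro sets.sigma_sets_subset UN_least count_events_subset_events) auto

lemma family_events_mono: "C \<subseteq> D \<Longrightarrow> family_events C \<subseteq> family_events D"
  unfolding family_events_def by (intro sigma_sets_mono') auto

lemma Int_stable_count_events: "Int_stable (count_events B)"
proof (rule Int_stableI)
  fix a b assume "a \<in> count_events B" "b \<in> count_events B"
  then obtain A A' where "A \<in> sets borel" "A' \<in> sets borel"
    "a = (\<lambda>\<omega>. emeasure (N \<omega>) B) -` A \<inter> space M" "b = (\<lambda>\<omega>. emeasure (N \<omega>) B) -` A' \<inter> space M"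
    by (auto simp: count_events_def)
  then show "a \<inter> b \<in> count_events B"
    unfolding count_events_def by (auto intro!: exI[of _ "A \<inter> A'"])
qed

text \<open>Independent counts stay independent after grouping them into two blocks. The condition
  \<open>C \<inter> D = {}\<close> is separate because \<open>disjoint (C \<union> D)\<close> allows
  a set that belongs to both families.\<close>

lemma indep_disjoint_families:
  assumes "finite C" "finite D" "C \<subseteq> sets m" "D \<subseteq> sets m" "disjoint (C \<union> D)" "C \<inter> D = {}"
  shows "indep_set (family_events C) (family_events D)"
proof -
  \<comment> \<open>The independence of counts is formulated for families indexed by naturals, hence
    the enumeration; its injectivity turns distinct indices into disjoint sets.\<close>
  obtain h where h: "bij_betw h {0..<card (C \<union> D)} (C \<union> D)"
    using ex_bij_betw_nat_finite[of "C \<union> D"] assms by auto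
  define I where "I = {0..<card (C \<union> D)}"
  define I1 where "I1 = {i\<in>I. h i \<in> C}"
  define I2 where "I2 = {i\<in>I. h i \<in> D}"
  have im: "h ` I = C \<union> D" and inj: "inj_on h I"
    using h by (auto simp: bij_betw_def I_def)
  have hI: "h ` I1 = C" "h ` I2 = D" "I = I1 \<union> I2" "I1 \<inter> I2 = {}"
  proof -
    have *: "h ` {i\<in>I. h i \<in> E} = E" if "E \<subseteq> C \<union> D" for E
    proof (intro equalityI subsetI)
      fix x assume "x \<in> E"
      then have "x \<in> h ` I"
        using that im by auto
      then show "x \<in> h ` {i\<in>I. h i \<in> E}"
        using \<open>x \<in> E\<close> by auto
    qed auto
    show "h ` I1 = C" "h ` I2 = D"
      unfolding I1_def I2_def by (rule *, simp)+
    show "I1 \<inter> I2 = {}"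
      using assms(6) unfolding I1_def I2_def by auto
    have "h i \<in> C \<union> D" if "i \<in> I" for i
      using that im by auto
    then show "I = I1 \<union> I2"
      unfolding I1_def I2_def by auto
  qed
  have "disjoint_family_on h I"
  proof (unfold disjoint_family_on_def, intro ballI impI)
    fix i j assume "i \<in> I" "j \<in> I" "i \<noteq> j"
    then have "h i \<in> C \<union> D" "h j \<in> C \<union> D" "h i \<noteq> h j"
      using im inj by (auto simp: inj_on_eq_iff)
    with assms(5) show "h i \<inter> h j = {}"
      by (rule disjointD)
  qed
  then have "indep_vars (\<lambda>_. borel) (\<lambda>i \<omega>. emeasure (N \<omega>) (h i)) I"
    using assms im by (intro indep_N) (auto simp: I_def)
  then have ind: "indep_sets (\<lambda>i. count_events (h i)) I"
    unfolding indep_vars_def2 count_events_def by simp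
  have "indep_sets (\<lambda>j. sigma_sets (space M) (\<Union>i\<in>case_bool I1 I2 j. count_events (h i))) UNIV"
  proof (rule indep_sets_collect_sigma)
    show "indep_sets (\<lambda>i. count_events (h i)) (\<Union>j\<in>UNIV. case_bool I1 I2 j)"
      using ind hI(3) by (simp add: UNIV_bool Un_commute)
    show "disjoint_family_on (case_bool I1 I2) UNIV"
      using hI(4) by (auto simp: disjoint_family_on_def split: bool.splits)
  qed (rule Int_stable_count_events)
  moreover have "(\<lambda>j. sigma_sets (space M) (\<Union>i\<in>case_bool I1 I2 j. count_events (h i)))
      = case_bool (family_events C) (family_events D)"
    using hI(1,2) by (auto simp: fun_eq_iff family_events_def split: bool.splits)
  ultimately show ?thesis
    by (simp add: indep_set_def)
qed

text \<open>By additivity of \<open>N \<omega>\<close> the count of a member of \<open>C\<close> is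
  the sum of the counts of the finitely many pieces in \<open>D\<close> that make it up, so it is
  decided by the counts of the pieces.\<close>

lemma family_events_refine:
  assumes "finite D" "D \<subseteq> sets m" "disjoint D" "\<And>B. B \<in> C \<Longrightarrow> \<exists>D'\<subseteq>D. B = \<Union>D'"
  shows "family_events C \<subseteq> family_events D"
proof -
  define S where "S = sigma (space M) (\<Union>B\<in>D. count_events B)"
  have setsS: "sets S = family_events D" and spaceS: "space S = space M"
    unfolding S_def family_events_def using count_events_subset by (auto simp: sets_measure_of_conv space_measure_of_conv)
  have meas: "(\<lambda>\<omega>. emeasure (N \<omega>) B) \<in> borel_measurable S" if "B \<in> D" for B
  proof (rule measurableI)
    fix A :: "ennreal set" assume "A \<in> sets borel"
    with that show "(\<lambda>\<omega>. emeasure (N \<omega>) B) -` A \<inter> space S \<in> sets S"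
      unfolding setsS spaceS family_events_def count_events_def
      by (intro sigma_sets.Basic) blast
  qed auto
  have "count_events B \<subseteq> sets S" if BC: "B \<in> C" for B
  proof -
    obtain D' where D': "D' \<subseteq> D" "B = \<Union>D'"
      using assms(4)[OF BC] by blast
    have "emeasure (N \<omega>) B = (\<Sum>E\<in>D'. emeasure (N \<omega>) E)" if "\<omega> \<in> space M" for \<omega>
    proof -
      have "disjoint D'" "finite D'" "D' \<subseteq> sets (N \<omega>)"
        using D' assms sets_N[OF that] by (auto intro: pairwise_subset finite_subset simp del: subset_iff)
      then have "(\<Sum>E\<in>D'. emeasure (N \<omega>) E) = emeasure (N \<omega>) (\<Union>E\<in>D'. E)"
        by (intro sum_emeasure) (auto simp: disjoint_family_on_def disjoint_def)
      then show ?thesis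
        using D'(2) by simp
    qed
    moreover have "(\<lambda>\<omega>. \<Sum>E\<in>D'. emeasure (N \<omega>) E) \<in> borel_measurable S"
      using D'(1) meas by (intro borel_measurable_sum) auto
    ultimately have "(\<lambda>\<omega>. emeasure (N \<omega>) B) \<in> borel_measurable S"
      using spaceS by (subst measurable_cong) auto
    from measurable_sets[OF this] show ?thesis
      unfolding count_events_def spaceS by blast
  qed
  then have "sigma_sets (space S) (\<Union>B\<in>C. count_events B) \<subseteq> sets S"
    by (intro sets.sigma_sets_subset) blast
  then show ?thesis
    by (simp add: family_events_def spaceS setsS)
qed

text \<open>Overlaps within \<open>C\<close> or within \<open>D\<close> are removed by refining each
  family separately; refinement keeps the unions, so the pieces of the two families remain
  apart.\<close>

lemma indep_families:
  assumes "finite C" "finite D" "C \<subseteq> sets m" "D \<subseteq> sets m" "\<Union>C \<inter> \<Union>D = {}"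
  shows "indep_set (family_events C) (family_events D)"
proof -
  obtain C' where C': "finite C'" "C' \<subseteq> sets m" "disjoint C'" "{} \<notin> C'" "\<Union>C' = \<Union>C"
    "\<And>B. B \<in> C \<Longrightarrow> \<exists>E\<subseteq>C'. B = \<Union>E"
    using finite_disjoint_refinement[OF assms(1,3)] by metis
  obtain D' where D': "finite D'" "D' \<subseteq> sets m" "disjoint D'" "{} \<notin> D'" "\<Union>D' = \<Union>D"
    "\<And>B. B \<in> D \<Longrightarrow> \<exists>E\<subseteq>D'. B = \<Union>E"
    using finite_disjoint_refinement[OF assms(2,4)] by metis
  have sep: "B \<inter> E = {}" if "B \<in> C'" "E \<in> D'" for B E
    using that C'(5) D'(5) assms(5) by blast
  have "disjoint (C' \<union> D')"
    using sep C'(3) D'(3) by (intro disjoint_union) auto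
  \<comment> \<open>A piece common to both families would be disjoint from itself, hence empty, and
    empty pieces are excluded.\<close>
  moreover have "C' \<inter> D' = {}"
    using sep C'(4) by fastforce
  ultimately have "indep_set (family_events C') (family_events D')"
    using C' D' by (intro indep_disjoint_families) auto
  moreover have "family_events C \<subseteq> family_events C'" "family_events D \<subseteq> family_events D'"
    by (rule family_events_refine[OF C'(1-3,6)], assumption)
       (rule family_events_refine[OF D'(1-3,6)])
  ultimately show ?thesis
    unfolding indep_sets2_eq by blast
qed

text \<open>Events decided by two finite families are both decided by the union of the families.
  This closure under intersection is what extends independence from finite families to the
  sigma-algebra of a whole region.\<close>

lemma Int_stable_finite_families:
  "Int_stable (\<Union>C\<in>{C. finite C \<and> C \<subseteq> sets m \<and> \<Union>C \<subseteq> P}. family_events C)"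
proof (rule Int_stableI)
  fix a b
  assume "a \<in> (\<Union>C\<in>{C. finite C \<and> C \<subseteq> sets m \<and> \<Union>C \<subseteq> P}. family_events C)"
    "b \<in> (\<Union>C\<in>{C. finite C \<and> C \<subseteq> sets m \<and> \<Union>C \<subseteq> P}. family_events C)"
  then obtain C D where C: "finite C" "C \<subseteq> sets m" "\<Union>C \<subseteq> P" "a \<in> family_events C"
    and D: "finite D" "D \<subseteq> sets m" "\<Union>D \<subseteq> P" "b \<in> family_events D"
    by blast
  have "a \<in> family_events (C \<union> D)" "b \<in> family_events (C \<union> D)"
    using C(4) D(4) family_events_mono[of C "C \<union> D"] family_events_mono[of D "C \<union> D"] by auto
  moreover have "sigma_algebra (space M) (family_events (C \<union> D))"
    unfolding family_events_def using count_events_subset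
    by (intro sigma_algebra_sigma_sets) blast
  then interpret S: sigma_algebra "space M" "family_events (C \<union> D)" .
  have "a \<inter> b \<in> family_events (C \<union> D)"
    using calculation by blast
  then show "a \<inter> b \<in> (\<Union>C\<in>{C. finite C \<and> C \<subseteq> sets m \<and> \<Union>C \<subseteq> P}. family_events C)"
    using C D by (intro UN_I[of "C \<union> D"]) auto
qed

lemma indep_regions:
  assumes "P \<inter> Q = {}"
  shows "indep_set (region_events P) (region_events Q)"
proof -
  define G where "G P = (\<Union>C\<in>{C. finite C \<and> C \<subseteq> sets m \<and> \<Union>C \<subseteq> P}. family_events C)" for P
  have "indep_set (G P) (G Q)"
    unfolding indep_sets2_eq
  proof (intro conjI ballI)
    show "G P \<subseteq> events" "G Q \<subseteq> events"
      unfolding G_def using family_events_subset_events by blast+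
    fix a b assume "a \<in> G P" "b \<in> G Q"
    then obtain C D where C: "finite C" "C \<subseteq> sets m" "\<Union>C \<subseteq> P" "a \<in> family_events C"
      and D: "finite D" "D \<subseteq> sets m" "\<Union>D \<subseteq> Q" "b \<in> family_events D"
      unfolding G_def by blast
    have "\<Union>C \<inter> \<Union>D = {}"
      using C(3) D(3) assms by blast
    then have "indep_set (family_events C) (family_events D)"
      using C D by (intro indep_families)
    then show "prob (a \<inter> b) = prob a * prob b"
      using C(4) D(4) unfolding indep_sets2_eq by blast
  qed
  then have "indep_set (sigma_sets (space M) (G P)) (sigma_sets (space M) (G Q))"
    unfolding G_def by (intro indep_set_sigma_sets Int_stable_finite_families)
  moreover have "region_events P \<subseteq> sigma_sets (space M) (G P)" for P
    unfolding region_events_def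
  proof (rule sigma_sets_mono', rule subsetI)
    fix a assume "a \<in> (\<Union>B\<in>{B\<in>sets m. B \<subseteq> P}. count_events B)"
    then obtain B where "B \<in> sets m" "B \<subseteq> P" "a \<in> count_events B"
      by blast
    then show "a \<in> G P"
      unfolding G_def family_events_def by (intro UN_I[of "{B}"]) auto
  qed
  ultimately show ?thesis
    unfolding indep_sets2_eq by blast
qed

definition region_algebra :: "'e set \<Rightarrow> 'w measure" where
  "region_algebra P = sigma (space M) (\<Union>B\<in>{B\<in>sets m. B \<subseteq> P}. count_events B)"

lemma sets_region_algebra: "sets (region_algebra P) = region_events P"
  and space_region_algebra [simp]: "space (region_algebra P) = space M"
proof -
  have "(\<Union>B\<in>{B\<in>sets m. B \<subseteq> P}. count_events B) \<subseteq> Pow (space M)"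
    using count_events_subset by blast
  then show "sets (region_algebra P) = region_events P" "space (region_algebra P) = space M"
    unfolding region_algebra_def region_events_def by (simp_all add: sets_measure_of space_measure_of_conv)
qed

lemma measurable_region_algebra:
  "f \<in> borel_measurable (region_algebra P) \<Longrightarrow> f \<in> borel_measurable M"
  using measurable_mono[of borel borel "region_algebra P" M] region_events_subset_events[of P]
  by (auto simp: sets_region_algebra)

lemma region_algebra_mono:
  "P \<subseteq> Q \<Longrightarrow> f \<in> borel_measurable (region_algebra P) \<Longrightarrow> f \<in> borel_measurable (region_algebra Q)"
proof -
  assume "P \<subseteq> Q"
  then have "region_events P \<subseteq> region_events Q"
    unfolding region_events_def by (intro sigma_sets_mono') auto
  then show "f \<in> borel_measurable (region_algebra P) \<Longrightarrow> f \<in> borel_measurable (region_algebra Q)"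
    using measurable_mono[of borel borel "region_algebra P" "region_algebra Q"]
    by (auto simp: sets_region_algebra)
qed

lemma emeasure_N_region:
  assumes "B \<in> sets m" "B \<subseteq> P"
  shows "(\<lambda>\<omega>. emeasure (N \<omega>) B) \<in> borel_measurable (region_algebra P)"
proof (rule measurableI)
  fix A :: "ennreal set" assume "A \<in> sets borel"
  with assms show "(\<lambda>\<omega>. emeasure (N \<omega>) B) -` A \<inter> space (region_algebra P) \<in> sets (region_algebra P)"
    unfolding sets_region_algebra space_region_algebra region_events_def count_events_def
    by (intro sigma_sets.Basic) blast
qed auto

lemma region_expectation_mult:
  fixes X Y :: "'w \<Rightarrow> real"
  assumes "P \<inter> Q = {}" "X \<in> borel_measurable (region_algebra P)" "Y \<in> borel_measurable (region_algebra Q)"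
    and "integrable M X" "integrable M Y"
  shows "integrable M (\<lambda>\<omega>. X \<omega> * Y \<omega>)" "expectation (\<lambda>\<omega>. X \<omega> * Y \<omega>) = expectation X * expectation Y"
proof -
  have *: "sigma_sets (space M) {f -` A \<inter> space M |A. A \<in> sets borel} \<subseteq> region_events R"
    if "f \<in> borel_measurable (region_algebra R)" for f :: "'w \<Rightarrow> real" and R
  proof -
    have "{f -` A \<inter> space M |A. A \<in> sets borel} \<subseteq> sets (region_algebra R)"
      using measurable_sets[OF that] by auto
    from sets.sigma_sets_subset[OF this] show ?thesis
      by (simp add: sets_region_algebra)
  qed
  have "indep_var borel X borel Y"
    unfolding indep_var_eq
    using indep_regions[OF assms(1)] *[OF assms(2)] *[OF assms(3)]
      measurable_region_algebra[OF assms(2)] measurable_region_algebra[OF assms(3)]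
    unfolding indep_sets2_eq by blast
  then show "integrable M (\<lambda>\<omega>. X \<omega> * Y \<omega>)" "expectation (\<lambda>\<omega>. X \<omega> * Y \<omega>) = expectation X * expectation Y"
    using indep_var_integrable indep_var_lebesgue_integral assms by blast+
qed

section \<open>Moments of the compensated counts\<close>

lemma measurable_count_set [measurable]:
  "B \<in> sets m \<Longrightarrow> {\<omega>\<in>space M. emeasure (N \<omega>) B = of_nat k} \<in> events"
  using measurable_sets[OF measurable_emeasure_N, of B "{of_nat k}"]
  by (simp add: vimage_def Int_def conj_commute)

text \<open>The definition does not demand that counts be natural numbers; almost surely they are,
  because the Poisson probabilities add up to 1.\<close>

lemma AE_count:
  assumes "B \<in> sets m" "emeasure m B < \<infinity>"
  shows "AE \<omega> in M. \<exists>k::nat. emeasure (N \<omega>) B = of_nat k"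
proof -
  define E where "E k = {\<omega>\<in>space M. emeasure (N \<omega>) B = of_nat k}" for k :: nat
  have E: "range E \<subseteq> events"
    using assms(1) by (auto simp: E_def)
  have "disjoint_family E"
    by (auto simp: disjoint_family_on_def E_def)
  then have "(\<lambda>k. prob (E k)) sums prob (\<Union>k. E k)"
    using E by (intro finite_measure_UNION) auto
  moreover have "(\<lambda>k. prob (E k)) sums 1"
    unfolding E_def prob_N_eq[OF assms] by (rule poisson_moment_sums(1))
  ultimately have "prob (\<Union>k. E k) = 1"
    by (rule sums_unique2)
  moreover have "(\<Union>k. E k) \<in> events"
    using E by auto
  ultimately have "AE \<omega> in M. \<omega> \<in> (\<Union>k. E k)"
    using AE_prob_1 by blast
  then show ?thesis
    by eventually_elim (auto simp: E_def)
qed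

lemma AE_count_finite:
  assumes "B \<in> sets m" "emeasure m B < \<infinity>"
  shows "AE \<omega> in M. emeasure (N \<omega>) B < \<infinity>"
  using AE_count[OF assms] by eventually_elim (auto simp: ennreal_of_nat_eq_real_of_nat)

text \<open>Up to a null set the space splits into the events \<open>E k\<close> on which the count
  is \<open>k\<close>, so the expectation becomes a series over the Poisson weights.\<close>

lemma nn_integral_count:
  fixes F :: "real \<Rightarrow> real"
  assumes B: "B \<in> sets m" "emeasure m B < \<infinity>" and F: "\<And>x. 0 \<le> F x"
    and S: "(\<lambda>k. F (real k) * (exp (- measure m B) * measure m B ^ k / fact k)) sums S"
  shows "(\<integral>\<^sup>+\<omega>. ennreal (F (measure (N \<omega>) B)) \<partial>M) = ennreal S"
proof -
  define E where "E k = {\<omega>\<in>space M. emeasure (N \<omega>) B = of_nat k}" for k :: nat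
  have E: "E k \<in> events" for k
    using B(1) by (auto simp: E_def)
  have "AE \<omega> in M. ennreal (F (measure (N \<omega>) B)) = (\<Sum>k. ennreal (F (real k)) * indicator (E k) \<omega>)"
    using AE_count[OF B] AE_space
  proof eventually_elim
    case (elim \<omega>)
    then obtain j :: nat where j: "emeasure (N \<omega>) B = of_nat j"
      by auto
    have "(\<Sum>k. ennreal (F (real k)) * indicator (E k) \<omega>) = (\<Sum>k. if k = j then ennreal (F (real j)) else 0)"
      using j elim by (intro suminf_cong) (auto simp: E_def indicator_def)
    also have "\<dots> = ennreal (F (real j))"
      using suminf_finite[of "{j}" "\<lambda>k. if k = j then ennreal (F (real j)) else 0"] by simp
    finally show ?case
      using j by (simp add: measure_def)
  qed
  then have "(\<integral>\<^sup>+\<omega>. ennreal (F (measure (N \<omega>) B)) \<partial>M)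
      = (\<integral>\<^sup>+\<omega>. (\<Sum>k. ennreal (F (real k)) * indicator (E k) \<omega>) \<partial>M)"
    by (rule nn_integral_cong_AE)
  also have "\<dots> = (\<Sum>k. \<integral>\<^sup>+\<omega>. ennreal (F (real k)) * indicator (E k) \<omega> \<partial>M)"
    using E by (intro nn_integral_suminf) auto
  also have "\<dots> = (\<Sum>k. ennreal (F (real k) * (exp (- measure m B) * measure m B ^ k / fact k)))"
    using E F by (simp add: nn_integral_cmult_indicator emeasure_eq_measure prob_N_eq[OF B, folded E_def]
        ennreal_mult[symmetric] del: times_divide_eq_right)
  also have "\<dots> = ennreal S"
    using S F by (intro suminf_ennreal_eq) auto
  finally show ?thesis .
qed

text \<open>\<open>measure\<close> turns an infinite count into 0. For \<open>B\<close> of finite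
  intensity this affects only a null set, so additivity of \<open>compensated\<close> is claimed
  almost surely.\<close>

definition compensated :: "'e set \<Rightarrow> 'w \<Rightarrow> real" where
  "compensated B \<omega> = measure (N \<omega>) B - measure m B"

lemma compensated_region [measurable]:
  assumes "B \<in> sets m" "B \<subseteq> P"
  shows "compensated B \<in> borel_measurable (region_algebra P)"
  unfolding compensated_def[abs_def] measure_def
  using emeasure_N_region[OF assms] by measurable

lemma measurable_compensated [measurable]:
  "B \<in> sets m \<Longrightarrow> compensated B \<in> borel_measurable M"
  using compensated_region[of B B] measurable_region_algebra by blast

lemma compensated_moments:
  assumes B: "B \<in> sets m" "emeasure m B < \<infinity>"
  shows "integrable M (compensated B)" "expectation (compensated B) = 0"
    and "integrable M (\<lambda>\<omega>. compensated B \<omega> * compensated B \<omega>)"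
    and "expectation (\<lambda>\<omega>. compensated B \<omega> * compensated B \<omega>) = measure m B"
proof -
  let ?n = "\<lambda>\<omega>. measure (N \<omega>) B" and ?r = "measure m B"
  have [measurable]: "?n \<in> borel_measurable M"
    using measurable_compensated[OF B(1)] borel_measurable_add[of "compensated B" M "\<lambda>_. ?r"]
    by (simp add: compensated_def[abs_def])
  have "(\<integral>\<^sup>+\<omega>. ennreal (?n \<omega>) \<partial>M) = ennreal ?r"
    using nn_integral_count[OF B, of "\<lambda>x. \<bar>x\<bar>"] poisson_moment_sums(2)[of ?r] by simp
  then have n1: "integrable M ?n" "expectation ?n = ?r"
    using nn_integral_eq_integrable[of ?n M ?r] by auto
  have "(\<integral>\<^sup>+\<omega>. ennreal ((?n \<omega>)\<^sup>2) \<partial>M) = ennreal (?r\<^sup>2 + ?r)"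
    using nn_integral_count[OF B, of "\<lambda>x. x\<^sup>2"] poisson_moment_sums(3)[of ?r] by simp
  then have n2: "integrable M (\<lambda>\<omega>. (?n \<omega>)\<^sup>2)" "expectation (\<lambda>\<omega>. (?n \<omega>)\<^sup>2) = ?r\<^sup>2 + ?r"
    using nn_integral_eq_integrable[of "\<lambda>\<omega>. (?n \<omega>)\<^sup>2" M "?r\<^sup>2 + ?r"] by auto
  show "integrable M (compensated B)" "expectation (compensated B) = 0"
    using n1 by (auto simp: compensated_def[abs_def] prob_space)
  have eq: "compensated B \<omega> * compensated B \<omega> = (?n \<omega>)\<^sup>2 - 2 * ?r * ?n \<omega> + ?r\<^sup>2" for \<omega>
    by (simp add: compensated_def power2_eq_square algebra_simps)
  show "integrable M (\<lambda>\<omega>. compensated B \<omega> * compensated B \<omega>)"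
    unfolding eq using n1 n2 by auto
  show "expectation (\<lambda>\<omega>. compensated B \<omega> * compensated B \<omega>) = ?r"
    unfolding eq using n1 n2 by (simp add: prob_space power2_eq_square)
qed

lemma compensated_split:
  assumes "A \<in> sets m" "B \<in> sets m" "emeasure m A < \<infinity>" "emeasure m B < \<infinity>" "A \<inter> B = {}"
  shows "AE \<omega> in M. compensated (A \<union> B) \<omega> = compensated A \<omega> + compensated B \<omega>"
  using AE_count_finite[OF assms(1,3)] AE_count_finite[OF assms(2,4)] AE_space
proof eventually_elim
  case (elim \<omega>)
  then have "measure (N \<omega>) (A \<union> B) = measure (N \<omega>) A + measure (N \<omega>) B"
    using assms sets_N[of \<omega>] by (intro measure_Union) auto
  moreover have "measure m (A \<union> B) = measure m A + measure m B"
    using assms by (intro measure_Union) auto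
  ultimately show ?case
    by (simp add: compensated_def)
qed

lemma compensated_orthogonal:
  assumes "A \<in> sets m" "B \<in> sets m" "emeasure m A < \<infinity>" "emeasure m B < \<infinity>" "A \<inter> B = {}"
  shows "integrable M (\<lambda>\<omega>. compensated A \<omega> * compensated B \<omega>)"
    and "expectation (\<lambda>\<omega>. compensated A \<omega> * compensated B \<omega>) = 0"
  using region_expectation_mult[OF assms(5), of "compensated A" "compensated B"]
    compensated_region[of A A] compensated_region[of B B] compensated_moments[of A] compensated_moments[of B] assms
  by auto

text \<open>Both sets are cut along \<open>C \<inter> D\<close>. Of the four resulting products only
  the square over the common part can have nonzero mean; the other three pair disjoint sets.\<close>

lemma compensated_covariance:
  assumes C: "C \<in> sets m" "emeasure m C < \<infinity>" and D: "D \<in> sets m" "emeasure m D < \<infinity>"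
  shows "integrable M (\<lambda>\<omega>. compensated C \<omega> * compensated D \<omega>)"
    and "expectation (\<lambda>\<omega>. compensated C \<omega> * compensated D \<omega>) = measure m (C \<inter> D)"
proof -
  define I where "I = C \<inter> D"
  have fin: "emeasure m A < \<infinity>" if "A \<subseteq> C \<or> A \<subseteq> D" for A
    using that C D by (meson emeasure_mono le_less_trans)
  have sets [measurable]: "I \<in> sets m" "C - D \<in> sets m" "D - C \<in> sets m" "C \<in> sets m" "D \<in> sets m"
    using C D by (auto simp: I_def)
  have finI: "emeasure m I < \<infinity>" "emeasure m (C - D) < \<infinity>" "emeasure m (D - C) < \<infinity>"
    using fin[of I] fin[of "C - D"] fin[of "D - C"] by (auto simp: I_def)
  have sC: "AE \<omega> in M. compensated C \<omega> = compensated I \<omega> + compensated (C - D) \<omega>"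
    using compensated_split[of I "C - D"] sets finI by (auto simp: I_def Int_Diff_Un)
  have sD: "AE \<omega> in M. compensated D \<omega> = compensated I \<omega> + compensated (D - C) \<omega>"
  proof -
    have "I \<union> (D - C) = D" "I \<inter> (D - C) = {}"
      by (auto simp: I_def)
    then show ?thesis
      using compensated_split[of I "D - C"] sets finI by simp
  qed
  let ?R = "\<lambda>\<omega>. compensated I \<omega> * compensated I \<omega> + compensated I \<omega> * compensated (D - C) \<omega>
    + compensated (C - D) \<omega> * compensated I \<omega> + compensated (C - D) \<omega> * compensated (D - C) \<omega>"
  have AE: "AE \<omega> in M. compensated C \<omega> * compensated D \<omega> = ?R \<omega>"
    using sC sD by eventually_elim (simp add: algebra_simps)
  note o1 = compensated_orthogonal[of I "D - C"] and o2 = compensated_orthogonal[of "C - D" I]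
    and o3 = compensated_orthogonal[of "C - D" "D - C"] and v = compensated_moments[of I]
  have disj: "I \<inter> (D - C) = {}" "(C - D) \<inter> I = {}" "(C - D) \<inter> (D - C) = {}"
    by (auto simp: I_def)
  have R: "integrable M ?R" "expectation ?R = measure m I"
    using o1 o2 o3 v sets finI disj by auto
  show "integrable M (\<lambda>\<omega>. compensated C \<omega> * compensated D \<omega>)"
    using R(1) integrable_cong_AE[OF _ _ AE] sets by simp
  show "expectation (\<lambda>\<omega>. compensated C \<omega> * compensated D \<omega>) = measure m (C \<inter> D)"
    using R(2) integral_cong_AE[OF _ _ AE] sets by (simp add: I_def)
qed

lemma integrable_bounded_mult:
  fixes X Y :: "'w \<Rightarrow> real"
  assumes "X \<in> borel_measurable M" "bounded (X ` space M)" "integrable M Y"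
  shows "integrable M (\<lambda>\<omega>. X \<omega> * Y \<omega>)"
proof -
  obtain c where c: "\<And>\<omega>. \<omega> \<in> space M \<Longrightarrow> \<bar>X \<omega>\<bar> \<le> c"
    using assms(2) by (auto simp: bounded_iff)
  have "integrable M (\<lambda>\<omega>. c * Y \<omega>)"
    using assms(3) by simp
  then show ?thesis
  proof (rule Bochner_Integration.integrable_bound)
    show "AE \<omega> in M. norm (X \<omega> * Y \<omega>) \<le> norm (c * Y \<omega>)"
    proof (rule AE_I2)
      fix \<omega> assume "\<omega> \<in> space M"
      then have "\<bar>X \<omega>\<bar> \<le> \<bar>c\<bar>"
        using c by force
      then show "norm (X \<omega> * Y \<omega>) \<le> norm (c * Y \<omega>)"
        by (simp add: abs_mult mult_right_mono)
    qed
  qed (use assms in auto)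
qed

lemma region_compensated_expectation:
  assumes X: "X \<in> borel_measurable (region_algebra P)" "integrable M X"
    and R: "R \<in> sets m" "emeasure m R < \<infinity>" "P \<inter> R = {}"
  shows "integrable M (\<lambda>\<omega>. X \<omega> * compensated R \<omega>)" "expectation (\<lambda>\<omega>. X \<omega> * compensated R \<omega>) = 0"
  using region_expectation_mult[OF R(3) X(1) _ X(2), of "compensated R"] compensated_moments[OF R(1,2)] R
  by auto

text \<open>
  Typically \<open>P\<close> is the past and \<open>Q\<close> the future of the later of two starting times: the part of
  \<open>R\<close> in \<open>P\<close> joins \<open>X\<close> and is independent of \<open>R'\<close>, so only \<open>R \<inter> Q\<close> contributes.
\<close>

lemma region_compensated_covariance:
  assumes X: "X \<in> borel_measurable (region_algebra P)" "bounded (X ` space M)"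
    and R: "R \<in> sets m" "emeasure m R < \<infinity>" "R \<subseteq> P \<union> Q"
    and R': "R' \<in> sets m" "emeasure m R' < \<infinity>" "R' \<subseteq> Q"
    and PQ: "P \<inter> Q = {}" "R \<inter> P \<in> sets m"
  shows "integrable M (\<lambda>\<omega>. X \<omega> * (compensated R \<omega> * compensated R' \<omega>))"
    and "expectation (\<lambda>\<omega>. X \<omega> * (compensated R \<omega> * compensated R' \<omega>)) = expectation X * measure m (R \<inter> R')"
proof -
  define R1 where "R1 = R \<inter> P"
  define R2 where "R2 = R - P"
  have sets [measurable]: "R \<in> sets m" "R' \<in> sets m" "R1 \<in> sets m" "R2 \<in> sets m"
    using R R' PQ sets.Diff[OF R(1) PQ(2)] by (auto simp: R1_def R2_def Diff_Int)
  have fin: "emeasure m R1 < \<infinity>" "emeasure m R2 < \<infinity>"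
    using R by (auto simp: R1_def R2_def intro: le_less_trans[OF emeasure_mono])
  have [measurable]: "X \<in> borel_measurable M"
    using X measurable_region_algebra by blast
  have "AE \<omega> in M. compensated R \<omega> = compensated R1 \<omega> + compensated R2 \<omega>"
    using compensated_split[of R1 R2] sets fin by (auto simp: R1_def R2_def Int_Diff_Un)
  then have AE: "AE \<omega> in M. X \<omega> * (compensated R \<omega> * compensated R' \<omega>)
      = X \<omega> * compensated R1 \<omega> * compensated R' \<omega> + X \<omega> * (compensated R2 \<omega> * compensated R' \<omega>)"
    by eventually_elim (simp add: algebra_simps)
  have iX: "integrable M X"
    using integrable_bounded_mult[OF _ X(2), of "\<lambda>_. 1"] by simp
  have [measurable]: "X \<in> borel_measurable (region_algebra P)" "compensated R1 \<in> borel_measurable (region_algebra P)"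
    using X sets by (auto intro!: compensated_region simp: R1_def)
  have "(\<lambda>\<omega>. X \<omega> * compensated R1 \<omega>) \<in> borel_measurable (region_algebra P)"
    by measurable
  moreover have "integrable M (\<lambda>\<omega>. X \<omega> * compensated R1 \<omega>)"
    using integrable_bounded_mult[OF _ X(2)] compensated_moments(1) sets fin by simp
  ultimately have 1: "integrable M (\<lambda>\<omega>. X \<omega> * compensated R1 \<omega> * compensated R' \<omega>)"
    "expectation (\<lambda>\<omega>. X \<omega> * compensated R1 \<omega> * compensated R' \<omega>) = 0"
    using region_compensated_expectation[of "\<lambda>\<omega>. X \<omega> * compensated R1 \<omega>" P R'] R' PQ(1) by blast+
  have "R2 \<subseteq> Q"
    using R(3) by (auto simp: R2_def)
  then have [measurable]: "compensated R2 \<in> borel_measurable (region_algebra Q)"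
    "compensated R' \<in> borel_measurable (region_algebra Q)"
    using sets R'(3) by (auto intro!: compensated_region)
  have "(\<lambda>\<omega>. compensated R2 \<omega> * compensated R' \<omega>) \<in> borel_measurable (region_algebra Q)"
    by measurable
  then have 2: "integrable M (\<lambda>\<omega>. X \<omega> * (compensated R2 \<omega> * compensated R' \<omega>))"
    "expectation (\<lambda>\<omega>. X \<omega> * (compensated R2 \<omega> * compensated R' \<omega>)) = expectation X * measure m (R2 \<inter> R')"
    using region_expectation_mult[OF PQ(1) X(1) _ iX, of "\<lambda>\<omega>. compensated R2 \<omega> * compensated R' \<omega>"]
      compensated_covariance[of R2 R'] sets fin R'(2) by auto
  have "R2 \<inter> R' = R \<inter> R'"
    using R'(3) PQ(1) by (auto simp: R2_def)
  then show "integrable M (\<lambda>\<omega>. X \<omega> * (compensated R \<omega> * compensated R' \<omega>))"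
    "expectation (\<lambda>\<omega>. X \<omega> * (compensated R \<omega> * compensated R' \<omega>)) = expectation X * measure m (R \<inter> R')"
    using integrable_cong_AE[OF _ _ AE] integral_cong_AE[OF _ _ AE] 1 2 by auto
qed

end

section \<open>The isometry of the compensated integral\<close>

text \<open>Young's inequality for \<open>f = g - (g - f)\<close>: a substitute for the triangle
  inequality in L2 that also holds for infinite integrals. The factor of the main term can be as
  close to 1 as desired, so nothing is lost in the limit.\<close>

lemma second_moment_perturb:
  fixes f g :: "'x \<Rightarrow> real"
  assumes [measurable]: "f \<in> borel_measurable P" "g \<in> borel_measurable P" and e: "0 < e"
  shows "(\<integral>\<^sup>+x. ennreal ((f x)\<^sup>2) \<partial>P)
    \<le> ennreal (1 + e) * (\<integral>\<^sup>+x. ennreal ((g x)\<^sup>2) \<partial>P) + ennreal (1 + 1 / e) * (\<integral>\<^sup>+x. ennreal ((g x - f x)\<^sup>2) \<partial>P)"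
proof -
  have "(f x)\<^sup>2 \<le> (1 + e) * (g x)\<^sup>2 + (1 + 1 / e) * (g x - f x)\<^sup>2" for x
  proof -
    \<comment> \<open>The gap between the two sides of the claim is exactly this quotient.\<close>
    have "0 \<le> (e * g x + (g x - f x))\<^sup>2 / e"
      using e by simp
    also have "\<dots> = (1 + e) * (g x)\<^sup>2 + (1 + 1 / e) * (g x - f x)\<^sup>2 - (f x)\<^sup>2"
      using e by (simp add: field_simps power2_eq_square)
    finally show ?thesis
      by simp
  qed
  then have "(\<integral>\<^sup>+x. ennreal ((f x)\<^sup>2) \<partial>P)
      \<le> (\<integral>\<^sup>+x. ennreal (1 + e) * ennreal ((g x)\<^sup>2) + ennreal (1 + 1 / e) * ennreal ((g x - f x)\<^sup>2) \<partial>P)"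
    using e by (intro nn_integral_mono) (auto simp: ennreal_mult[symmetric] ennreal_plus[symmetric] simp del: ennreal_plus intro!: ennreal_leI)
  also have "\<dots> = ennreal (1 + e) * (\<integral>\<^sup>+x. ennreal ((g x)\<^sup>2) \<partial>P) + ennreal (1 + 1 / e) * (\<integral>\<^sup>+x. ennreal ((g x - f x)\<^sup>2) \<partial>P)"
    by (subst nn_integral_add) (auto simp: nn_integral_cmult)
  finally show ?thesis .
qed

section \<open>Simple predictable integrands and their isometry\<close>

locale poisson_noise = poisson_random M "intensity K" N + K: sigma_finite_measure K
  for M :: "'w measure" and K :: "'k measure" and N :: "'w \<Rightarrow> (real \<times> 'k) measure"
begin

definition strip :: "('w \<Rightarrow> real) \<times> real \<times> real \<times> 'k set \<Rightarrow> (real \<times> 'k) set" where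
  "strip = (\<lambda>(\<xi>, a, b, B). {a<..b} \<times> B)"

abbreviation simple :: "('w, 'k) simple_integrand \<Rightarrow> bool" where
  "simple \<equiv> simple_predictable (noise_filtration M K N) (space M) K"

lemma rectangle_in_sets [measurable (raw)]:
  "A \<in> sets borel \<Longrightarrow> A \<subseteq> {0..} \<Longrightarrow> B \<in> sets K \<Longrightarrow> A \<times> B \<in> sets (intensity K)"
  unfolding intensity_def by (intro pair_measureI) (auto simp: sets_restrict_space image_iff Int_absorb1 intro!: bexI[of _ A])

lemma emeasure_strip:
  assumes "0 \<le> a" "a \<le> b" "B \<in> sets K"
  shows "emeasure (intensity K) ({a<..b} \<times> B) = ennreal (b - a) * emeasure K B"
proof -
  have "emeasure (restrict_space lborel {0..}) {a<..b} = ennreal (b - a)"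
    using assms by (subst emeasure_restrict_space) auto
  moreover have "{a<..b} \<in> sets (restrict_space lborel {0::real..})"
    using assms by (auto simp: sets_restrict_space image_iff intro!: bexI[of _ "{a<..b}"])
  ultimately show ?thesis
    unfolding intensity_def using assms by (simp add: K.emeasure_pair_measure_Times)
qed

text \<open>This identification makes independence over regions applicable: a coefficient known at
  time \<open>a\<close> is decided by the noise on \<open>{0..a} \<times> space K\<close>, which is
  disjoint from every strip over \<open>{a<..b}\<close>.\<close>

lemma noise_filtration_eq: "noise_filtration M K N a = region_algebra ({0..a} \<times> space K)"
proof -
  have "{(\<lambda>\<omega>. emeasure (N \<omega>) B) -` A \<inter> space M |A B.
        A \<in> sets borel \<and> B \<in> sets (intensity K) \<and> B \<subseteq> {0..a} \<times> space K}
      = (\<Union>B\<in>{B\<in>sets (intensity K). B \<subseteq> {0..a} \<times> space K}. count_events B)"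
    unfolding count_events_def by blast
  then show ?thesis
    unfolding noise_filtration_def region_algebra_def by simp
qed

lemma simple_term:
  assumes "simple S" "x \<in> set S" "x = (\<xi>, a, b, B)"
  shows "0 \<le> a" "a \<le> b" "\<xi> \<in> borel_measurable (region_algebra ({0..a} \<times> space K))"
    "bounded (\<xi> ` space M)" "B \<in> sets K" "emeasure K B < \<infinity>"
    "strip x \<in> sets (intensity K)" "emeasure (intensity K) (strip x) < \<infinity>"
    "measure (intensity K) (strip x) = (b - a) * measure K B"
    "strip x \<subseteq> {a<..} \<times> space K"
proof -
  note S = bspec[OF assms(1)[unfolded simple_predictable_def] assms(2), unfolded assms(3) prod.case]
  then show *: "0 \<le> a" "a \<le> b" "bounded (\<xi> ` space M)" "B \<in> sets K" "emeasure K B < \<infinity>"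
    by simp_all
  show "\<xi> \<in> borel_measurable (region_algebra ({0..a} \<times> space K))"
    using S by (simp add: noise_filtration_eq)
  show "strip x \<in> sets (intensity K)"
    unfolding assms(3) strip_def using * by (auto intro!: rectangle_in_sets)
  show "emeasure (intensity K) (strip x) < \<infinity>"
    unfolding assms(3) strip_def using * by (simp add: emeasure_strip ennreal_mult_less_top)
  show "measure (intensity K) (strip x) = (b - a) * measure K B"
    unfolding assms(3) strip_def measure_def prod.case using * by (simp add: emeasure_strip enn2real_mult)
  show "strip x \<subseteq> {a<..} \<times> space K"
    unfolding assms(3) strip_def using sets.sets_into_space[OF *(4)] by auto
qed

text \<open>With the starting times ordered, both coefficients are known at the later one, and the
  strip of \<open>y\<close> lies in the future of that time, while the strip of \<open>x\<close> may
  straddle it. This is the configuration of \<open>region_compensated_covariance\<close>.\<close>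

lemma simple_covariance_ordered:
  assumes S: "simple S" "x \<in> set S" "y \<in> set S" and le: "fst (snd x) \<le> fst (snd y)"
  shows "integrable M (\<lambda>\<omega>. (fst x \<omega> * compensated (strip x) \<omega>) * (fst y \<omega> * compensated (strip y) \<omega>))"
    and "expectation (\<lambda>\<omega>. (fst x \<omega> * compensated (strip x) \<omega>) * (fst y \<omega> * compensated (strip y) \<omega>))
      = expectation (\<lambda>\<omega>. fst x \<omega> * fst y \<omega>) * measure (intensity K) (strip x \<inter> strip y)"
proof -
  obtain \<xi> a b B where x: "x = (\<xi>, a, b, B)"
    by (metis prod_cases4)
  obtain \<eta> a' b' B' where y: "y = (\<eta>, a', b', B')"
    by (metis prod_cases4)
  note X = simple_term[OF S(1,2) x] and Y = simple_term[OF S(1,3) y]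
  let ?P = "{0..a'} \<times> space K" and ?Q = "{a'<..} \<times> space K"
  have "\<xi> \<in> borel_measurable (region_algebra ?P)"
    using le by (intro region_algebra_mono[OF _ X(3)]) (auto simp: x y)
  then have m: "(\<lambda>\<omega>. \<xi> \<omega> * \<eta> \<omega>) \<in> borel_measurable (region_algebra ?P)"
    using Y(3) by measurable
  have b: "bounded ((\<lambda>\<omega>. \<xi> \<omega> * \<eta> \<omega>) ` space M)"
  proof -
    obtain c d where "\<And>\<omega>. \<omega> \<in> space M \<Longrightarrow> \<bar>\<xi> \<omega>\<bar> \<le> c" "\<And>\<omega>. \<omega> \<in> space M \<Longrightarrow> \<bar>\<eta> \<omega>\<bar> \<le> d"
      using X(4) Y(4) by (auto simp: bounded_iff)
    then show ?thesis
      unfolding bounded_iff by (intro exI[of _ "c * d"]) (auto simp: abs_mult intro!: mult_mono order_trans[OF abs_ge_zero])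
  qed
  have "strip x \<inter> ?P = {a<..min b a'} \<times> B"
    using X(1) sets.sets_into_space[OF X(5)] unfolding x strip_def by auto
  then have P: "strip x \<inter> ?P \<in> sets (intensity K)"
    using X(1,5) by (auto intro!: rectangle_in_sets)
  have "strip x \<subseteq> ?P \<union> ?Q"
    using X(1,10) by fastforce
  note C = region_compensated_covariance[OF m b X(7,8) this Y(7,8,10) _ P]
  have eq: "(\<xi> \<omega> * compensated (strip x) \<omega>) * (\<eta> \<omega> * compensated (strip y) \<omega>)
      = \<xi> \<omega> * \<eta> \<omega> * (compensated (strip x) \<omega> * compensated (strip y) \<omega>)" for \<omega>
    by simp
  have PQ: "?P \<inter> ?Q = {}"
    by auto
  show "integrable M (\<lambda>\<omega>. (fst x \<omega> * compensated (strip x) \<omega>) * (fst y \<omega> * compensated (strip y) \<omega>))"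
    using C(1)[OF PQ] unfolding eq[symmetric] by (simp add: x y)
  show "expectation (\<lambda>\<omega>. (fst x \<omega> * compensated (strip x) \<omega>) * (fst y \<omega> * compensated (strip y) \<omega>))
      = expectation (\<lambda>\<omega>. fst x \<omega> * fst y \<omega>) * measure (intensity K) (strip x \<inter> strip y)"
    using C(2)[OF PQ] unfolding eq[symmetric] by (simp add: x y)
qed

lemma simple_covariance:
  assumes S: "simple S" "x \<in> set S" "y \<in> set S"
  shows "integrable M (\<lambda>\<omega>. (fst x \<omega> * compensated (strip x) \<omega>) * (fst y \<omega> * compensated (strip y) \<omega>))"
    and "expectation (\<lambda>\<omega>. (fst x \<omega> * compensated (strip x) \<omega>) * (fst y \<omega> * compensated (strip y) \<omega>))
      = expectation (\<lambda>\<omega>. fst x \<omega> * fst y \<omega>) * measure (intensity K) (strip x \<inter> strip y)"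
  using simple_covariance_ordered[OF S] simple_covariance_ordered[OF S(1,3,2)]
  by (cases "fst (snd x) \<le> fst (snd y)"; simp add: mult.commute Int_commute)+

text \<open>The sum runs over list positions and not over \<open>set S\<close>, because a tuple may
  occur more than once in the list. The product \<open>(b - a) * measure K B\<close> is the
  intensity of the strip.\<close>

lemma simple_integral_eq:
  assumes "simple S"
  shows "simple_integral K N S \<omega> = (\<Sum>i<length S. fst (S ! i) \<omega> * compensated (strip (S ! i)) \<omega>)"
proof -
  have "simple_integral K N S \<omega> = (\<Sum>i<length S. (case S ! i of (\<xi>, a, b, B) \<Rightarrow>
      \<xi> \<omega> * (measure (N \<omega>) ({a<..b} \<times> B) - (b - a) * measure K B)))"
    unfolding simple_integral_def by (simp add: sum_list_sum_nth lessThan_atLeast0)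
  also have "\<dots> = (\<Sum>i<length S. fst (S ! i) \<omega> * compensated (strip (S ! i)) \<omega>)"
  proof (rule sum.cong)
    fix i assume "i \<in> {..<length S}"
    moreover obtain \<xi> a b B where x: "S ! i = (\<xi>, a, b, B)"
      by (metis prod_cases4)
    ultimately show "(case S ! i of (\<xi>, a, b, B) \<Rightarrow>
        \<xi> \<omega> * (measure (N \<omega>) ({a<..b} \<times> B) - (b - a) * measure K B))
        = fst (S ! i) \<omega> * compensated (strip (S ! i)) \<omega>"
      using simple_term(9)[OF assms nth_mem x] by (simp add: x compensated_def strip_def)
  qed simp
  finally show ?thesis .
qed

lemma simple_value_eq:
  "simple_value S \<omega> s k = (\<Sum>i<length S. fst (S ! i) \<omega> * indicator (strip (S ! i)) (s, k))"
proof -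
  have "simple_value S \<omega> s k = (\<Sum>i<length S. (case S ! i of (\<xi>, a, b, B) \<Rightarrow>
      \<xi> \<omega> * indicator {a<..b} s * indicator B k))"
    unfolding simple_value_def by (simp add: sum_list_sum_nth lessThan_atLeast0)
  also have "\<dots> = (\<Sum>i<length S. fst (S ! i) \<omega> * indicator (strip (S ! i)) (s, k))"
    by (intro sum.cong) (auto simp: strip_def indicator_def split: prod.splits)
  finally show ?thesis .
qed

lemma simple_coefficient:
  assumes "simple S" "i < length S"
  shows "fst (S ! i) \<in> borel_measurable M" "bounded (fst (S ! i) ` space M)" "integrable M (fst (S ! i))"
proof -
  obtain \<xi> a b B where x: "S ! i = (\<xi>, a, b, B)"
    by (metis prod_cases4)
  note X = simple_term[OF assms(1) nth_mem[OF assms(2)] x]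
  show 1: "fst (S ! i) \<in> borel_measurable M" "bounded (fst (S ! i) ` space M)"
    using X(3,4) measurable_region_algebra by (auto simp: x)
  show "integrable M (fst (S ! i))"
    using integrable_bounded_mult[OF 1, of "\<lambda>_. 1"] by simp
qed

lemma simple_strip:
  assumes "simple S" "i < length S"
  shows "strip (S ! i) \<in> sets (intensity K)" "emeasure (intensity K) (strip (S ! i)) < \<infinity>"
proof -
  obtain \<xi> a b B where x: "S ! i = (\<xi>, a, b, B)"
    by (metis prod_cases4)
  from simple_term[OF assms(1) nth_mem[OF assms(2)] x]
  show "strip (S ! i) \<in> sets (intensity K)" "emeasure (intensity K) (strip (S ! i)) < \<infinity>"
    by auto
qed

lemma simple_integral_mean:
  assumes "simple S"
  shows "integrable M (simple_integral K N S)" "expectation (simple_integral K N S) = 0"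
proof -
  have *: "integrable M (\<lambda>\<omega>. fst (S ! i) \<omega> * compensated (strip (S ! i)) \<omega>)
      \<and> expectation (\<lambda>\<omega>. fst (S ! i) \<omega> * compensated (strip (S ! i)) \<omega>) = 0" if "i < length S" for i
  proof -
    obtain \<xi> a b B where x: "S ! i = (\<xi>, a, b, B)"
      by (metis prod_cases4)
    note X = simple_term[OF assms nth_mem[OF that] x]
    have "({0..a} \<times> space K) \<inter> strip (S ! i) = {}"
      using X(10) by auto
    with region_compensated_expectation[OF X(3) _ X(7,8)] simple_coefficient(3)[OF assms that]
    show ?thesis
      by (simp add: x)
  qed
  have eq: "simple_integral K N S = (\<lambda>\<omega>. \<Sum>i<length S. fst (S ! i) \<omega> * compensated (strip (S ! i)) \<omega>)"
    using simple_integral_eq[OF assms] by auto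
  show "integrable M (simple_integral K N S)" "expectation (simple_integral K N S) = 0"
    unfolding eq using * by (auto simp: Bochner_Integration.integral_sum)
qed

text \<open>Both sides equal the same double sum \<open>V\<close> over pairs of terms. Strips may
  overlap, so mixed terms need not vanish: on one side they come from the covariances of the
  compensated counts, on the other from integrating the indicator of the intersection.\<close>

lemma simple_isometry:
  assumes "simple S"
  shows "integrable M (\<lambda>\<omega>. (simple_integral K N S \<omega>)\<^sup>2)"
    and "(\<integral>\<^sup>+(s, k). (\<integral>\<^sup>+\<omega>. ennreal ((simple_value S \<omega> s k)\<^sup>2) \<partial>M) \<partial>intensity K)
      = (\<integral>\<^sup>+\<omega>. ennreal ((simple_integral K N S \<omega>)\<^sup>2) \<partial>M)"
proof -
  define n where "n = length S"
  define c where "c i j = expectation (\<lambda>\<omega>. fst (S ! i) \<omega> * fst (S ! j) \<omega>)" for i j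
  define V where "V = (\<Sum>i<n. \<Sum>j<n. c i j * measure (intensity K) (strip (S ! i) \<inter> strip (S ! j)))"
  have sq: "(simple_integral K N S \<omega>)\<^sup>2 = (\<Sum>i<n. \<Sum>j<n.
      (fst (S ! i) \<omega> * compensated (strip (S ! i)) \<omega>) * (fst (S ! j) \<omega> * compensated (strip (S ! j)) \<omega>))" for \<omega>
    by (simp add: simple_integral_eq[OF assms] power2_eq_square sum_product n_def)
  note cov = simple_covariance[OF assms nth_mem[of _ S, folded n_def] nth_mem[of _ S, folded n_def]]
  show int: "integrable M (\<lambda>\<omega>. (simple_integral K N S \<omega>)\<^sup>2)"
    unfolding sq using cov(1) by (intro Bochner_Integration.integrable_sum) auto
  have "expectation (\<lambda>\<omega>. (simple_integral K N S \<omega>)\<^sup>2) = (\<Sum>i<n. \<Sum>j<n. expectation (\<lambda>\<omega>.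
      (fst (S ! i) \<omega> * compensated (strip (S ! i)) \<omega>) * (fst (S ! j) \<omega> * compensated (strip (S ! j)) \<omega>)))"
    unfolding sq using cov(1)
    by (subst Bochner_Integration.integral_sum)
      (auto intro!: Bochner_Integration.integrable_sum sum.cong Bochner_Integration.integral_sum)
  also have "\<dots> = V"
    unfolding V_def c_def using cov(2) by (intro sum.cong) auto
  finally have "expectation (\<lambda>\<omega>. (simple_integral K N S \<omega>)\<^sup>2) = V" .
  then have 1: "(\<integral>\<^sup>+\<omega>. ennreal ((simple_integral K N S \<omega>)\<^sup>2) \<partial>M) = ennreal V"
    using nn_integral_eq_integral[OF int] by simp
  \<comment> \<open>\<open>h\<close> is the mean square of the integrand at a point, written as a
    finite combination of indicators so that its integral over the intensity can be read
    off.\<close>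
  define h where "h z = (\<Sum>i<n. \<Sum>j<n. c i j * indicator (strip (S ! i) \<inter> strip (S ! j)) z)" for z
  have c: "integrable M (\<lambda>\<omega>. fst (S ! i) \<omega> * fst (S ! j) \<omega>)" if "i < n" "j < n" for i j
    using integrable_bounded_mult simple_coefficient[OF assms] that by (simp add: n_def)
  have inner: "(\<integral>\<^sup>+\<omega>. ennreal ((simple_value S \<omega> s k)\<^sup>2) \<partial>M) = ennreal (h (s, k)) \<and> 0 \<le> h (s, k)" for s k
  proof -
    have eq: "(simple_value S \<omega> s k)\<^sup>2 = (\<Sum>i<n. \<Sum>j<n.
        (fst (S ! i) \<omega> * fst (S ! j) \<omega>) * indicator (strip (S ! i) \<inter> strip (S ! j)) (s, k))" for \<omega>
      unfolding simple_value_eq power2_eq_square sum_product n_def indicator_inter_arith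
      by (simp only: mult_ac)
    have int: "integrable M (\<lambda>\<omega>. (simple_value S \<omega> s k)\<^sup>2)"
      unfolding eq by (intro Bochner_Integration.integrable_sum Bochner_Integration.integrable_mult_left c) auto
    moreover have "expectation (\<lambda>\<omega>. (simple_value S \<omega> s k)\<^sup>2) = h (s, k)"
      unfolding eq h_def c_def using c
      by (subst Bochner_Integration.integral_sum)
        (auto intro!: Bochner_Integration.integrable_sum sum.cong simp: Bochner_Integration.integral_sum simp del: sum_mult_indicator)
    ultimately show ?thesis
      using nn_integral_eq_integral[OF int] integral_nonneg_AE[where M = M and f = "\<lambda>\<omega>. (simple_value S \<omega> s k)\<^sup>2"] by auto
  qed
  have fin: "emeasure (intensity K) (strip (S ! i) \<inter> strip (S ! j)) < \<infinity>" if "i < n" "j < n" for i j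
    using simple_strip[OF assms] that by (auto simp: n_def intro: le_less_trans[OF emeasure_mono])
  have meas: "strip (S ! i) \<inter> strip (S ! j) \<in> sets (intensity K)" if "i < n" "j < n" for i j
    using simple_strip[OF assms] that by (auto simp: n_def)
  have ih: "integrable (intensity K) h"
    unfolding h_def[abs_def] using fin meas
    by (intro Bochner_Integration.integrable_sum integrable_mult_right integrable_real_indicator) auto
  have "(\<integral>z. h z \<partial>intensity K) = V"
  proof -
    have int: "integrable (intensity K) (\<lambda>z. c i j * indicator (strip (S ! i) \<inter> strip (S ! j)) z)" if "i < n" "j < n" for i j
      using fin[OF that] meas[OF that] by (intro integrable_mult_right integrable_real_indicator)
    have "(\<integral>z. h z \<partial>intensity K) = (\<Sum>i<n. \<integral>z. (\<Sum>j<n. c i j * indicator (strip (S ! i) \<inter> strip (S ! j)) z) \<partial>intensity K)"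
      unfolding h_def using int by (intro Bochner_Integration.integral_sum Bochner_Integration.integrable_sum) simp
    also have "\<dots> = (\<Sum>i<n. \<Sum>j<n. \<integral>z. c i j * indicator (strip (S ! i) \<inter> strip (S ! j)) z \<partial>intensity K)"
      using int by (intro sum.cong refl Bochner_Integration.integral_sum) simp
    also have "\<dots> = V"
      unfolding V_def using meas sets.sets_into_space
      by (intro sum.cong refl) (simp add: Int_absorb2)
    finally show ?thesis .
  qed
  moreover have "0 \<le> h z" for z
    using inner[of "fst z" "snd z"] by simp
  ultimately have "(\<integral>\<^sup>+z. ennreal (h z) \<partial>intensity K) = ennreal V"
    using nn_integral_eq_integral[OF ih] by simp
  moreover have "(\<lambda>(s, k). \<integral>\<^sup>+\<omega>. ennreal ((simple_value S \<omega> s k)\<^sup>2) \<partial>M) = (\<lambda>z. ennreal (h z))"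
    using inner by auto
  ultimately show "(\<integral>\<^sup>+(s, k). (\<integral>\<^sup>+\<omega>. ennreal ((simple_value S \<omega> s k)\<^sup>2) \<partial>M) \<partial>intensity K)
      = (\<integral>\<^sup>+\<omega>. ennreal ((simple_integral K N S \<omega>)\<^sup>2) \<partial>M)"
    using 1 by simp
qed

section \<open>Predictable fields and the passage to the limit\<close>

lemma sets_noise_filtration: "sets (noise_filtration M K N a) \<subseteq> events"
  using region_events_subset_events by (simp add: noise_filtration_eq sets_region_algebra)

lemma sets_noise_filtration_le_space: "A \<in> sets (noise_filtration M K N a) \<Longrightarrow> A \<subseteq> space M"
  using sets_noise_filtration sets.sets_into_space by blast

lemma predictable_generator_subset:
  "{A \<times> {a<..b} \<times> B | A a b B. 0 \<le> a \<and> a \<le> b \<and> A \<in> sets (noise_filtration M K N a) \<and> B \<in> sets L}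
    \<subseteq> Pow (space M \<times> {0<..} \<times> space L)"
proof (rule subsetI)
  fix y
  assume "y \<in> {A \<times> {a<..b} \<times> B | A a b B. 0 \<le> a \<and> a \<le> b \<and> A \<in> sets (noise_filtration M K N a) \<and> B \<in> sets L}"
  then obtain A a b B where "y = A \<times> {a<..b} \<times> B" "0 \<le> a" "A \<in> sets (noise_filtration M K N a)" "B \<in> sets L"
    by blast
  then show "y \<in> Pow (space M \<times> {0<..} \<times> space L)"
    using sets_noise_filtration_le_space[of A a] sets.sets_into_space[of B L] by auto
qed

text \<open>Adaptedness is forgotten: rectangles are tested with an arbitrary event as first factor,
  which is enough for the sectionwise and joint measurability below.\<close>

lemma measurable_predictable_algebra:
  assumes "\<phi> \<in> space Q \<rightarrow> space M \<times> {0<..} \<times> space L"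
    and "\<And>A a b B. 0 \<le> a \<Longrightarrow> A \<in> events \<Longrightarrow> B \<in> sets L \<Longrightarrow> \<phi> -` (A \<times> {a<..b} \<times> B) \<inter> space Q \<in> sets Q"
  shows "\<phi> \<in> measurable Q (predictable_algebra (noise_filtration M K N) (space M) L)"
  unfolding predictable_algebra_def
proof (rule measurable_measure_of[OF predictable_generator_subset assms(1)])
  fix y
  assume "y \<in> {A \<times> {a<..b} \<times> B | A a b B. 0 \<le> a \<and> a \<le> b \<and> A \<in> sets (noise_filtration M K N a) \<and> B \<in> sets L}"
  then obtain A a b B where "y = A \<times> {a<..b} \<times> B" "0 \<le> a" "A \<in> sets (noise_filtration M K N a)" "B \<in> sets L"
    by blast
  then show "\<phi> -` y \<inter> space Q \<in> sets Q"
    using assms(2)[of a A B b] sets_noise_filtration by auto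
qed

lemma predictable_section:
  assumes "f \<in> borel_measurable (predictable_algebra (noise_filtration M K N) (space M) L)" "0 < s" "k \<in> space L"
  shows "(\<lambda>\<omega>. f (\<omega>, s, k)) \<in> borel_measurable M"
proof (rule measurable_compose[OF measurable_predictable_algebra assms(1)])
  show "(\<lambda>\<omega>. (\<omega>, s, k)) \<in> space M \<rightarrow> space M \<times> {0<..} \<times> space L"
    using assms by auto
  fix A B and a b :: real assume "A \<in> events" "B \<in> sets L"
  moreover have "(\<lambda>\<omega>. (\<omega>, s, k)) -` (A \<times> {a<..b} \<times> B) \<inter> space M = (if s \<in> {a<..b} \<and> k \<in> B then A \<inter> space M else {})"
    by auto
  ultimately show "(\<lambda>\<omega>. (\<omega>, s, k)) -` (A \<times> {a<..b} \<times> B) \<inter> space M \<in> events"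
    by auto
qed

lemma space_intensity: "space (intensity K) = {0..} \<times> space K"
  by (simp add: intensity_def space_pair_measure space_restrict_space)

text \<open>The predictable algebra lives over positive times, while the space of the intensity
  contains time 0 as well; extension by 0 bridges the difference.\<close>

lemma predictable_jointly_measurable:
  fixes f :: "'w \<times> real \<times> 'k \<Rightarrow> real"
  assumes "f \<in> borel_measurable (predictable_algebra (noise_filtration M K N) (space M) K)"
  shows "(\<lambda>z. if z \<in> UNIV \<times> {0<..} \<times> UNIV then f z else 0) \<in> borel_measurable (M \<Otimes>\<^sub>M intensity K)"
proof -
  let ?P = "M \<Otimes>\<^sub>M intensity K" and ?\<Omega> = "UNIV \<times> {0::real<..} \<times> UNIV :: ('w \<times> real \<times> 'k) set"
  have "?\<Omega> \<inter> space ?P = space M \<times> {0<..} \<times> space K"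
    by (auto simp: space_pair_measure space_intensity)
  moreover from this have "space (restrict_space ?P ?\<Omega>) = space M \<times> {0<..} \<times> space K"
    by (simp add: space_restrict_space)
  ultimately have \<Omega>: "?\<Omega> \<inter> space ?P \<in> sets ?P" and space: "space (restrict_space ?P ?\<Omega>) = space M \<times> {0<..} \<times> space K"
    by (auto intro!: pair_measureI rectangle_in_sets)
  have "(\<lambda>z. z) \<in> measurable (restrict_space ?P ?\<Omega>) (predictable_algebra (noise_filtration M K N) (space M) K)"
  proof (rule measurable_predictable_algebra)
    show "(\<lambda>z. z) \<in> space (restrict_space ?P ?\<Omega>) \<rightarrow> space M \<times> {0<..} \<times> space K"
      by (simp add: space)
    fix A B and a b :: real assume *: "0 \<le> a" "A \<in> events" "B \<in> sets K"
    then have "A \<times> {a<..b} \<times> B \<in> sets ?P"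
      by (auto intro!: pair_measureI rectangle_in_sets)
    moreover have "(\<lambda>z. z) -` (A \<times> {a<..b} \<times> B) \<inter> space (restrict_space ?P ?\<Omega>) = ?\<Omega> \<inter> (A \<times> {a<..b} \<times> B)"
      unfolding space using *(1) sets.sets_into_space[OF *(2)] sets.sets_into_space[OF *(3)] by auto
    ultimately show "(\<lambda>z. z) -` (A \<times> {a<..b} \<times> B) \<inter> space (restrict_space ?P ?\<Omega>) \<in> sets (restrict_space ?P ?\<Omega>)"
      by (auto simp: sets_restrict_space)
  qed
  from measurable_compose[OF this assms] have "f \<in> borel_measurable (restrict_space ?P ?\<Omega>)"
    by simp
  then show ?thesis
    using measurable_restrict_space_iff[OF \<Omega>, of "0::real" borel f] by simp
qed

text \<open>Zero mean and the isometry, the latter as an inequality, survive the mean square limit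
  from simple integrands. The hypothesis \<open>X0\<close> makes \<open>X\<close> agree with its
  extension by 0, which is jointly measurable.\<close>

lemma compensated_integral_bounds:
  assumes "has_compensated_integral M K N X Z" and X0: "\<And>\<omega> s k. s \<le> 0 \<Longrightarrow> X \<omega> s k = 0"
  shows "integrable M Z" "integrable M (\<lambda>\<omega>. (Z \<omega>)\<^sup>2)" "expectation Z = 0"
    and "(\<integral>\<^sup>+(s, k). (\<integral>\<^sup>+\<omega>. ennreal ((X \<omega> s k)\<^sup>2) \<partial>M) \<partial>intensity K) \<le> (\<integral>\<^sup>+\<omega>. ennreal ((Z \<omega>)\<^sup>2) \<partial>M)"
proof -
  obtain S where X: "(\<lambda>(\<omega>, s, k). X \<omega> s k) \<in> borel_measurable (predictable_algebra (noise_filtration M K N) (space M) K)"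
    and Z [measurable]: "Z \<in> borel_measurable M"
    and S: "\<And>n. simple (S n)"
    and d: "(\<lambda>n. \<integral>\<^sup>+(s, k). (\<integral>\<^sup>+\<omega>. ennreal ((simple_value (S n) \<omega> s k - X \<omega> s k)\<^sup>2) \<partial>M) \<partial>intensity K) \<longlonglongrightarrow> 0"
    and e: "(\<lambda>n. \<integral>\<^sup>+\<omega>. ennreal ((simple_integral K N (S n) \<omega> - Z \<omega>)\<^sup>2) \<partial>M) \<longlonglongrightarrow> 0"
    using assms(1) unfolding has_compensated_integral_def by (elim conjE exE) blast
  define I where "I n = simple_integral K N (S n)" for n
  define dd where "dd n = (\<integral>\<^sup>+(s, k). (\<integral>\<^sup>+\<omega>. ennreal ((simple_value (S n) \<omega> s k - X \<omega> s k)\<^sup>2) \<partial>M) \<partial>intensity K)" for n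
  define ee where "ee n = (\<integral>\<^sup>+\<omega>. ennreal ((I n \<omega> - Z \<omega>)\<^sup>2) \<partial>M)" for n
  define A where "A = (\<integral>\<^sup>+(s, k). (\<integral>\<^sup>+\<omega>. ennreal ((X \<omega> s k)\<^sup>2) \<partial>M) \<partial>intensity K)"
  define B where "B = (\<integral>\<^sup>+\<omega>. ennreal ((Z \<omega>)\<^sup>2) \<partial>M)"
  note I = simple_integral_mean[OF S, folded I_def] and I2 = simple_isometry[OF S, folded I_def]
  have [measurable]: "I n \<in> borel_measurable M" for n
    using I(1) by auto
  have ee: "ee \<longlonglongrightarrow> 0" and dd: "dd \<longlonglongrightarrow> 0"
    using d e by (simp_all add: ee_def[abs_def] dd_def[abs_def] I_def)
  \<comment> \<open>A single approximation with finite mean square error already shows that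
    \<open>Z\<close> is square integrable.\<close>
  have "eventually (\<lambda>n. ee n < 1) sequentially"
    using ee by (rule order_tendstoD) simp
  then obtain n where n: "ee n < 1"
    by (auto simp: eventually_sequentially)
  have Ifin: "(\<integral>\<^sup>+\<omega>. ennreal ((I n \<omega>)\<^sup>2) \<partial>M) < \<infinity>"
    using I2(1)[of n] by (simp add: real_integrable_def less_top)
  have "B \<le> ennreal (1 + 1) * (\<integral>\<^sup>+\<omega>. ennreal ((I n \<omega>)\<^sup>2) \<partial>M) + ennreal (1 + 1 / 1) * ee n"
    unfolding B_def ee_def by (rule second_moment_perturb) auto
  also have "\<dots> < \<infinity>"
    using n Ifin by (auto simp: ennreal_mult_less_top intro: less_trans[OF n])
  finally have Bfin: "B < \<infinity>" .
  show Z2: "integrable M (\<lambda>\<omega>. (Z \<omega>)\<^sup>2)"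
    using Bfin unfolding B_def by (intro integrableI_nonneg) auto
  show Z1: "integrable M Z"
    by (rule square_integrable_imp_integrable[OF Z Z2])
  show "expectation Z = 0"
  proof -
    \<comment> \<open>\<open>I n\<close> has mean 0, so the mean of \<open>I n - Z\<close> is minus
      that of \<open>Z\<close>; its square is at most the mean square error because variances are
      nonnegative.\<close>
    have "ennreal ((expectation Z)\<^sup>2) \<le> ee n" for n
    proof (cases "ee n = \<infinity>")
      case False
      then have sq: "integrable M (\<lambda>\<omega>. (I n \<omega> - Z \<omega>)\<^sup>2)"
        unfolding ee_def by (intro integrableI_nonneg) (auto simp: less_top)
      have "integrable M (\<lambda>\<omega>. I n \<omega> - Z \<omega>)"
        using I(1) Z1 by auto
      from variance_eq[OF this sq] variance_positive[of "\<lambda>\<omega>. I n \<omega> - Z \<omega>"]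
      have "(expectation (\<lambda>\<omega>. I n \<omega> - Z \<omega>))\<^sup>2 \<le> expectation (\<lambda>\<omega>. (I n \<omega> - Z \<omega>)\<^sup>2)"
        by linarith
      then have "(expectation Z)\<^sup>2 \<le> expectation (\<lambda>\<omega>. (I n \<omega> - Z \<omega>)\<^sup>2)"
        using I Z1 by simp
      moreover have "ee n = ennreal (expectation (\<lambda>\<omega>. (I n \<omega> - Z \<omega>)\<^sup>2))"
        unfolding ee_def by (rule nn_integral_eq_integral[OF sq]) simp
      ultimately show ?thesis
        by (simp add: ennreal_leI)
    qed simp
    then have "ennreal ((expectation Z)\<^sup>2) \<le> 0"
      by (intro LIMSEQ_le_const[OF ee]) auto
    then show ?thesis
      by simp
  qed
  define X' where "X' z = (if z \<in> UNIV \<times> {0<..} \<times> UNIV then (case z of (\<omega>, s, k) \<Rightarrow> X \<omega> s k) else 0)" for z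
  have X': "X' \<in> borel_measurable (M \<Otimes>\<^sub>M intensity K)"
    unfolding X'_def[abs_def] by (rule predictable_jointly_measurable[OF X])
  have X'_eq: "X' (\<omega>, s, k) = X \<omega> s k" for \<omega> s k
    using X0 by (auto simp: X'_def)
  have v: "(\<lambda>z. simple_value (S n) (fst z) (fst (snd z)) (snd (snd z))) \<in> borel_measurable (M \<Otimes>\<^sub>M intensity K)" for n
    unfolding simple_value_eq
  proof (intro borel_measurable_sum borel_measurable_times)
    fix i assume i: "i \<in> {..<length (S n)}"
    then have [measurable]: "fst (S n ! i) \<in> borel_measurable M" "strip (S n ! i) \<in> sets (intensity K)"
      using simple_coefficient(1)[OF S] simple_strip(1)[OF S] by auto
    show "(\<lambda>z. fst (S n ! i) (fst z)) \<in> borel_measurable (M \<Otimes>\<^sub>M intensity K)"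
      by measurable
    show "(\<lambda>z. indicator (strip (S n ! i)) (fst (snd z), snd (snd z)) :: real) \<in> borel_measurable (M \<Otimes>\<^sub>M intensity K)"
      by simp
  qed
  have meas: "(\<lambda>z. \<integral>\<^sup>+\<omega>. ennreal (f (\<omega>, z)) \<partial>M) \<in> borel_measurable (intensity K)"
    if "f \<in> borel_measurable (M \<Otimes>\<^sub>M intensity K)" for f :: "_ \<Rightarrow> real"
    using that by measurable
  have sec: "(\<lambda>\<omega>. f (\<omega>, z)) \<in> borel_measurable M"
    if "f \<in> borel_measurable (M \<Otimes>\<^sub>M intensity K)" "z \<in> space (intensity K)" for f :: "_ \<Rightarrow> real" and z
    using that by measurable
  \<comment> \<open>Two perturbations with the same \<open>r\<close>, from \<open>X\<close> to the
    simple integrand and from the simple integral to \<open>Z\<close>, are joined by the isometry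
    for simple integrands. Both errors vanish as \<open>n\<close> grows with \<open>r\<close>
    fixed.\<close>
  have bound: "A \<le> ennreal ((1 + r)\<^sup>2) * B" if r: "0 < r" for r
  proof -
    have "A \<le> ennreal ((1 + r)\<^sup>2) * B + ennreal ((1 + r) * (1 + 1 / r)) * ee n + ennreal (1 + 1 / r) * dd n" for n
    proof -
      let ?V = "\<lambda>z. \<integral>\<^sup>+\<omega>. ennreal ((simple_value (S n) \<omega> (fst z) (snd z))\<^sup>2) \<partial>M"
      let ?W = "\<lambda>z. \<integral>\<^sup>+\<omega>. ennreal ((simple_value (S n) \<omega> (fst z) (snd z) - X' (\<omega>, z))\<^sup>2) \<partial>M"
      have mV: "?V \<in> borel_measurable (intensity K)"
        using meas[OF borel_measurable_power[OF v]] by simp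
      have mW: "?W \<in> borel_measurable (intensity K)"
        using meas[OF borel_measurable_power[OF borel_measurable_diff[OF v X']]] by simp
      have "A = (\<integral>\<^sup>+z. (\<integral>\<^sup>+\<omega>. ennreal ((X' (\<omega>, z))\<^sup>2) \<partial>M) \<partial>intensity K)"
        unfolding A_def by (simp add: split_beta' X'_eq[symmetric])
      also have "\<dots> \<le> (\<integral>\<^sup>+z. ennreal (1 + r) * ?V z + ennreal (1 + 1 / r) * ?W z \<partial>intensity K)"
      proof (rule nn_integral_mono)
        fix z assume z: "z \<in> space (intensity K)"
        show "(\<integral>\<^sup>+\<omega>. ennreal ((X' (\<omega>, z))\<^sup>2) \<partial>M) \<le> ennreal (1 + r) * ?V z + ennreal (1 + 1 / r) * ?W z"
          using sec[OF v z] sec[OF X' z] r by (intro second_moment_perturb) auto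
      qed
      also have "\<dots> = ennreal (1 + r) * (\<integral>\<^sup>+z. ?V z \<partial>intensity K) + ennreal (1 + 1 / r) * (\<integral>\<^sup>+z. ?W z \<partial>intensity K)"
        using mV mW by (simp add: nn_integral_add nn_integral_cmult)
      also have "(\<integral>\<^sup>+z. ?V z \<partial>intensity K) = (\<integral>\<^sup>+\<omega>. ennreal ((I n \<omega>)\<^sup>2) \<partial>M)"
        using I2(2)[of n] by (simp add: split_beta')
      also have "(\<integral>\<^sup>+z. ?W z \<partial>intensity K) = dd n"
        unfolding dd_def by (simp add: split_beta' X'_eq[symmetric])
      finally have 1: "A \<le> ennreal (1 + r) * (\<integral>\<^sup>+\<omega>. ennreal ((I n \<omega>)\<^sup>2) \<partial>M) + ennreal (1 + 1 / r) * dd n" .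
      have "(\<integral>\<^sup>+\<omega>. ennreal ((I n \<omega>)\<^sup>2) \<partial>M) \<le> ennreal (1 + r) * B + ennreal (1 + 1 / r) * ee n"
        unfolding B_def ee_def using second_moment_perturb[of "I n" M Z r] r by (simp add: power2_commute)
      then have "ennreal (1 + r) * (\<integral>\<^sup>+\<omega>. ennreal ((I n \<omega>)\<^sup>2) \<partial>M)
          \<le> ennreal (1 + r) * (ennreal (1 + r) * B + ennreal (1 + 1 / r) * ee n)"
        by (intro mult_left_mono) auto
      also have "\<dots> = ennreal ((1 + r)\<^sup>2) * B + ennreal ((1 + r) * (1 + 1 / r)) * ee n"
      proof -
        have "ennreal ((1 + r)\<^sup>2) = ennreal (1 + r) * ennreal (1 + r)"
          "ennreal ((1 + r) * (1 + 1 / r)) = ennreal (1 + r) * ennreal (1 + 1 / r)"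
          unfolding power2_eq_square using r by (intro ennreal_mult; simp)+
        then show ?thesis
          by (simp only: distrib_left mult.assoc)
      qed
      finally show ?thesis
        using 1 by (meson add_right_mono order_trans)
    qed
    moreover have "(\<lambda>n. ennreal ((1 + r)\<^sup>2) * B + ennreal ((1 + r) * (1 + 1 / r)) * ee n + ennreal (1 + 1 / r) * dd n)
        \<longlonglongrightarrow> ennreal ((1 + r)\<^sup>2) * B + ennreal ((1 + r) * (1 + 1 / r)) * 0 + ennreal (1 + 1 / r) * 0"
      using ee dd by (intro tendsto_add tendsto_const ennreal_tendsto_cmult) auto
    ultimately show ?thesis
      by (intro LIMSEQ_le_const[where a = A]) auto
  qed
  obtain b where b: "B = ennreal b" "0 \<le> b"
    using Bfin by (cases B) auto
  \<comment> \<open>Letting \<open>r = 1 / Suc n\<close> tend to 0 restores the constant 1.\<close>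
  have "A \<le> ennreal ((1 + 1 / real (Suc n))\<^sup>2 * b)" for n
    using bound[of "1 / real (Suc n)"] b by (simp add: ennreal_mult)
  moreover have "(\<lambda>n. ennreal ((1 + 1 / real (Suc n))\<^sup>2 * b)) \<longlonglongrightarrow> ennreal ((1 + 0)\<^sup>2 * b)"
    by (intro tendsto_intros LIMSEQ_Suc[OF lim_1_over_n])
  ultimately have "A \<le> ennreal ((1 + 0)\<^sup>2 * b)"
    by (intro LIMSEQ_le_const) auto
  then show "(\<integral>\<^sup>+(s, k). (\<integral>\<^sup>+\<omega>. ennreal ((X \<omega> s k)\<^sup>2) \<partial>M) \<partial>intensity K) \<le> (\<integral>\<^sup>+\<omega>. ennreal ((Z \<omega>)\<^sup>2) \<partial>M)"
    using b unfolding A_def B_def by simp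
qed

end

section \<open>Lower bounds for the kernel\<close>

text \<open>The average of \<open>1 - cos (r * y)\<close> over \<open>{0..\<delta>}\<close> is
  \<open>1 - sin (\<delta> * y) / (\<delta> * y)\<close>. As the sine is at most 1 in modulus, the
  threshold 2 makes this at least 1/2.\<close>

lemma cos_average_lower:
  fixes y \<delta> :: real
  assumes "0 < \<delta>" "2 \<le> \<delta> * \<bar>y\<bar>"
  shows "ennreal (\<delta> / 2) \<le> (\<integral>\<^sup>+r. ennreal (1 - cos (r * y)) * indicator {0..\<delta>} r \<partial>lborel)"
proof -
  have y: "y \<noteq> 0"
    using assms by auto
  have "(\<integral>\<^sup>+r. ennreal (1 - cos (r * y)) * indicator {0..\<delta>} r \<partial>lborel)
      = ennreal ((\<delta> - sin (\<delta> * y) / y) - (0 - sin (0 * y) / y))"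
  proof (rule nn_integral_FTC_Icc)
    show "((\<lambda>r. r - sin (r * y) / y) has_real_derivative 1 - cos (r * y)) (at r)" for r
      using y by (auto intro!: derivative_eq_intros)
  qed (use assms in auto)
  moreover have "\<delta> / 2 \<le> \<delta> - sin (\<delta> * y) / y"
  proof -
    have "sin (\<delta> * y) / y \<le> \<bar>sin (\<delta> * y)\<bar> / \<bar>y\<bar>"
      by (metis abs_divide abs_ge_self)
    also have "\<dots> \<le> 1 / \<bar>y\<bar>"
      using y by (intro divide_right_mono) auto
    also have "\<dots> \<le> \<delta> / 2"
      using assms y by (simp add: field_simps)
    finally show ?thesis
      by simp
  qed
  ultimately show ?thesis
    by (simp add: ennreal_leI)
qed

text \<open>\<open>\<delta>\<close> is a frequency: the half side is \<open>2 / \<delta>\<close>,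
  with the 2 from \<open>cos_average_lower\<close>, and the complement is the union over the
  coordinates of the tails treated in \<open>stable_tail\<close>.\<close>

definition cube :: "real \<Rightarrow> 'a::euclidean_space set" where
  "cube \<delta> = {x. \<forall>b\<in>Basis. \<delta> * \<bar>x \<bullet> b\<bar> < 2}"

lemma cube_eq_box:
  assumes "0 < \<delta>"
  shows "cube \<delta> = box (- (2 / \<delta>) *\<^sub>R One) ((2 / \<delta>) *\<^sub>R One)"
proof -
  have "\<delta> * \<bar>y\<bar> < 2 \<longleftrightarrow> - (2 / \<delta>) < y \<and> y < 2 / \<delta>" for y :: real
  proof -
    have "\<delta> * \<bar>y\<bar> < 2 \<longleftrightarrow> \<bar>y\<bar> < 2 / \<delta>"
      using assms by (simp add: field_simps)
    then show ?thesis
      by (auto simp: abs_less_iff)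
  qed
  then show ?thesis
    by (auto simp: cube_def box_def)
qed

lemma sets_cube [measurable]: "0 < \<delta> \<Longrightarrow> cube \<delta> \<in> sets borel"
  by (simp add: cube_eq_box)

lemma emeasure_cube:
  assumes "0 < \<delta>"
  shows "emeasure lborel (cube \<delta> :: 'a::euclidean_space set) = ennreal ((4 / \<delta>) ^ DIM('a))"
proof -
  have "emeasure lborel (cube \<delta> :: 'a set) = (\<Prod>b\<in>(Basis :: 'a set). ((2 / \<delta>) *\<^sub>R One - (- (2 / \<delta>) *\<^sub>R One)) \<bullet> b)"
    unfolding cube_eq_box[OF assms] using assms by (intro emeasure_lborel_box) auto
  also have "(\<Prod>b\<in>(Basis :: 'a set). ((2 / \<delta>) *\<^sub>R One - (- (2 / \<delta>) *\<^sub>R One)) \<bullet> b) = (\<Prod>b\<in>(Basis :: 'a set). 4 / \<delta>)"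
    by (intro prod.cong) (auto simp: inner_diff_left inner_add_left)
  finally show ?thesis
    by simp
qed

section \<open>Mass of the stable densities near the origin\<close>

locale stable_density =
  fixes \<alpha> \<nu> :: real and p :: "real \<Rightarrow> 'a::euclidean_space \<Rightarrow> real"
  assumes p: "stable_densities \<alpha> \<nu> p" and \<alpha>: "0 < \<alpha>" and \<nu>: "0 < \<nu>"
begin

lemma stable_measurable_pair: "(\<lambda>(s, x). p s x) \<in> borel_measurable (borel \<Otimes>\<^sub>M borel)"
  using p unfolding stable_densities_def borel_prod by simp

lemma stable_measurable [measurable (raw)]:
  "f \<in> borel_measurable L \<Longrightarrow> g \<in> borel_measurable L \<Longrightarrow> (\<lambda>z. p (f z) (g z)) \<in> borel_measurable L"
  using measurable_compose[OF measurable_Pair stable_measurable_pair] by simp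

lemma stable_nonneg: "0 < s \<Longrightarrow> 0 \<le> p s x"
  using p unfolding stable_densities_def by blast

text \<open>Real parts carry all the information, as the transform is real. Frequency 0 gives the
  total mass: \<open>0 powr \<alpha>\<close> is 0, so the exponential is 1.\<close>

lemma stable_cos_transform:
  assumes s: "0 < s"
  shows "integrable lborel (p s)" "(LINT x|lborel. p s x) = 1"
    and "(LINT x|lborel. cos (\<xi> \<bullet> x) * p s x) = exp (- s * \<nu> * norm \<xi> powr \<alpha>)"
    and "integrable lborel (\<lambda>x. cos (\<xi> \<bullet> x) * p s x)"
proof -
  show int: "integrable lborel (p s)"
    using p s unfolding stable_densities_def by blast
  have F: "(CLINT x|lborel. cis (\<eta> \<bullet> x) * complex_of_real (p s x)) = complex_of_real (exp (- s * \<nu> * norm \<eta> powr \<alpha>))" for \<eta>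
    using p s unfolding stable_densities_def by blast
  have ci: "integrable lborel (\<lambda>x. cis (\<eta> \<bullet> x) * complex_of_real (p s x))" for \<eta> :: 'a
  proof (rule Bochner_Integration.integrable_bound[OF int])
    show "(\<lambda>x. cis (\<eta> \<bullet> x) * complex_of_real (p s x)) \<in> borel_measurable lborel"
      unfolding cis_conv_exp by measurable
    show "AE x in lborel. norm (cis (\<eta> \<bullet> x) * complex_of_real (p s x)) \<le> norm (p s x)"
      by (simp add: norm_mult)
  qed
  have cos: "(LINT x|lborel. cos (\<eta> \<bullet> x) * p s x) = exp (- s * \<nu> * norm \<eta> powr \<alpha>)" for \<eta>
  proof -
    have "(LINT x|lborel. Re (cis (\<eta> \<bullet> x) * complex_of_real (p s x))) = exp (- s * \<nu> * norm \<eta> powr \<alpha>)"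
      using integral_Re[OF ci] F by simp
    then show ?thesis
      by simp
  qed
  then show "(LINT x|lborel. cos (\<xi> \<bullet> x) * p s x) = exp (- s * \<nu> * norm \<xi> powr \<alpha>)" .
  show "(LINT x|lborel. p s x) = 1"
    using cos[of 0] by simp
  show "integrable lborel (\<lambda>x. cos (\<xi> \<bullet> x) * p s x)"
    using integrable_Re[OF ci[of \<xi>]] by simp
qed

lemma stable_mass: "0 < s \<Longrightarrow> (\<integral>\<^sup>+x. ennreal (p s x) \<partial>lborel) = 1"
  using stable_cos_transform(1,2)[of s] stable_nonneg by (simp add: nn_integral_eq_integral)

lemma stable_one_minus_cos:
  assumes s: "0 < s"
  shows "(\<integral>\<^sup>+x. ennreal ((1 - cos (\<xi> \<bullet> x)) * p s x) \<partial>lborel) = ennreal (1 - exp (- s * \<nu> * norm \<xi> powr \<alpha>))"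
proof -
  note F = stable_cos_transform[OF s]
  have int: "integrable lborel (\<lambda>x. (1 - cos (\<xi> \<bullet> x)) * p s x)"
    using F by (simp add: left_diff_distrib)
  have "(LINT x|lborel. (1 - cos (\<xi> \<bullet> x)) * p s x) = 1 - exp (- s * \<nu> * norm \<xi> powr \<alpha>)"
    using F by (simp add: left_diff_distrib)
  then show ?thesis
    using nn_integral_eq_integral[OF int] stable_nonneg[OF s] by simp
qed

text \<open>
  Averaging \<open>1 - cos (r x\<^sub>b)\<close> over \<open>0 \<le> r \<le> \<delta>\<close> gives at least \<open>1/2\<close> on the tail, so the tail
  is controlled by the Fourier transform near the origin.
\<close>

lemma stable_tail:
  assumes s: "0 < s" and \<delta>: "0 < \<delta>" and b: "b \<in> Basis"
  shows "(\<integral>\<^sup>+x. ennreal (p s x) * indicator {x. 2 \<le> \<delta> * \<bar>x \<bullet> b\<bar>} x \<partial>lborel) \<le> ennreal (2 * s * \<nu> * \<delta> powr \<alpha>)"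
proof -
  let ?T = "{x. 2 \<le> \<delta> * \<bar>x \<bullet> b\<bar>}"
  let ?L = "\<integral>\<^sup>+x. ennreal (p s x) * indicator ?T x \<partial>lborel"
  have "ennreal (\<delta> / 2) * ?L = (\<integral>\<^sup>+x. ennreal (\<delta> / 2) * (ennreal (p s x) * indicator ?T x) \<partial>lborel)"
    by (simp add: nn_integral_cmult)
  also have "\<dots> \<le> (\<integral>\<^sup>+x. (\<integral>\<^sup>+r. ennreal ((1 - cos ((r *\<^sub>R b) \<bullet> x)) * p s x) * indicator {0..\<delta>} r \<partial>lborel) \<partial>lborel)"
  proof (rule nn_integral_mono)
    fix x :: 'a
    have "(\<integral>\<^sup>+r. ennreal ((1 - cos ((r *\<^sub>R b) \<bullet> x)) * p s x) * indicator {0..\<delta>} r \<partial>lborel)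
        = (\<integral>\<^sup>+r. ennreal (p s x) * (ennreal (1 - cos (r * (x \<bullet> b))) * indicator {0..\<delta>} r) \<partial>lborel)"
      using stable_nonneg[OF s] by (intro nn_integral_cong) (simp add: ennreal_mult inner_commute mult_ac)
    also have "\<dots> = ennreal (p s x) * (\<integral>\<^sup>+r. ennreal (1 - cos (r * (x \<bullet> b))) * indicator {0..\<delta>} r \<partial>lborel)"
      by (simp add: nn_integral_cmult)
    finally have eq: "(\<integral>\<^sup>+r. ennreal ((1 - cos ((r *\<^sub>R b) \<bullet> x)) * p s x) * indicator {0..\<delta>} r \<partial>lborel)
      = ennreal (p s x) * (\<integral>\<^sup>+r. ennreal (1 - cos (r * (x \<bullet> b))) * indicator {0..\<delta>} r \<partial>lborel)" .
    show "ennreal (\<delta> / 2) * (ennreal (p s x) * indicator ?T x)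
        \<le> (\<integral>\<^sup>+r. ennreal ((1 - cos ((r *\<^sub>R b) \<bullet> x)) * p s x) * indicator {0..\<delta>} r \<partial>lborel)"
      unfolding eq using cos_average_lower[OF \<delta>, of "x \<bullet> b"]
      by (auto simp: indicator_def mult.commute[of "ennreal (\<delta> / 2)"] intro: mult_left_mono)
  qed
  \<comment> \<open>Exchanging the integrals turns the average of cosines into an average of the
    Fourier transform over the frequencies \<open>r\<close> times \<open>b\<close>.\<close>
  also have "\<dots> = (\<integral>\<^sup>+r. (\<integral>\<^sup>+x. ennreal ((1 - cos ((r *\<^sub>R b) \<bullet> x)) * p s x) * indicator {0..\<delta>} r \<partial>lborel) \<partial>lborel)"
    by (rule lborel_pair.Fubini') measurable
  also have "\<dots> \<le> (\<integral>\<^sup>+r. ennreal (s * \<nu> * \<delta> powr \<alpha>) * indicator {0..\<delta>} r \<partial>lborel)"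
  proof (rule nn_integral_mono)
    fix r :: real
    have "(\<integral>\<^sup>+x. ennreal ((1 - cos ((r *\<^sub>R b) \<bullet> x)) * p s x) * indicator {0..\<delta>} r \<partial>lborel)
        = (\<integral>\<^sup>+x. ennreal ((1 - cos ((r *\<^sub>R b) \<bullet> x)) * p s x) \<partial>lborel) * indicator {0..\<delta>} r"
      by (rule nn_integral_multc) measurable
    also have "\<dots> \<le> ennreal (s * \<nu> * \<delta> powr \<alpha>) * indicator {0..\<delta>} r"
    proof (cases "r \<in> {0..\<delta>}")
      case True
      \<comment> \<open>Here \<open>1 - exp (- z) \<le> z\<close> is used; as \<open>b\<close> has
        norm 1, the frequency has norm \<open>r \<le> \<delta>\<close>.\<close>
      have "1 - exp (- s * \<nu> * norm (r *\<^sub>R b) powr \<alpha>) \<le> s * \<nu> * norm (r *\<^sub>R b) powr \<alpha>"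
        using exp_ge_add_one_self[of "- s * \<nu> * norm (r *\<^sub>R b) powr \<alpha>"] by linarith
      also have "\<dots> \<le> s * \<nu> * \<delta> powr \<alpha>"
        using True b s \<alpha> \<nu> by (intro mult_left_mono powr_mono2) auto
      finally show ?thesis
        using True unfolding stable_one_minus_cos[OF s] by (simp add: ennreal_leI)
    qed simp
    finally show "(\<integral>\<^sup>+x. ennreal ((1 - cos ((r *\<^sub>R b) \<bullet> x)) * p s x) * indicator {0..\<delta>} r \<partial>lborel)
        \<le> ennreal (s * \<nu> * \<delta> powr \<alpha>) * indicator {0..\<delta>} r" .
  qed
  also have "\<dots> = ennreal (s * \<nu> * \<delta> powr \<alpha> * \<delta>)"
    using s \<nu> \<delta> by (simp add: nn_integral_cmult_indicator ennreal_mult)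
  finally have "ennreal (\<delta> / 2) * ?L \<le> ennreal (s * \<nu> * \<delta> powr \<alpha> * \<delta>)" .
  then have "ennreal (2 / \<delta>) * (ennreal (\<delta> / 2) * ?L) \<le> ennreal (2 / \<delta>) * ennreal (s * \<nu> * \<delta> powr \<alpha> * \<delta>)"
    by (intro mult_left_mono) auto
  moreover have "ennreal (2 / \<delta>) * ennreal (\<delta> / 2) = 1"
    using \<delta> by (simp add: ennreal_mult[symmetric])
  moreover have "ennreal (2 / \<delta>) * ennreal (s * \<nu> * \<delta> powr \<alpha> * \<delta>) = ennreal (2 * s * \<nu> * \<delta> powr \<alpha>)"
    using \<delta> s \<nu> by (simp add: ennreal_mult[symmetric])
  ultimately show ?thesis
    by (simp add: mult.assoc[symmetric])
qed

text \<open>Union bound: outside the cube some coordinate lies in its tail. A sum on the right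
  avoids subtraction in \<open>ennreal\<close>; the estimate is informative when
  \<open>s * \<nu> * \<delta> powr \<alpha>\<close> is small.\<close>

lemma stable_cube_mass:
  assumes s: "0 < s" and \<delta>: "0 < \<delta>"
  shows "1 \<le> (\<integral>\<^sup>+x. ennreal (p s x) * indicator (cube \<delta>) x \<partial>lborel) + ennreal (real DIM('a) * (2 * s * \<nu> * \<delta> powr \<alpha>))"
proof -
  have "1 = (\<integral>\<^sup>+x. ennreal (p s x) \<partial>lborel)"
    using stable_mass[OF s] by simp
  also have "\<dots> \<le> (\<integral>\<^sup>+x. ennreal (p s x) * indicator (cube \<delta>) x
      + (\<Sum>b\<in>Basis. ennreal (p s x) * indicator {x. 2 \<le> \<delta> * \<bar>x \<bullet> b\<bar>} x) \<partial>lborel)"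
  proof (rule nn_integral_mono)
    fix x :: 'a
    show "ennreal (p s x) \<le> ennreal (p s x) * indicator (cube \<delta>) x
      + (\<Sum>b\<in>Basis. ennreal (p s x) * indicator {x. 2 \<le> \<delta> * \<bar>x \<bullet> b\<bar>} x)"
    proof (cases "x \<in> cube \<delta>")
      case False
      then obtain b :: 'a where b: "b \<in> Basis" "2 \<le> \<delta> * \<bar>x \<bullet> b\<bar>"
        by (auto simp: cube_def not_less)
      then have "ennreal (p s x) = ennreal (p s x) * indicator {x. 2 \<le> \<delta> * \<bar>x \<bullet> b\<bar>} x"
        by simp
      also have "\<dots> \<le> (\<Sum>b\<in>Basis. ennreal (p s x) * indicator {x. 2 \<le> \<delta> * \<bar>x \<bullet> b\<bar>} x)"
        using b(1) by (intro member_le_sum) auto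
      finally show ?thesis
        using False by simp
    qed simp
  qed
  also have "\<dots> = (\<integral>\<^sup>+x. ennreal (p s x) * indicator (cube \<delta>) x \<partial>lborel)
      + (\<Sum>b\<in>Basis. \<integral>\<^sup>+x. ennreal (p s x) * indicator {x. 2 \<le> \<delta> * \<bar>x \<bullet> b\<bar>} x \<partial>lborel)"
    using \<delta> by (subst nn_integral_add)
      (auto simp: nn_integral_sum simp del: sum_mult_indicator intro!: borel_measurable_sum)
  also have "\<dots> \<le> (\<integral>\<^sup>+x. ennreal (p s x) * indicator (cube \<delta>) x \<partial>lborel) + (\<Sum>b\<in>(Basis :: 'a set). ennreal (2 * s * \<nu> * \<delta> powr \<alpha>))"
    using stable_tail[OF s \<delta>] by (intro add_left_mono sum_mono)
  also have "(\<Sum>b\<in>(Basis :: 'a set). ennreal (2 * s * \<nu> * \<delta> powr \<alpha>)) = ennreal (real DIM('a) * (2 * s * \<nu> * \<delta> powr \<alpha>))"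
    using s \<nu> by (simp add: ennreal_mult ennreal_of_nat_eq_real_of_nat)
  finally show ?thesis .
qed

end

section \<open>The inverse stable subordinator\<close>

locale subordinator =
  fixes \<beta> :: real and g :: "real \<Rightarrow> real"
  assumes g: "subordinator_density \<beta> g" and \<beta>: "0 < \<beta>"
begin

lemma subordinator_measurable [measurable]: "g \<in> borel_measurable borel"
  and subordinator_nonneg: "0 \<le> g x"
  using g unfolding subordinator_density_def by simp_all

lemma subordinator_mass: "(\<integral>\<^sup>+x\<in>{0<..}. ennreal (g x) \<partial>lborel) = 1"
proof -
  have "\<forall>r\<ge>0. (\<integral>\<^sup>+x\<in>{0<..}. ennreal (exp (- r * x) * g x) \<partial>lborel) = ennreal (exp (- (r powr \<beta>)))"
    using g unfolding subordinator_density_def by simp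
  from this[rule_format, of 0] show ?thesis
    by simp
qed

text \<open>The half-lines \<open>{1 / real (Suc n)..}\<close> exhaust \<open>{0<..}\<close>, so one
  of them has positive mass. Values of the subordinator above \<open>v\<close> will correspond to
  inverse times up to \<open>(t / v) powr \<beta>\<close>.\<close>

lemma subordinator_mass_away_from_zero:
  obtains v where "0 < v" "0 < (\<integral>\<^sup>+x\<in>{v..}. ennreal (g x) \<partial>lborel)"
proof -
  have "\<exists>n. 0 < (\<integral>\<^sup>+x\<in>{1 / real (Suc n)..}. ennreal (g x) \<partial>lborel)"
  proof (rule ccontr)
    assume "\<not> ?thesis"
    then have zero: "(\<integral>\<^sup>+x\<in>{1 / real (Suc n)..}. ennreal (g x) \<partial>lborel) = 0" for n
      by (simp add: not_gr_zero)
    have "(\<Union>n. {1 / real (Suc n)..}) = {0<..}"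
    proof safe
      fix x :: real assume "0 < x"
      then obtain n where "1 / real (Suc n) < x"
        using nat_approx_posE by metis
      then show "x \<in> (\<Union>n. {1 / real (Suc n)..})"
        by (auto intro!: exI[of _ n])
    next
      fix x :: real and n assume "1 / real (Suc n) \<le> x"
      then show "0 < x"
        by (rule less_le_trans[rotated]) simp
    qed
    moreover have "emeasure (density lborel (\<lambda>x. ennreal (g x))) (\<Union>n. {1 / real (Suc n)..}) = 0"
      using zero by (intro emeasure_UN_eq_0) (auto simp: emeasure_density simp del: of_nat_Suc)
    ultimately have "emeasure (density lborel (\<lambda>x. ennreal (g x))) {0<..} = 0"
      by simp
    then show False
      using subordinator_mass by (simp add: emeasure_density)
  qed
  then obtain n where "0 < (\<integral>\<^sup>+x\<in>{1 / real (Suc n)..}. ennreal (g x) \<partial>lborel)" ..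
  then show ?thesis
    by (intro that[of "1 / real (Suc n)"]) auto
qed

lemma subordinator_set_integrable:
  assumes "T \<subseteq> {0<..}" "T \<in> sets borel"
  shows "integrable lborel (\<lambda>x. indicator T x *\<^sub>R g x)"
proof (rule integrableI_nonneg)
  have "(\<integral>\<^sup>+x. ennreal (indicator T x *\<^sub>R g x) \<partial>lborel) \<le> (\<integral>\<^sup>+x\<in>{0<..}. ennreal (g x) \<partial>lborel)"
    using assms(1) by (intro nn_integral_mono) (auto simp: indicator_def)
  also have "\<dots> < \<infinity>"
    unfolding subordinator_mass by simp
  finally show "(\<integral>\<^sup>+x. ennreal (indicator T x *\<^sub>R g x) \<partial>lborel) < \<infinity>" .
qed (use assms subordinator_nonneg in \<open>auto simp: indicator_def\<close>)

lemma inverse_subordinator_nonneg: "0 < t \<Longrightarrow> 0 \<le> inverse_subordinator_density \<beta> g t s"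
  unfolding inverse_subordinator_density_def using \<beta> subordinator_nonneg by simp

lemma inverse_subordinator_measurable [measurable (raw)]:
  assumes [measurable]: "a \<in> borel_measurable L" "b \<in> borel_measurable L"
  shows "(\<lambda>z. inverse_subordinator_density \<beta> g (a z) (b z)) \<in> borel_measurable L"
  unfolding inverse_subordinator_density_def by measurable

text \<open>The density at \<open>s\<close> is \<open>\<bar>\<phi>' s\<bar> * g (\<phi> s)\<close>
  for \<open>\<phi> s = t * s powr (- 1 / \<beta>)\<close>: the inverse subordinator at time
  \<open>t\<close> has the law of \<open>(t / D) powr \<beta>\<close>, where \<open>D\<close> is the
  subordinator at time 1.\<close>

lemma inverse_subordinator_substitution:
  assumes t: "0 < t" and S: "S \<subseteq> {0<..}" "S \<in> sets borel" and T: "(\<lambda>s. t * s powr (- 1 / \<beta>)) ` S \<in> sets borel"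
  shows "(\<integral>\<^sup>+s\<in>S. ennreal (inverse_subordinator_density \<beta> g t s) \<partial>lborel)
    = (\<integral>\<^sup>+v\<in>(\<lambda>s. t * s powr (- 1 / \<beta>)) ` S. ennreal (g v) \<partial>lborel)"
proof -
  define \<phi> where "\<phi> s = t * s powr (- 1 / \<beta>)" for s
  define \<phi>' where "\<phi>' s = t * (- 1 / \<beta> * s powr (- 1 / \<beta> - 1))" for s
  define f where "f = inverse_subordinator_density \<beta> g t"
  have f_eq: "\<bar>\<phi>' s\<bar> * g (\<phi> s) = f s" for s
  proof -
    have "- 1 / \<beta> - 1 = - 1 - 1 / \<beta>"
      by simp
    then have "\<phi>' s = - (t / \<beta> * s powr (- 1 - 1 / \<beta>))"
      unfolding \<phi>'_def by (simp only: mult_minus_left mult_minus_right minus_divide_left[symmetric] times_divide_eq_left times_divide_eq_right mult_1_left)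
    moreover have "0 \<le> t / \<beta> * s powr (- 1 - 1 / \<beta>)"
      using t \<beta> by simp
    ultimately have "\<bar>\<phi>' s\<bar> = t / \<beta> * s powr (- 1 - 1 / \<beta>)"
      by (simp only: abs_minus_cancel abs_of_nonneg)
    then show ?thesis
      by (simp only: \<phi>_def f_def inverse_subordinator_density_def)
  qed
  have TS: "\<phi> ` S \<subseteq> {0<..}" and T': "\<phi> ` S \<in> sets borel"
    using S t T by (auto simp: \<phi>_def)
  have inj: "inj_on \<phi> S"
  proof (rule inj_onI)
    fix x y assume "x \<in> S" "y \<in> S" and eq: "\<phi> x = \<phi> y"
    then have xy: "0 < x" "0 < y"
      using S by auto
    from eq have "(x powr (- 1 / \<beta>)) powr (- \<beta>) = (y powr (- 1 / \<beta>)) powr (- \<beta>)"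
      using t by (simp add: \<phi>_def)
    then show "x = y"
      using xy \<beta> by (simp add: powr_powr)
  qed
  have der: "(\<phi> has_field_derivative \<phi>' s) (at s within S)" if "s \<in> S" for s
    using that S unfolding \<phi>_def[abs_def] \<phi>'_def
    by (intro DERIV_cmult has_field_derivative_at_within[OF has_real_derivative_powr]) auto
  have gi: "integrable lborel (\<lambda>x. indicator (\<phi> ` S) x *\<^sub>R g x)"
    using TS T' by (rule subordinator_set_integrable)
  \<comment> \<open>The change of variables theorem is about absolute integrability for Lebesgue
    measure; \<open>integrable_completion\<close> moves Borel functions between it and
    \<open>lborel\<close>.\<close>
  then have "g absolutely_integrable_on \<phi> ` S"
    unfolding set_integrable_def by (subst integrable_completion) (use T' in auto)
  then have ch: "(\<lambda>s. \<bar>\<phi>' s\<bar> * g (\<phi> s)) absolutely_integrable_on S"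
    "integral S (\<lambda>s. \<bar>\<phi>' s\<bar> * g (\<phi> s)) = integral (\<phi> ` S) g"
    using has_absolute_integral_change_of_variables_1'[of S \<phi> \<phi>' g "integral (\<phi> ` S) g"] S(2) der inj by auto
  have fi: "integrable lborel (\<lambda>s. indicator S s *\<^sub>R f s)"
    using ch(1) unfolding f_eq set_integrable_def
    by (subst (asm) integrable_completion) (use S in \<open>auto simp: f_def\<close>)
  have "(LINT s|lborel. indicator S s *\<^sub>R f s) = integral S f"
    using set_borel_integral_eq_integral(2)[of S f] fi by (simp add: set_integrable_def set_lebesgue_integral_def)
  moreover have "(LINT s|lborel. indicator (\<phi> ` S) s *\<^sub>R g s) = integral (\<phi> ` S) g"
    using set_borel_integral_eq_integral(2)[of "\<phi> ` S" g] gi by (simp add: set_integrable_def set_lebesgue_integral_def)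
  ultimately have eq: "(LINT s|lborel. indicator S s *\<^sub>R f s) = (LINT s|lborel. indicator (\<phi> ` S) s *\<^sub>R g s)"
    using ch(2) unfolding f_eq by simp
  have f0: "0 \<le> f s" for s
    unfolding f_def by (rule inverse_subordinator_nonneg[OF t])
  have "(\<integral>\<^sup>+s\<in>S. ennreal (f s) \<partial>lborel) = (\<integral>\<^sup>+s. ennreal (indicator S s *\<^sub>R f s) \<partial>lborel)"
    by (intro nn_integral_cong) (auto simp: indicator_def)
  also have "\<dots> = ennreal (LINT s|lborel. indicator S s *\<^sub>R f s)"
    using f0 by (intro nn_integral_eq_integral[OF fi]) (auto simp: indicator_def)
  also have "\<dots> = (\<integral>\<^sup>+s. ennreal (indicator (\<phi> ` S) s *\<^sub>R g s) \<partial>lborel)"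
    unfolding eq using subordinator_nonneg by (intro nn_integral_eq_integral[OF gi, symmetric]) (auto simp: indicator_def)
  also have "\<dots> = (\<integral>\<^sup>+v\<in>\<phi> ` S. ennreal (g v) \<partial>lborel)"
    by (intro nn_integral_cong) (auto simp: indicator_def)
  finally show ?thesis
    unfolding f_def \<phi>_def .
qed

text \<open>As \<open>\<phi>\<close> is decreasing with inverse \<open>\<psi>\<close>, it maps
  \<open>{0<..}\<close> onto itself and \<open>{0<..\<psi> v}\<close> onto \<open>{v..}\<close>. In
  law, small values of the inverse subordinator are large values of the subordinator at time
  1.\<close>

lemma inverse_subordinator_mass:
  assumes t: "0 < t"
  shows "(\<integral>\<^sup>+s\<in>{0<..}. ennreal (inverse_subordinator_density \<beta> g t s) \<partial>lborel) = 1"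
    and "0 < v \<Longrightarrow> (\<integral>\<^sup>+s\<in>{0<..(t / v) powr \<beta>}. ennreal (inverse_subordinator_density \<beta> g t s) \<partial>lborel)
      = (\<integral>\<^sup>+x\<in>{v..}. ennreal (g x) \<partial>lborel)"
proof -
  define \<phi> where "\<phi> s = t * s powr (- 1 / \<beta>)" for s
  define \<psi> where "\<psi> x = (t / x) powr \<beta>" for x
  have inv: "\<phi> (\<psi> x) = x" "0 < \<psi> x" if "0 < x" for x
    using t \<beta> that by (auto simp: \<phi>_def \<psi>_def powr_powr powr_minus)
  have pos: "0 < \<phi> s" if "0 < s" for s
    using t that by (simp add: \<phi>_def)
  have mono: "\<psi> x \<le> \<psi> y" if "0 < y" "y \<le> x" for x y
    using t \<beta> that unfolding \<psi>_def by (intro powr_mono2 divide_left_mono) auto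
  have antimono: "\<phi> x \<le> \<phi> y" if "0 < y" "y \<le> x" for x y
    using t \<beta> that unfolding \<phi>_def by (intro mult_left_mono powr_mono2') auto
  have im1: "\<phi> ` {0<..} = {0<..}"
  proof (intro equalityI subsetI)
    fix x :: real assume "x \<in> {0<..}"
    then show "x \<in> \<phi> ` {0<..}"
      using inv[of x] by (intro image_eqI[of _ _ "\<psi> x"]) auto
  qed (use pos in auto)
  have im2: "\<phi> ` {0<..\<psi> v} = {v..}" if v: "0 < v"
  proof (intro equalityI subsetI)
    fix x assume "x \<in> {v..}"
    then show "x \<in> \<phi> ` {0<..\<psi> v}"
      using inv[of x] v mono[of v x] by (intro image_eqI[of _ _ "\<psi> x"]) auto
  next
    fix x assume "x \<in> \<phi> ` {0<..\<psi> v}"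
    then show "x \<in> {v..}"
      using antimono[of _ "\<psi> v"] inv(1)[OF v] by fastforce
  qed
  note sub = inverse_subordinator_substitution[OF t, folded \<phi>_def]
  show "(\<integral>\<^sup>+s\<in>{0<..}. ennreal (inverse_subordinator_density \<beta> g t s) \<partial>lborel) = 1"
    using sub[of "{0<..}"] im1 subordinator_mass by simp
  show "(\<integral>\<^sup>+s\<in>{0<..(t / v) powr \<beta>}. ennreal (inverse_subordinator_density \<beta> g t s) \<partial>lborel)
      = (\<integral>\<^sup>+x\<in>{v..}. ennreal (g x) \<partial>lborel)" if "0 < v"
  proof -
    have "{0<..\<psi> v} \<subseteq> {0<..}"
      by auto
    from sub[OF this] show ?thesis
      using im2[OF that] by (simp add: \<psi>_def)
  qed
qed

end

section \<open>The kernel as a mixture of stable densities\<close>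

locale fractional_densities = stable_density \<alpha> \<nu> p + subordinator \<beta> g
  for \<alpha> \<beta> \<nu> :: real and p :: "real \<Rightarrow> 'a::euclidean_space \<Rightarrow> real" and g :: "real \<Rightarrow> real"
begin

lemma kernel_measurable [measurable (raw)]:
  assumes [measurable]: "f \<in> borel_measurable L" "h \<in> borel_measurable L"
  shows "(\<lambda>z. fractional_kernel \<beta> p g (f z) (h z)) \<in> borel_measurable L"
  unfolding fractional_kernel_def set_lebesgue_integral_def by measurable

lemma kernel_integrand_nonneg:
  "0 < t \<Longrightarrow> 0 \<le> indicator {0<..} s *\<^sub>R (p s x * inverse_subordinator_density \<beta> g t s)"
  using stable_nonneg[of s x] inverse_subordinator_nonneg[of t s]
  by (auto simp: indicator_def)

lemma kernel_nonneg: "0 < t \<Longrightarrow> 0 \<le> fractional_kernel \<beta> p g t x"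
  unfolding fractional_kernel_def set_lebesgue_integral_def
  using kernel_integrand_nonneg by (intro Bochner_Integration.integral_nonneg) auto

text \<open>The inner integral is taken in \<open>ennreal\<close>, where the order can be exchanged
  before anything is known about convergence of the integral that defines the kernel.\<close>

lemma kernel_tonelli:
  assumes t: "0 < t" and Q [measurable]: "Q \<in> sets borel"
  shows "(\<integral>\<^sup>+x. (\<integral>\<^sup>+s. ennreal (indicator {0<..} s *\<^sub>R (p s x * inverse_subordinator_density \<beta> g t s)) \<partial>lborel) * indicator Q x \<partial>lborel)
    = (\<integral>\<^sup>+s\<in>{0<..}. ennreal (inverse_subordinator_density \<beta> g t s) * (\<integral>\<^sup>+x\<in>Q. ennreal (p s x) \<partial>lborel) \<partial>lborel)"
proof -
  let ?f = "inverse_subordinator_density \<beta> g t"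
  have "(\<integral>\<^sup>+x. (\<integral>\<^sup>+s. ennreal (indicator {0<..} s *\<^sub>R (p s x * ?f s)) \<partial>lborel) * indicator Q x \<partial>lborel)
      = (\<integral>\<^sup>+x. (\<integral>\<^sup>+s. ennreal (indicator {0<..} s *\<^sub>R (p s x * ?f s)) * indicator Q x \<partial>lborel) \<partial>lborel)"
    by (intro nn_integral_cong nn_integral_multc[symmetric]) measurable
  also have "\<dots> = (\<integral>\<^sup>+s. (\<integral>\<^sup>+x. ennreal (indicator {0<..} s *\<^sub>R (p s x * ?f s)) * indicator Q x \<partial>lborel) \<partial>lborel)"
    by (rule lborel_pair.Fubini') measurable
  also have "\<dots> = (\<integral>\<^sup>+s\<in>{0<..}. ennreal (?f s) * (\<integral>\<^sup>+x\<in>Q. ennreal (p s x) \<partial>lborel) \<partial>lborel)"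
  proof (rule nn_integral_cong)
    fix s :: real
    show "(\<integral>\<^sup>+x. ennreal (indicator {0<..} s *\<^sub>R (p s x * ?f s)) * indicator Q x \<partial>lborel)
        = ennreal (?f s) * (\<integral>\<^sup>+x\<in>Q. ennreal (p s x) \<partial>lborel) * indicator {0<..} s"
    proof (cases "0 < s")
      case True
      have "(\<integral>\<^sup>+x. ennreal (indicator {0<..} s *\<^sub>R (p s x * ?f s)) * indicator Q x \<partial>lborel)
          = (\<integral>\<^sup>+x. ennreal (?f s) * (ennreal (p s x) * indicator Q x) \<partial>lborel)"
        using True stable_nonneg[OF True] inverse_subordinator_nonneg[OF t]
        by (intro nn_integral_cong) (simp add: ennreal_mult mult_ac)
      also have "\<dots> = ennreal (?f s) * (\<integral>\<^sup>+x\<in>Q. ennreal (p s x) \<partial>lborel)"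
        by (rule nn_integral_cmult) measurable
      finally show ?thesis
        using True by simp
    qed simp
  qed
  finally show ?thesis .
qed

text \<open>
  The kernel is a Bochner integral, hence \<open>0\<close> where its integrand is not integrable; this happens
  only on a null set.
\<close>

lemma kernel_AE:
  assumes t: "0 < t"
  shows "AE x in lborel. ennreal (fractional_kernel \<beta> p g t x)
    = (\<integral>\<^sup>+s. ennreal (indicator {0<..} s *\<^sub>R (p s x * inverse_subordinator_density \<beta> g t s)) \<partial>lborel)"
proof -
  let ?f = "inverse_subordinator_density \<beta> g t"
  let ?H = "\<lambda>x. \<integral>\<^sup>+s. ennreal (indicator {0<..} s *\<^sub>R (p s x * ?f s)) \<partial>lborel"
  \<comment> \<open>The total integral is the mass 1, so the inner integral is finite almost
    everywhere.\<close>
  have "(\<integral>\<^sup>+x. ?H x \<partial>lborel) = (\<integral>\<^sup>+s\<in>{0<..}. ennreal (?f s) * (\<integral>\<^sup>+x. ennreal (p s x) \<partial>lborel) \<partial>lborel)"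
    using kernel_tonelli[OF t, of UNIV] by simp
  also have "\<dots> = (\<integral>\<^sup>+s\<in>{0<..}. ennreal (?f s) \<partial>lborel)"
    using stable_mass by (intro nn_integral_cong) (simp add: indicator_def)
  also have "\<dots> = 1"
    by (rule inverse_subordinator_mass(1)[OF t])
  finally have "(\<integral>\<^sup>+x. ?H x \<partial>lborel) \<noteq> \<infinity>"
    by simp
  then have "AE x in lborel. ?H x \<noteq> \<infinity>"
    by (intro nn_integral_PInf_AE) measurable
  then show ?thesis
  proof eventually_elim
    case (elim x)
    have "integrable lborel (\<lambda>s. indicator {0<..} s *\<^sub>R (p s x * ?f s))"
      using elim kernel_integrand_nonneg[OF t] by (intro integrableI_nonneg) (auto simp: less_top)
    then show ?case
      unfolding fractional_kernel_def set_lebesgue_integral_def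
      using kernel_integrand_nonneg[OF t] by (intro nn_integral_eq_integral[symmetric]) auto
  qed
qed

lemma kernel_nn_integral:
  assumes t: "0 < t" and Q [measurable]: "Q \<in> sets borel"
  shows "(\<integral>\<^sup>+x\<in>Q. ennreal (fractional_kernel \<beta> p g t x) \<partial>lborel)
    = (\<integral>\<^sup>+s\<in>{0<..}. ennreal (inverse_subordinator_density \<beta> g t s) * (\<integral>\<^sup>+x\<in>Q. ennreal (p s x) \<partial>lborel) \<partial>lborel)"
  unfolding kernel_tonelli[OF assms, symmetric]
  using kernel_AE[OF t] by (intro nn_integral_cong_AE) auto

lemma kernel_integrable:
  assumes t: "0 < t"
  shows "integrable lborel (fractional_kernel \<beta> p g t)"
proof (rule integrableI_nonneg)
  have "(\<integral>\<^sup>+x. ennreal (fractional_kernel \<beta> p g t x) \<partial>lborel)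
      = (\<integral>\<^sup>+s\<in>{0<..}. ennreal (inverse_subordinator_density \<beta> g t s) \<partial>lborel)"
    using stable_mass
    by (subst kernel_nn_integral[OF t, of UNIV, simplified]) (auto intro!: nn_integral_cong simp: indicator_def)
  then show "(\<integral>\<^sup>+x. ennreal (fractional_kernel \<beta> p g t x) \<partial>lborel) < \<infinity>"
    unfolding inverse_subordinator_mass(1)[OF t] by simp
qed (use kernel_nonneg[OF t] in auto)

text \<open>
  A fixed share of the mass of \<open>G t\<close> lies in a cube with side of order \<open>t\<^bsup>\<beta>/\<alpha>\<^esup>\<close>; the second
  bound is Cauchy--Schwarz on this cube.
\<close>

lemma kernel_bounds:
  defines "\<gamma> \<equiv> \<beta> * real DIM('a) / \<alpha>"
  obtains m C where "0 < m" "0 < C"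
    "\<And>t. 0 < t \<Longrightarrow> m \<le> (LINT x|lborel. fractional_kernel \<beta> p g t x)"
    "\<And>t. 0 < t \<Longrightarrow> ennreal (C * t powr (- \<gamma>)) \<le> (\<integral>\<^sup>+x. ennreal ((fractional_kernel \<beta> p g t x)\<^sup>2) \<partial>lborel)"
proof -
  let ?G = "fractional_kernel \<beta> p g" and ?f = "inverse_subordinator_density \<beta> g"
  obtain v where v: "0 < v" "0 < (\<integral>\<^sup>+x\<in>{v..}. ennreal (g x) \<partial>lborel)"
    using subordinator_mass_away_from_zero by blast
  have "(\<integral>\<^sup>+x\<in>{v..}. ennreal (g x) \<partial>lborel) \<le> (\<integral>\<^sup>+x\<in>{0<..}. ennreal (g x) \<partial>lborel)"
    using v(1) by (intro nn_integral_mono) (auto simp: indicator_def)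
  then have "(\<integral>\<^sup>+x\<in>{v..}. ennreal (g x) \<partial>lborel) < \<infinity>"
    unfolding subordinator_mass by (rule le_less_trans) simp
  then obtain w where w: "(\<integral>\<^sup>+x\<in>{v..}. ennreal (g x) \<partial>lborel) = ennreal w" "0 < w"
    using v(2) by (cases "\<integral>\<^sup>+x\<in>{v..}. ennreal (g x) \<partial>lborel") auto
  \<comment> \<open>\<open>w\<close> is the weight of the times
    \<open>s \<le> (t / v) powr \<beta>\<close> under the mixing density, the same for all
    \<open>t\<close>; for each such \<open>s\<close> at least half the mass of \<open>p s\<close>
    lies in the cube.\<close>
  define m where "m = w / 2"
  define d where "d = real DIM('a)"
  have d: "0 < d"
    by (simp add: d_def)
  \<comment> \<open>Chosen so that the tail bound of \<open>stable_cube_mass\<close> equals 1/2 at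
    the largest of these times, \<open>s = (t / v) powr \<beta>\<close>.\<close>
  define \<delta> where "\<delta> t = (1 / (4 * d * \<nu> * (t / v) powr \<beta>)) powr (1 / \<alpha>)" for t
  have \<delta>: "0 < \<delta> t" if "0 < t" for t
    using that v d \<nu> by (simp add: \<delta>_def)
  have mass: "ennreal m \<le> (\<integral>\<^sup>+x\<in>cube (\<delta> t). ennreal (?G t x) \<partial>lborel)" if t: "0 < t" for t
  proof -
    let ?s = "(t / v) powr \<beta>"
    have half: "ennreal (1 / 2) \<le> (\<integral>\<^sup>+x\<in>cube (\<delta> t). ennreal (p s x) \<partial>lborel)" if s: "0 < s" "s \<le> ?s" for s
    proof -
      have "\<delta> t powr \<alpha> = 1 / (4 * d * \<nu> * ?s)"
        using \<alpha> t v d \<nu> by (simp add: \<delta>_def powr_powr)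
      then have "d * (2 * s * \<nu> * \<delta> t powr \<alpha>) = s / ?s / 2"
        using d \<nu> by simp
      also have "\<dots> \<le> 1 / 2"
        using s t v by simp
      finally have "ennreal (d * (2 * s * \<nu> * \<delta> t powr \<alpha>)) \<le> ennreal (1 / 2)"
        by (rule ennreal_leI)
      then have "1 \<le> (\<integral>\<^sup>+x\<in>cube (\<delta> t). ennreal (p s x) \<partial>lborel) + ennreal (1 / 2)"
        using stable_cube_mass[OF s(1) \<delta>[OF t]] unfolding d_def by (meson add_left_mono order_trans)
      moreover have "(1::ennreal) = ennreal (1 / 2) + ennreal (1 / 2)"
        by (subst ennreal_plus[symmetric]) auto
      ultimately have "ennreal (1 / 2) + ennreal (1 / 2) \<le> ennreal (1 / 2) + (\<integral>\<^sup>+x\<in>cube (\<delta> t). ennreal (p s x) \<partial>lborel)"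
        by (simp only: add.commute)
      then show ?thesis
        unfolding ennreal_add_left_cancel_le by simp
    qed
    have "ennreal m = ennreal (1 / 2) * ennreal w"
      using w by (subst ennreal_mult[symmetric]) (auto simp: m_def)
    also have "\<dots> = ennreal (1 / 2) * (\<integral>\<^sup>+s\<in>{0<..?s}. ennreal (?f t s) \<partial>lborel)"
      using inverse_subordinator_mass(2)[OF t v(1)] w by simp
    also have "\<dots> = (\<integral>\<^sup>+s. ennreal (1 / 2) * (ennreal (?f t s) * indicator {0<..?s} s) \<partial>lborel)"
      by (rule nn_integral_cmult[symmetric]) measurable
    also have "\<dots> \<le> (\<integral>\<^sup>+s\<in>{0<..}. ennreal (?f t s) * (\<integral>\<^sup>+x\<in>cube (\<delta> t). ennreal (p s x) \<partial>lborel) \<partial>lborel)"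
    proof (rule nn_integral_mono)
      fix s :: real
      show "ennreal (1 / 2) * (ennreal (?f t s) * indicator {0<..?s} s)
          \<le> ennreal (?f t s) * (\<integral>\<^sup>+x\<in>cube (\<delta> t). ennreal (p s x) \<partial>lborel) * indicator {0<..} s"
      proof (cases "s \<in> {0<..?s}")
        case True
        then have "ennreal (?f t s) * ennreal (1 / 2) \<le> ennreal (?f t s) * (\<integral>\<^sup>+x\<in>cube (\<delta> t). ennreal (p s x) \<partial>lborel)"
          using half by (intro mult_left_mono) auto
        then show ?thesis
          using True by (simp add: mult.commute[of "ennreal (1 / 2)"] del: ennreal_half)
      qed simp
    qed
    also have "\<dots> = (\<integral>\<^sup>+x\<in>cube (\<delta> t). ennreal (?G t x) \<partial>lborel)"
      using \<delta>[OF t] by (intro kernel_nn_integral[OF t, symmetric]) auto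
    finally show ?thesis .
  qed
  have "m \<le> (LINT x|lborel. ?G t x)" if t: "0 < t" for t
  proof -
    have "ennreal m \<le> (\<integral>\<^sup>+x\<in>cube (\<delta> t). ennreal (?G t x) \<partial>lborel)"
      by (rule mass[OF t])
    also have "\<dots> \<le> (\<integral>\<^sup>+x. ennreal (?G t x) \<partial>lborel)"
      by (intro nn_integral_mono) (auto simp: indicator_def)
    also have "\<dots> = ennreal (LINT x|lborel. ?G t x)"
      using kernel_nonneg[OF t] by (intro nn_integral_eq_integral kernel_integrable t) auto
    finally show ?thesis
      using kernel_nonneg[OF t] by (subst (asm) ennreal_le_iff) auto
  qed
  \<comment> \<open>\<open>C\<close> is what remains of \<open>m\<^sup>2\<close> divided by the
    volume of the cube when the factor \<open>t powr \<gamma>\<close> of the volume is split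
    off.\<close>
  moreover define C where "C = m\<^sup>2 / (4 ^ DIM('a) * (4 * d * \<nu> / v powr \<beta>) powr (d / \<alpha>))"
  moreover have "ennreal (C * t powr (- \<gamma>)) \<le> (\<integral>\<^sup>+x. ennreal ((?G t x)\<^sup>2) \<partial>lborel)" if t: "0 < t" for t
  proof -
    let ?Q = "cube (\<delta> t) :: 'a set" and ?V = "(4 / \<delta> t) ^ DIM('a)"
    have V: "0 < ?V"
      using \<delta>[OF t] by simp
    have [measurable]: "?Q \<in> sets borel"
      using \<delta>[OF t] by simp
    \<comment> \<open>Integrating \<open>2 * \<theta> * G \<le> G\<^sup>2 + \<theta>\<^sup>2\<close>
      over the cube bounds the square integral below by
      \<open>2 * \<theta> * m - \<theta>\<^sup>2 * ?V\<close>; this \<open>\<theta>\<close>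
      maximises the bound, with value \<open>m\<^sup>2 / ?V\<close>.\<close>
    define \<theta> where "\<theta> = m / ?V"
    have \<theta>: "0 < \<theta>"
      using V w by (simp add: \<theta>_def m_def)
    have "ennreal (2 * \<theta> * m) \<le> ennreal (2 * \<theta>) * (\<integral>\<^sup>+x\<in>?Q. ennreal (?G t x) \<partial>lborel)"
      using mass[OF t] \<theta> w by (subst ennreal_mult) (auto simp: m_def intro!: mult_left_mono)
    also have "\<dots> = (\<integral>\<^sup>+x. ennreal (2 * \<theta>) * (ennreal (?G t x) * indicator ?Q x) \<partial>lborel)"
      by (rule nn_integral_cmult[symmetric]) measurable
    also have "\<dots> \<le> (\<integral>\<^sup>+x. ennreal ((?G t x)\<^sup>2) + ennreal (\<theta>\<^sup>2) * indicator ?Q x \<partial>lborel)"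
    proof (rule nn_integral_mono)
      fix x :: 'a
      have "2 * \<theta> * ?G t x \<le> (?G t x)\<^sup>2 + \<theta>\<^sup>2"
        using sum_squares_bound[of \<theta> "?G t x"] by simp
      then have "ennreal (2 * \<theta>) * ennreal (?G t x) \<le> ennreal ((?G t x)\<^sup>2) + ennreal (\<theta>\<^sup>2)"
        using \<theta> kernel_nonneg[OF t] by (simp add: ennreal_mult[symmetric] ennreal_plus[symmetric] ennreal_leI del: ennreal_plus)
      then show "ennreal (2 * \<theta>) * (ennreal (?G t x) * indicator ?Q x) \<le> ennreal ((?G t x)\<^sup>2) + ennreal (\<theta>\<^sup>2) * indicator ?Q x"
        by (auto simp: indicator_def)
    qed
    also have "\<dots> = (\<integral>\<^sup>+x. ennreal ((?G t x)\<^sup>2) \<partial>lborel) + ennreal (\<theta>\<^sup>2) * emeasure lborel ?Q"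
      by (subst nn_integral_add) (auto simp: nn_integral_cmult_indicator)
    also have "ennreal (\<theta>\<^sup>2) * emeasure lborel ?Q = ennreal (\<theta>\<^sup>2 * ?V)"
      using V by (simp add: emeasure_cube[OF \<delta>[OF t]] ennreal_mult)
    finally have le: "ennreal (2 * \<theta> * m) \<le> (\<integral>\<^sup>+x. ennreal ((?G t x)\<^sup>2) \<partial>lborel) + ennreal (\<theta>\<^sup>2 * ?V)" .
    have "2 * \<theta> * m = m\<^sup>2 / ?V + \<theta>\<^sup>2 * ?V"
      using V by (simp add: \<theta>_def power2_eq_square field_simps)
    then have "ennreal (2 * \<theta> * m) = ennreal (m\<^sup>2 / ?V) + ennreal (\<theta>\<^sup>2 * ?V)"
      using V by (simp add: ennreal_plus[symmetric] del: ennreal_plus)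
    with le have "ennreal (\<theta>\<^sup>2 * ?V) + ennreal (m\<^sup>2 / ?V) \<le> ennreal (\<theta>\<^sup>2 * ?V) + (\<integral>\<^sup>+x. ennreal ((?G t x)\<^sup>2) \<partial>lborel)"
      by (simp only: add.commute)
    then have *: "ennreal (m\<^sup>2 / ?V) \<le> (\<integral>\<^sup>+x. ennreal ((?G t x)\<^sup>2) \<partial>lborel)"
      unfolding ennreal_add_left_cancel_le by simp
    define E where "E = ((4 * d * \<nu> / v powr \<beta>) * t powr \<beta>) powr (1 / \<alpha>)"
    have "1 / \<delta> t = E" "0 < E"
      using t v d \<nu> by (simp_all add: \<delta>_def E_def powr_divide)
    then have "4 / \<delta> t = 4 * E"
      by (metis mult.commute mult_1 times_divide_eq_right)
    then have "?V = 4 ^ DIM('a) * E ^ DIM('a)"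
      by (simp add: power_mult_distrib)
    also have "\<dots> = 4 ^ DIM('a) * E powr d"
      using \<open>0 < E\<close> by (simp add: d_def powr_realpow)
    also have "\<dots> = 4 ^ DIM('a) * (4 * d * \<nu> / v powr \<beta>) powr (d / \<alpha>) * t powr \<gamma>"
    proof -
      define k where "k = 4 * d * \<nu> / v powr \<beta>"
      have "0 < k"
        using v d \<nu> by (simp add: k_def)
      then show ?thesis
        unfolding E_def k_def[symmetric] using t by (simp add: powr_powr powr_mult \<gamma>_def d_def)
    qed
    finally have "m\<^sup>2 / ?V = C * t powr (- \<gamma>)"
      by (simp add: C_def powr_minus field_simps)
    with * show ?thesis
      by simp
  qed
  moreover have "0 < m" "0 < C"
    using w v d \<nu> by (auto simp: m_def C_def)
  ultimately show ?thesis
    using that by blast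
qed

end

section \<open>Blow-up of the second moment\<close>

text \<open>
  Losing the factor \<open>2\<^bsup>\<rho>\<^esup>\<close> against Jensen's inequality allows a proof by splitting at \<open>a / 2\<close>,
  and the \<open>\<rho>\<close>-th moment need not be finite.
\<close>

lemma (in prob_space) power_moment_lower:
  fixes v :: "'a \<Rightarrow> real"
  assumes [measurable]: "v \<in> borel_measurable M" and nonneg: "\<And>\<omega>. 0 \<le> v \<omega>"
    and a: "0 < a" "ennreal a \<le> (\<integral>\<^sup>+\<omega>. ennreal (v \<omega>) \<partial>M)" and \<rho>: "1 < \<rho>"
  shows "ennreal ((a / 2) powr \<rho>) \<le> (\<integral>\<^sup>+\<omega>. ennreal (v \<omega> powr \<rho>) \<partial>M)"
proof -
  define l where "l = a / 2"
  have l: "0 < l"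
    using a by (simp add: l_def)
  \<comment> \<open>For \<open>x\<close> below \<open>l\<close> the constant term alone dominates,
    above \<open>l\<close> the power does.\<close>
  have pw: "l powr (\<rho> - 1) * x \<le> x powr \<rho> + l powr \<rho>" if "0 \<le> x" for x
  proof (cases "x \<le> l")
    case True
    then have "l powr (\<rho> - 1) * x \<le> l powr (\<rho> - 1) * l"
      by (intro mult_left_mono) auto
    also have "\<dots> = l powr \<rho>"
      using l by (simp add: powr_diff)
    finally show ?thesis
      by (simp add: add_increasing)
  next
    case False
    then have "l powr (\<rho> - 1) * x \<le> x powr (\<rho> - 1) * x"
      using that l \<rho> by (intro mult_right_mono powr_mono2) auto
    also have "\<dots> = x powr \<rho>"
      using False l by (simp add: powr_diff)
    finally show ?thesis
      by (simp add: add_increasing2)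
  qed
  \<comment> \<open>As \<open>a = 2 * l\<close>, the integrated left side of \<open>pw\<close> is at
    least two copies of \<open>l powr \<rho>\<close>; one of them pays for the constant term and is
    cancelled.\<close>
  have "ennreal (l powr \<rho>) + ennreal (l powr \<rho>) = ennreal (l powr (\<rho> - 1) * a)"
    using l by (simp add: l_def powr_diff ennreal_plus[symmetric] del: ennreal_plus)
  also have "\<dots> \<le> ennreal (l powr (\<rho> - 1)) * (\<integral>\<^sup>+\<omega>. ennreal (v \<omega>) \<partial>M)"
    using a by (simp add: ennreal_mult mult_left_mono)
  also have "\<dots> = (\<integral>\<^sup>+\<omega>. ennreal (l powr (\<rho> - 1) * v \<omega>) \<partial>M)"
    using nonneg by (simp add: nn_integral_cmult ennreal_mult)
  also have "\<dots> \<le> (\<integral>\<^sup>+\<omega>. ennreal (v \<omega> powr \<rho>) + ennreal (l powr \<rho>) \<partial>M)"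
    using pw[OF nonneg] by (intro nn_integral_mono) (simp add: ennreal_plus[symmetric] ennreal_leI del: ennreal_plus)
  also have "\<dots> = ennreal (l powr \<rho>) + (\<integral>\<^sup>+\<omega>. ennreal (v \<omega> powr \<rho>) \<partial>M)"
    by (subst nn_integral_add) (auto simp: emeasure_space_1 add.commute)
  finally show ?thesis
    unfolding ennreal_add_left_cancel_le by (simp add: l_def)
qed

text \<open>From level \<open>a\<close> the level \<open>2 * a\<close> is reached after time
  \<open>2 * a powr (1 - \<rho>) / k\<close>, when \<open>k * a powr \<rho> * (t - r)\<close> equals
  \<open>2 * a\<close>. For \<open>a = 2 ^ n * b\<close> this time is \<open>D * q ^ n\<close>, and
  the condition on \<open>T\<close> says that the sum of all these times,
  \<open>D / (1 - q)\<close>, is less than \<open>T\<close>.\<close>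

lemma doubling_blowup:
  fixes U :: "real \<Rightarrow> 'x \<Rightarrow> ennreal"
  assumes b: "0 < b" and k: "0 < k" and \<rho>: "1 < \<rho>"
    and base: "\<And>t x. 0 < t \<Longrightarrow> t \<le> T \<Longrightarrow> ennreal b \<le> U t x"
    and step: "\<And>a r t x. 0 < a \<Longrightarrow> 0 \<le> r \<Longrightarrow> r < t \<Longrightarrow> t \<le> T \<Longrightarrow>
      (\<And>s y. r < s \<Longrightarrow> s < t \<Longrightarrow> ennreal a \<le> U s y) \<Longrightarrow> ennreal (k * a powr \<rho> * (t - r)) \<le> U t x"
    and T: "2 * b powr (1 - \<rho>) / k / (1 - 2 powr (1 - \<rho>)) < T"
  shows "U T x = \<infinity>"
proof -
  define q where "q = (2::real) powr (1 - \<rho>)"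
  define D where "D = 2 * b powr (1 - \<rho>) / k"
  have q: "0 < q" "q < 1"
    using \<rho> by (auto simp: q_def powr_less_one)
  have D: "0 < D"
    using b k by (simp add: D_def)
  \<comment> \<open>The claim covers all positions \<open>y\<close> at once, because
    \<open>step\<close> asks for the lower bound everywhere on the preceding open time interval. For
    \<open>n = 0\<close> the sum is empty and the strict inequality reads \<open>0 < t\<close>, as
    in \<open>base\<close>.\<close>
  have *: "D * (\<Sum>i<n. q ^ i) < t \<Longrightarrow> t \<le> T \<Longrightarrow> ennreal (2 ^ n * b) \<le> U t y" for n t y
  proof (induction n arbitrary: t y)
    case 0
    then show ?case
      using base by simp
  next
    case (Suc n)
    define r where "r = D * (\<Sum>i<n. q ^ i)"
    define a where "a = 2 ^ n * b"
    have a: "0 < a"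
      using b by (simp add: a_def)
    have r: "0 \<le> r"
      using D q by (simp add: r_def sum_nonneg)
    have tr: "D * q ^ n < t - r"
      using Suc.prems by (simp add: r_def algebra_simps)
    then have rt: "r < t"
      using D q by (smt (verit) mult_nonneg_nonneg zero_le_power)
    have "ennreal (k * a powr \<rho> * (t - r)) \<le> U t y"
      using Suc a r rt by (intro step) (auto simp: a_def r_def)
    moreover have "2 ^ Suc n * b \<le> k * a powr \<rho> * (t - r)"
    proof -
      have "q ^ n = (2 ^ n) powr (1 - \<rho>)"
        by (simp add: q_def powr_realpow[symmetric] powr_powr mult.commute)
      then have "a powr (1 - \<rho>) = b powr (1 - \<rho>) * q ^ n"
        using b by (simp add: a_def powr_mult)
      then have "k * a powr \<rho> * (D * q ^ n) = 2 * (a powr \<rho> * a powr (1 - \<rho>))"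
        using k by (simp add: D_def)
      also have "\<dots> = 2 ^ Suc n * b"
        using a by (simp add: powr_add[symmetric] a_def)
      finally have "2 ^ Suc n * b = k * a powr \<rho> * (D * q ^ n)" ..
      also have "\<dots> \<le> k * a powr \<rho> * (t - r)"
        using tr k by (intro mult_left_mono) auto
      finally show ?thesis .
    qed
    ultimately show ?case
      by (meson ennreal_leI order_trans)
  qed
  have "D * (\<Sum>i<n. q ^ i) < T" for n
  proof -
    have "(\<Sum>i<n. q ^ i) = (1 - q ^ n) / (1 - q)"
      using q sum_gp_strict[of q n] by auto
    also have "\<dots> \<le> 1 / (1 - q)"
      using q by (intro divide_right_mono) auto
    finally have "D * (\<Sum>i<n. q ^ i) \<le> D * (1 / (1 - q))"
      using D by (intro mult_left_mono) auto
    also have "\<dots> < T"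
      using T by (simp add: D_def q_def)
    finally show ?thesis .
  qed
  then have large: "ennreal (2 ^ n * b) \<le> U T x" for n
    using * by blast
  show ?thesis
  proof (rule ccontr)
    assume "U T x \<noteq> \<infinity>"
    then obtain w where w: "U T x = ennreal w" "0 \<le> w"
      by (cases "U T x") auto
    obtain n where "w / b < 2 ^ n"
      using real_arch_pow[of 2 "w / b"] by auto
    then have "w < 2 ^ n * b"
      using b by (simp add: field_simps)
    moreover have "2 ^ n * b \<le> w"
      using large[of n] w by (simp add: ennreal_le_iff)
    ultimately show False
      by simp
  qed
qed

lemma nn_integral_reflect_shift:
  fixes f :: "'a::euclidean_space \<Rightarrow> ennreal"
  assumes [measurable]: "f \<in> borel_measurable borel"
  shows "(\<integral>\<^sup>+y. f (x - y) \<partial>lborel) = (\<integral>\<^sup>+y. f y \<partial>lborel)"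
proof -
  have "lborel = density (distr lborel borel (\<lambda>y. x - y)) (\<lambda>_. 1)"
    using lborel_affine[of "- 1" x] by simp
  then have "(lborel :: 'a measure) = distr lborel borel (\<lambda>y. x - y)"
    by (simp add: density_1)
  then have "(\<integral>\<^sup>+y. f y \<partial>lborel) = (\<integral>\<^sup>+y. f y \<partial>distr lborel borel (\<lambda>y. x - y))"
    by simp
  also have "\<dots> = (\<integral>\<^sup>+y. f (x - y) \<partial>lborel)"
    by (subst nn_integral_distr) auto
  finally show ?thesis ..
qed

section \<open>The second moment of a mild solution\<close>

locale fractional_mild_solution =
  fractional_densities \<alpha> \<beta> \<nu> p g + poisson_noise M "lborel \<Otimes>\<^sub>M \<mu>" N
  for \<alpha> \<beta> \<nu> :: real and p :: "real \<Rightarrow> 'a::euclidean_space \<Rightarrow> real" and g :: "real \<Rightarrow> real"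
    and M :: "'w measure" and \<mu> :: "'a measure" and N :: "'w \<Rightarrow> (real \<times> 'a \<times> 'a) measure" +
  fixes \<sigma> :: "real \<Rightarrow> 'a \<Rightarrow> real" and u\<^sub>0 :: "'a \<Rightarrow> real" and u :: "real \<Rightarrow> 'a \<Rightarrow> 'w \<Rightarrow> real"
  assumes mild: "mild_solution M \<mu> N (fractional_kernel \<beta> p g) \<sigma> u\<^sub>0 u"
    and \<mu>_sets: "sets \<mu> = sets borel" and \<mu>_finite: "sigma_finite_measure \<mu>"
begin

abbreviation G :: "real \<Rightarrow> 'a \<Rightarrow> real" where
  "G \<equiv> fractional_kernel \<beta> p g"

definition second_moment :: "real \<Rightarrow> 'a \<Rightarrow> ennreal" where
  "second_moment t x = (\<integral>\<^sup>+\<omega>. ennreal ((u t x \<omega>)\<^sup>2) \<partial>M)"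

lemma field_measurable: "0 < t \<Longrightarrow> u t x \<in> borel_measurable M"
  using mild predictable_section[of "\<lambda>(\<omega>, t, x). u t x \<omega>" borel t x] unfolding mild_solution_def by simp

text \<open>The stochastic integral has mean 0, so the mixed term of the square drops out and two
  nonnegative summands remain. Each alone is a lower bound, the second one after the inequality of
  the isometry.\<close>

lemma second_moment_decomposition:
  assumes t: "0 < t"
  shows "ennreal ((LINT y|lborel. G t (x - y) * u\<^sub>0 y)\<^sup>2) \<le> second_moment t x"
    and "(\<integral>\<^sup>+(s, y, h). (\<integral>\<^sup>+\<omega>. ennreal ((indicator {0<..<t} s * G (t - s) (x - y) * \<sigma> (u s y \<omega>) h)\<^sup>2) \<partial>M)
        \<partial>intensity (lborel \<Otimes>\<^sub>M \<mu>)) \<le> second_moment t x"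
proof -
  define X where "X = (\<lambda>\<omega> s (y, h). indicator {0<..<t} s * G (t - s) (x - y) * \<sigma> (u s y \<omega>) h)"
  define w where "w = (LINT y|lborel. G t (x - y) * u\<^sub>0 y)"
  obtain Z where Z: "has_compensated_integral M (lborel \<Otimes>\<^sub>M \<mu>) N X Z"
    and uZ: "AE \<omega> in M. u t x \<omega> = w + Z \<omega>"
    using mild t unfolding mild_solution_def X_def w_def by blast
  have X0: "X \<omega> s k = 0" if "s \<le> 0" for \<omega> s k
    using that by (cases k) (simp add: X_def)
  note Z = compensated_integral_bounds[OF Z X0]
  have eq: "(w + Z \<omega>)\<^sup>2 = w\<^sup>2 + 2 * w * Z \<omega> + (Z \<omega>)\<^sup>2" for \<omega>
    by (simp add: power2_eq_square algebra_simps)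
  have int: "integrable M (\<lambda>\<omega>. (w + Z \<omega>)\<^sup>2)"
    unfolding eq using Z(1,2) by simp
  have "expectation (\<lambda>\<omega>. (w + Z \<omega>)\<^sup>2) = w\<^sup>2 + expectation (\<lambda>\<omega>. (Z \<omega>)\<^sup>2)"
    unfolding eq using Z(1-3) by (simp add: prob_space)
  moreover have "second_moment t x = (\<integral>\<^sup>+\<omega>. ennreal ((w + Z \<omega>)\<^sup>2) \<partial>M)"
    unfolding second_moment_def using uZ by (intro nn_integral_cong_AE) auto
  ultimately have "second_moment t x = ennreal (w\<^sup>2 + expectation (\<lambda>\<omega>. (Z \<omega>)\<^sup>2))"
    using nn_integral_eq_integral[OF int] by simp
  also have "\<dots> = ennreal (w\<^sup>2) + (\<integral>\<^sup>+\<omega>. ennreal ((Z \<omega>)\<^sup>2) \<partial>M)"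
    using nn_integral_eq_integral[OF Z(2)] by simp
  finally have sm: "second_moment t x = ennreal (w\<^sup>2) + (\<integral>\<^sup>+\<omega>. ennreal ((Z \<omega>)\<^sup>2) \<partial>M)" .
  show "ennreal ((LINT y|lborel. G t (x - y) * u\<^sub>0 y)\<^sup>2) \<le> second_moment t x"
    unfolding sm w_def by simp
  have "(\<integral>\<^sup>+(s, k). (\<integral>\<^sup>+\<omega>. ennreal ((X \<omega> s k)\<^sup>2) \<partial>M) \<partial>intensity (lborel \<Otimes>\<^sub>M \<mu>)) \<le> second_moment t x"
    unfolding sm using Z(4) by (simp add: add_increasing)
  then show "(\<integral>\<^sup>+(s, y, h). (\<integral>\<^sup>+\<omega>. ennreal ((indicator {0<..<t} s * G (t - s) (x - y) * \<sigma> (u s y \<omega>) h)\<^sup>2) \<partial>M)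
        \<partial>intensity (lborel \<Otimes>\<^sub>M \<mu>)) \<le> second_moment t x"
    by (simp add: X_def split_beta')
qed

text \<open>The kernel is nonnegative with mass at least \<open>m\<close>, and
  \<open>u\<^sub>0\<close> is at least \<open>c\<close>. Boundedness of \<open>u\<^sub>0\<close>
  gives integrability of the product, so that the Bochner integral does not take its default value
  0.\<close>

lemma initial_average_lower:
  assumes u0 [measurable]: "u\<^sub>0 \<in> borel_measurable borel" and bd: "bounded (range u\<^sub>0)"
    and c: "0 \<le> c" "\<And>x. c \<le> u\<^sub>0 x" and m: "m \<le> (LINT x|lborel. G t x)" and t: "0 < t"
  shows "m * c \<le> (LINT y|lborel. G t (x - y) * u\<^sub>0 y)"
proof -
  obtain B where B: "\<And>x. \<bar>u\<^sub>0 x\<bar> \<le> B"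
    using bd by (auto simp: bounded_iff)
  have G0: "0 \<le> G t y" for y
    by (rule kernel_nonneg[OF t])
  have nn: "(\<integral>\<^sup>+y. ennreal (G t (x - y)) \<partial>lborel) = ennreal (LINT x|lborel. G t x)"
    using G0 nn_integral_reflect_shift[of "\<lambda>y. ennreal (G t y)" x] nn_integral_eq_integral[OF kernel_integrable[OF t]] by simp
  have Gi: "integrable lborel (\<lambda>y. G t (x - y))" "(LINT y|lborel. G t (x - y)) = (LINT x|lborel. G t x)"
    using nn G0 nn_integral_eq_integrable[of "\<lambda>y. G t (x - y)" lborel "LINT x|lborel. G t x"]
    by (auto simp: Bochner_Integration.integral_nonneg)
  have "integrable lborel (\<lambda>y. G t (x - y) * u\<^sub>0 y)"
  proof (rule Bochner_Integration.integrable_bound)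
    show "integrable lborel (\<lambda>y. B * G t (x - y))"
      using Gi by simp
    show "AE y in lborel. norm (G t (x - y) * u\<^sub>0 y) \<le> norm (B * G t (x - y))"
      using B G0 by (intro AE_I2) (auto simp: abs_mult mult.commute intro!: mult_right_mono order_trans[OF B])
  qed auto
  moreover have "integrable lborel (\<lambda>y. G t (x - y) * c)"
    using Gi by simp
  ultimately have "(LINT y|lborel. G t (x - y) * c) \<le> (LINT y|lborel. G t (x - y) * u\<^sub>0 y)"
    using c G0 by (intro integral_mono mult_left_mono) auto
  moreover have "m * c \<le> (LINT y|lborel. G t (x - y) * c)"
    using m c Gi(2) by (simp add: mult_right_mono)
  ultimately show ?thesis
    by simp
qed

text \<open>Four lower bounds are multiplied: the growth of \<open>\<sigma>\<close> gives
  \<open>L\<^sup>2 * (J h)\<^sup>2\<close>, the moment inequality for the square of \<open>u\<close>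
  gives \<open>(a / 2) powr \<rho>\<close>, the marks give \<open>\<kappa>\<close>, and the kernel
  gives \<open>C * T powr (- \<gamma>)\<close>. Since the last bound is uniform over the horizon,
  the time integral contributes just the length \<open>t - r\<close>.\<close>

lemma second_moment_growth:
  fixes J :: "'a \<Rightarrow> real"
  assumes L: "0 < L" and \<rho>: "1 < \<rho>" and \<kappa>: "0 < \<kappa>" and J [measurable]: "J \<in> borel_measurable borel" "\<And>h. 0 < J h"
    and \<sigma>J: "\<And>x h. L * J h * \<bar>x\<bar> powr \<rho> \<le> \<bar>\<sigma> x h\<bar>"
    and J\<kappa>: "ennreal \<kappa> \<le> (\<integral>\<^sup>+h. ennreal ((J h)\<^sup>2) \<partial>\<mu>)"
    and C: "0 < C" "\<And>s. 0 < s \<Longrightarrow> ennreal (C * s powr (- \<gamma>)) \<le> (\<integral>\<^sup>+x. ennreal ((G s x)\<^sup>2) \<partial>lborel)"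
    and \<gamma>: "0 \<le> \<gamma>" and a: "0 < a" and r: "0 \<le> r" "r < t" "t \<le> T"
    and lower: "\<And>s y. r < s \<Longrightarrow> s < t \<Longrightarrow> ennreal a \<le> second_moment s y"
  shows "ennreal (L\<^sup>2 * \<kappa> * C * T powr (- \<gamma>) / 2 powr \<rho> * a powr \<rho> * (t - r)) \<le> second_moment t x"
proof -
  have t: "0 < t"
    using r by simp
  interpret \<mu>: sigma_finite_measure \<mu>
    by (rule \<mu>_finite)
  have [measurable_cong]: "sets \<mu> = sets borel"
    by (rule \<mu>_sets)
  define e where "e = (a / 2) powr \<rho>"
  have e: "0 < e"
    using a by (simp add: e_def)
  \<comment> \<open>\<open>F\<close> is an explicit minorant in product form: its measurability is
    immediate and its iterated integral factorises, while the expectation of the squared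
    \<open>\<sigma>\<close> enters only through the pointwise comparison \<open>low\<close>.\<close>
  define F where "F s y h = indicator {r<..<t} s * (ennreal ((G (t - s) (x - y))\<^sup>2) * (ennreal (L\<^sup>2 * e) * ennreal ((J h)\<^sup>2)))" for s y h
  have Fm: "(\<lambda>(s, y, h). F s y h) \<in> borel_measurable (intensity (lborel \<Otimes>\<^sub>M \<mu>))"
  proof -
    have F: "(\<lambda>(s, y, h). F s y h) \<in> borel_measurable (lborel \<Otimes>\<^sub>M lborel \<Otimes>\<^sub>M \<mu>)"
      unfolding F_def by measurable
    have "(\<lambda>z. (fst z, snd z)) \<in> intensity (lborel \<Otimes>\<^sub>M \<mu>) \<rightarrow>\<^sub>M lborel \<Otimes>\<^sub>M lborel \<Otimes>\<^sub>M \<mu>"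
      unfolding intensity_def
      by (intro measurable_Pair measurable_snd measurable_compose[OF measurable_fst measurable_restrict_space1]) simp
    from measurable_compose[OF this F] show ?thesis
      by simp
  qed
  have low: "F s y h \<le> (\<integral>\<^sup>+\<omega>. ennreal ((indicator {0<..<t} s * G (t - s) (x - y) * \<sigma> (u s y \<omega>) h)\<^sup>2) \<partial>M)" for s y h
  proof (cases "s \<in> {r<..<t}")
    case True
    then have s: "0 < s" "r < s" "s < t"
      using r by auto
    note [measurable] = field_measurable[OF s(1)]
    have "ennreal e \<le> (\<integral>\<^sup>+\<omega>. ennreal ((u s y \<omega>)\<^sup>2 powr \<rho>) \<partial>M)"
      unfolding e_def using lower[OF s(2,3), of y] a \<rho> by (intro power_moment_lower) (auto simp: second_moment_def)
    moreover have "ennreal (L\<^sup>2 * e) * ennreal ((J h)\<^sup>2) = ennreal (L\<^sup>2 * (J h)\<^sup>2) * ennreal e"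
      using e by (simp add: ennreal_mult mult_ac)
    ultimately have "ennreal (L\<^sup>2 * e) * ennreal ((J h)\<^sup>2) \<le> ennreal (L\<^sup>2 * (J h)\<^sup>2) * (\<integral>\<^sup>+\<omega>. ennreal ((u s y \<omega>)\<^sup>2 powr \<rho>) \<partial>M)"
      by (simp only: mult_left_mono zero_le)
    also have "\<dots> = (\<integral>\<^sup>+\<omega>. ennreal (L\<^sup>2 * (J h)\<^sup>2) * ennreal ((u s y \<omega>)\<^sup>2 powr \<rho>) \<partial>M)"
      by (rule nn_integral_cmult[symmetric]) measurable
    finally have "ennreal ((G (t - s) (x - y))\<^sup>2) * (ennreal (L\<^sup>2 * e) * ennreal ((J h)\<^sup>2))
        \<le> ennreal ((G (t - s) (x - y))\<^sup>2) * (\<integral>\<^sup>+\<omega>. ennreal (L\<^sup>2 * (J h)\<^sup>2) * ennreal ((u s y \<omega>)\<^sup>2 powr \<rho>) \<partial>M)"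
      by (rule mult_left_mono) simp
    also have "\<dots> = (\<integral>\<^sup>+\<omega>. ennreal ((G (t - s) (x - y))\<^sup>2) * (ennreal (L\<^sup>2 * (J h)\<^sup>2) * ennreal ((u s y \<omega>)\<^sup>2 powr \<rho>)) \<partial>M)"
      by (rule nn_integral_cmult[symmetric]) measurable
    also have "\<dots> \<le> (\<integral>\<^sup>+\<omega>. ennreal ((indicator {0<..<t} s * G (t - s) (x - y) * \<sigma> (u s y \<omega>) h)\<^sup>2) \<partial>M)"
    proof (rule nn_integral_mono)
      fix \<omega>
      have "L\<^sup>2 * (J h)\<^sup>2 * (u s y \<omega>)\<^sup>2 powr \<rho> = (L * J h * \<bar>u s y \<omega>\<bar> powr \<rho>)\<^sup>2"
      proof -
        have "(u s y \<omega>)\<^sup>2 powr \<rho> = (\<bar>u s y \<omega>\<bar> * \<bar>u s y \<omega>\<bar>) powr \<rho>"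
          by (simp add: power2_eq_square abs_mult[symmetric])
        also have "\<dots> = (\<bar>u s y \<omega>\<bar> powr \<rho>)\<^sup>2"
          by (subst powr_mult) (auto simp: power2_eq_square)
        finally show ?thesis
          by (simp add: power_mult_distrib)
      qed
      also have "\<dots> \<le> (\<bar>\<sigma> (u s y \<omega>) h\<bar>)\<^sup>2"
        using \<sigma>J[of h "u s y \<omega>"] L J(2)[of h] by (intro power_mono) auto
      finally have "(G (t - s) (x - y))\<^sup>2 * (L\<^sup>2 * (J h)\<^sup>2 * (u s y \<omega>)\<^sup>2 powr \<rho>) \<le> (G (t - s) (x - y))\<^sup>2 * (\<sigma> (u s y \<omega>) h)\<^sup>2"
        by (intro mult_left_mono) auto
      also have "\<dots> = (indicator {0<..<t} s * G (t - s) (x - y) * \<sigma> (u s y \<omega>) h)\<^sup>2"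
        using s by (simp add: power_mult_distrib)
      finally show "ennreal ((G (t - s) (x - y))\<^sup>2) * (ennreal (L\<^sup>2 * (J h)\<^sup>2) * ennreal ((u s y \<omega>)\<^sup>2 powr \<rho>))
          \<le> ennreal ((indicator {0<..<t} s * G (t - s) (x - y) * \<sigma> (u s y \<omega>) h)\<^sup>2)"
        by (simp add: ennreal_mult[symmetric] ennreal_leI)
    qed
    finally show ?thesis
      using True by (simp add: F_def)
  qed (simp add: F_def)
  have "ennreal (L\<^sup>2 * \<kappa> * C * T powr (- \<gamma>) / 2 powr \<rho> * a powr \<rho> * (t - r))
      = (\<integral>\<^sup>+s. ennreal (C * T powr (- \<gamma>) * (L\<^sup>2 * e * \<kappa>)) * indicator {r<..<t} s \<partial>restrict_space lborel {0..})"
  proof -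
    have "emeasure (restrict_space lborel {0..}) {r<..<t} = ennreal (t - r)"
      using r by (subst emeasure_restrict_space) auto
    moreover have "{r<..<t} \<in> sets (restrict_space lborel {0::real..})"
      using r by (auto simp: sets_restrict_space image_iff intro!: bexI[of _ "{r<..<t}"])
    ultimately have "(\<integral>\<^sup>+s. ennreal (C * T powr (- \<gamma>) * (L\<^sup>2 * e * \<kappa>)) * indicator {r<..<t} s \<partial>restrict_space lborel {0..})
        = ennreal (C * T powr (- \<gamma>) * (L\<^sup>2 * e * \<kappa>)) * ennreal (t - r)"
      by (simp add: nn_integral_cmult_indicator)
    moreover have "e = a powr \<rho> / 2 powr \<rho>"
      using a by (simp add: e_def powr_divide)
    ultimately show ?thesis
      using C(1) \<kappa> r a by (simp add: ennreal_mult[symmetric] mult_ac)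
  qed
  also have "\<dots> \<le> (\<integral>\<^sup>+s. (\<integral>\<^sup>+y. (\<integral>\<^sup>+h. F s y h \<partial>\<mu>) \<partial>lborel) \<partial>restrict_space lborel {0..})"
  proof (rule nn_integral_mono)
    fix s :: real
    show "ennreal (C * T powr (- \<gamma>) * (L\<^sup>2 * e * \<kappa>)) * indicator {r<..<t} s \<le> (\<integral>\<^sup>+y. (\<integral>\<^sup>+h. F s y h \<partial>\<mu>) \<partial>lborel)"
    proof (cases "s \<in> {r<..<t}")
      case True
      then have s: "0 < t - s" "t - s \<le> T"
        using r by auto
      \<comment> \<open>As \<open>\<gamma>\<close> is nonnegative and \<open>t - s \<le> T\<close>,
        the kernel bound is smallest at the full horizon.\<close>
      have "T powr (- \<gamma>) \<le> (t - s) powr (- \<gamma>)"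
        using s \<gamma> by (intro powr_mono2') auto
      then have "ennreal (C * T powr (- \<gamma>)) \<le> ennreal (C * (t - s) powr (- \<gamma>))"
        using C(1) by (intro ennreal_leI mult_left_mono) auto
      also have "\<dots> \<le> (\<integral>\<^sup>+y. ennreal ((G (t - s) y)\<^sup>2) \<partial>lborel)"
        by (rule C(2)[OF s(1)])
      also have "\<dots> = (\<integral>\<^sup>+y. ennreal ((G (t - s) (x - y))\<^sup>2) \<partial>lborel)"
        by (rule nn_integral_reflect_shift[symmetric]) measurable
      finally have G: "ennreal (C * T powr (- \<gamma>)) \<le> (\<integral>\<^sup>+y. ennreal ((G (t - s) (x - y))\<^sup>2) \<partial>lborel)" .
      have "ennreal (C * T powr (- \<gamma>) * (L\<^sup>2 * e * \<kappa>)) = ennreal (C * T powr (- \<gamma>)) * (ennreal (L\<^sup>2 * e) * ennreal \<kappa>)"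
        using C(1) e \<kappa> by (simp add: ennreal_mult)
      also have "\<dots> \<le> (\<integral>\<^sup>+y. ennreal ((G (t - s) (x - y))\<^sup>2) \<partial>lborel) * (ennreal (L\<^sup>2 * e) * (\<integral>\<^sup>+h. ennreal ((J h)\<^sup>2) \<partial>\<mu>))"
        by (intro mult_mono G J\<kappa>) auto
      also have "\<dots> = (\<integral>\<^sup>+y. ennreal ((G (t - s) (x - y))\<^sup>2) * (ennreal (L\<^sup>2 * e) * (\<integral>\<^sup>+h. ennreal ((J h)\<^sup>2) \<partial>\<mu>)) \<partial>lborel)"
        by (rule nn_integral_multc[symmetric]) measurable
      also have "\<dots> = (\<integral>\<^sup>+y. (\<integral>\<^sup>+h. F s y h \<partial>\<mu>) \<partial>lborel)"
        unfolding F_def using True by (simp add: nn_integral_cmult)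
      finally show ?thesis
        using True by simp
    qed simp
  qed
  also have "\<dots> = (\<integral>\<^sup>+s. (\<integral>\<^sup>+k. (case k of (y, h) \<Rightarrow> F s y h) \<partial>(lborel \<Otimes>\<^sub>M \<mu>)) \<partial>restrict_space lborel {0..})"
  proof (rule nn_integral_cong)
    fix s :: real
    have "(\<lambda>(y, h). F s y h) \<in> borel_measurable (lborel \<Otimes>\<^sub>M \<mu>)"
      unfolding F_def by measurable
    then show "(\<integral>\<^sup>+y. (\<integral>\<^sup>+h. F s y h \<partial>\<mu>) \<partial>lborel) = (\<integral>\<^sup>+k. (case k of (y, h) \<Rightarrow> F s y h) \<partial>(lborel \<Otimes>\<^sub>M \<mu>))"
      using \<mu>.nn_integral_fst[of "\<lambda>(y, h). F s y h" lborel] by simp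
  qed
  also have "\<dots> = (\<integral>\<^sup>+(s, y, h). F s y h \<partial>intensity (lborel \<Otimes>\<^sub>M \<mu>))"
    using K.nn_integral_fst[of "\<lambda>(s, y, h). F s y h" "restrict_space lborel {0..}"] Fm
    unfolding intensity_def by simp
  also have "\<dots> \<le> (\<integral>\<^sup>+(s, y, h). (\<integral>\<^sup>+\<omega>. ennreal ((indicator {0<..<t} s * G (t - s) (x - y) * \<sigma> (u s y \<omega>) h)\<^sup>2) \<partial>M)
      \<partial>intensity (lborel \<Otimes>\<^sub>M \<mu>))"
    using low by (intro nn_integral_mono) auto
  also have "\<dots> \<le> second_moment t x"
    by (rule second_moment_decomposition(2)[OF t])
  finally show ?thesis .
qed

end

theorem theorem2p5:
  fixes \<alpha> \<beta> \<nu> L \<rho> \<kappa> :: real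
    and p :: "real \<Rightarrow> real ^ 'd::finite \<Rightarrow> real" and g :: "real \<Rightarrow> real"
    and M :: "'w measure" and \<mu> :: "(real ^ 'd) measure"
    and N :: "'w \<Rightarrow> (real \<times> (real ^ 'd) \<times> (real ^ 'd)) measure"
    and \<sigma> :: "real \<Rightarrow> real ^ 'd \<Rightarrow> real" and u\<^sub>0 J :: "real ^ 'd \<Rightarrow> real"
  assumes "0 < \<alpha>" "\<alpha> \<le> 2" and "0 < \<beta>" "\<beta> < 1" and "\<nu> > 0"
    and "real CARD('d) < min 2 (1 / \<beta>) * \<alpha>"
    and "stable_densities \<alpha> \<nu> p" and "subordinator_density \<beta> g"
    and "prob_space M" and "levy_measure \<mu>"
    and "poisson_random_measure M (intensity (lborel \<Otimes>\<^sub>M \<mu>)) N"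
    and "(\<lambda>(x, h). \<sigma> x h) \<in> borel_measurable borel"
    and "u\<^sub>0 \<in> borel_measurable borel" and "bounded (range u\<^sub>0)" and "(INF x. u\<^sub>0 x) > 0"
    and "L > 0" and "\<rho> > 1" and "\<kappa> > 0"
    and "J \<in> borel_measurable borel" and "\<And>h. J h > 0"
    and "\<And>x h. \<bar>\<sigma> x h\<bar> \<ge> L * J h * \<bar>x\<bar> powr \<rho>"
    and "(\<integral>\<^sup>+h. ennreal ((J h)\<^sup>2) \<partial>\<mu>) \<ge> ennreal \<kappa>"
  shows "\<not> (\<exists>u. random_field_solution M \<mu> N (fractional_kernel \<beta> p g) \<sigma> u\<^sub>0 u)"
proof
  assume "\<exists>u. random_field_solution M \<mu> N (fractional_kernel \<beta> p g) \<sigma> u\<^sub>0 u"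
  then obtain u where mild: "mild_solution M \<mu> N (fractional_kernel \<beta> p g) \<sigma> u\<^sub>0 u"
    and fin: "\<And>T. 0 < T \<Longrightarrow> (SUP t\<in>{0<..T}. SUP x. \<integral>\<^sup>+\<omega>. ennreal ((u t x \<omega>)\<^sup>2) \<partial>M) < \<infinity>"
    unfolding random_field_solution_def by blast
  have \<mu>: "sets \<mu> = sets borel" "sigma_finite_measure \<mu>"
    using \<open>levy_measure \<mu>\<close> unfolding levy_measure_def by auto
  interpret \<mu>: sigma_finite_measure \<mu>
    by (rule \<mu>(2))
  interpret lm: pair_sigma_finite lborel \<mu> ..
  interpret prob_space M
    by (rule \<open>prob_space M\<close>)
  interpret fractional_mild_solution \<alpha> \<beta> \<nu> p g M \<mu> N \<sigma> u\<^sub>0 u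
    using assms mild \<mu> by unfold_locales auto
  define \<gamma> where "\<gamma> = \<beta> * real DIM(real ^ 'd) / \<alpha>"
  \<comment> \<open>\<open>\<gamma> < 1\<close> amounts to \<open>d < \<alpha> / \<beta>\<close> and
    makes \<open>T powr \<gamma>\<close> negligible against \<open>T\<close>.\<close>
  have \<gamma>: "0 \<le> \<gamma>" "\<gamma> < 1"
  proof -
    have "min 2 (1 / \<beta>) * \<alpha> \<le> (1 / \<beta>) * \<alpha>"
      using \<open>0 < \<alpha>\<close> by (intro mult_right_mono) auto
    with assms(6) have "real CARD('d) < (1 / \<beta>) * \<alpha>"
      by linarith
    then show "\<gamma> < 1"
      using \<open>0 < \<alpha>\<close> \<open>0 < \<beta>\<close> by (simp add: \<gamma>_def field_simps)
    show "0 \<le> \<gamma>"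
      using \<open>0 < \<alpha>\<close> \<open>0 < \<beta>\<close> by (simp add: \<gamma>_def)
  qed
  obtain m C where mC: "0 < m" "0 < C"
    "\<And>t. 0 < t \<Longrightarrow> m \<le> (LINT x|lborel. G t x)"
    "\<And>t. 0 < t \<Longrightarrow> ennreal (C * t powr (- \<gamma>)) \<le> (\<integral>\<^sup>+x. ennreal ((G t x)\<^sup>2) \<partial>lborel)"
    using kernel_bounds unfolding \<gamma>_def by metis
  define c where "c = (INF x. u\<^sub>0 x)"
  have c: "0 < c"
    using assms(15) by (simp add: c_def)
  have cu: "c \<le> u\<^sub>0 x" for x
    unfolding c_def using \<open>bounded (range u\<^sub>0)\<close> by (intro cINF_lower bounded_imp_bdd_below) auto
  \<comment> \<open>The square of the lower bound for the deterministic term is the level at which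
    the doubling starts.\<close>
  define b where "b = (m * c)\<^sup>2"
  define A where "A = L\<^sup>2 * \<kappa> * C / 2 powr \<rho>"
  \<comment> \<open>\<open>D\<close> is the total doubling time at rate \<open>A\<close>; at the
    rate \<open>A * T powr (- \<gamma>)\<close>, in force up to time \<open>T\<close>, it becomes
    \<open>D * T powr \<gamma>\<close>.\<close>
  define D where "D = 2 * b powr (1 - \<rho>) / A / (1 - 2 powr (1 - \<rho>))"
  have b: "0 < b" and A: "0 < A"
    using mC(1,2) c assms by (auto simp: b_def A_def)
  have "2 powr (1 - \<rho>) < 1"
    using \<open>1 < \<rho>\<close> by (simp add: powr_less_one)
  then have D: "0 < D"
    using b A by (simp add: D_def)
  \<comment> \<open>Chosen so that \<open>T = (D + 1) * T powr \<gamma>\<close>, which exceeds the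
    total doubling time by \<open>T powr \<gamma>\<close>.\<close>
  define T where "T = (D + 1) powr (1 / (1 - \<gamma>))"
  have T: "0 < T"
    using D by (simp add: T_def)
  have "second_moment T x = \<infinity>" for x
  proof (rule doubling_blowup[OF b _ \<open>1 < \<rho>\<close>, where U = second_moment and x = x and T = T and k = "A * T powr (- \<gamma>)"])
    show "0 < A * T powr (- \<gamma>)"
      using A T by simp
    fix t y assume t: "0 < t" "t \<le> T"
    have "m * c \<le> (LINT z|lborel. G t (y - z) * u\<^sub>0 z)"
      using assms c cu mC(3) t by (intro initial_average_lower) auto
    then have "b \<le> (LINT z|lborel. G t (y - z) * u\<^sub>0 z)\<^sup>2"
      unfolding b_def using mC(1) c by (intro power_mono) auto
    then show "ennreal b \<le> second_moment t y"
      using second_moment_decomposition(1)[OF t(1), of y] by (meson ennreal_leI order_trans)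
  next
    fix a r t y
    assume *: "0 < a" "0 \<le> r" "r < t" "t \<le> T" "\<And>s y. r < s \<Longrightarrow> s < t \<Longrightarrow> ennreal a \<le> second_moment s y"
    show "ennreal (A * T powr (- \<gamma>) * a powr \<rho> * (t - r)) \<le> second_moment t y"
      using second_moment_growth[of L \<rho> \<kappa> J C \<gamma> a r t T y] assms mC(2,4) \<gamma> * by (simp add: A_def)
  next
    have "T powr (1 - \<gamma>) = D + 1"
      using D \<gamma> by (simp add: T_def powr_powr)
    then have "T = (D + 1) * T powr \<gamma>"
      using T by (simp add: powr_diff field_simps)
    moreover have "2 * b powr (1 - \<rho>) / (A * T powr (- \<gamma>)) / (1 - 2 powr (1 - \<rho>)) = D * T powr \<gamma>"
      using T by (simp add: D_def powr_minus field_simps)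
    moreover have "D * T powr \<gamma> < (D + 1) * T powr \<gamma>"
      using T by simp
    ultimately show "2 * b powr (1 - \<rho>) / (A * T powr (- \<gamma>)) / (1 - 2 powr (1 - \<rho>)) < T"
      by simp
  qed
  \<comment> \<open>One point in space is enough, as the supremum up to time \<open>T\<close>
    dominates the moment there.\<close>
  moreover have "second_moment T 0 \<le> (SUP t\<in>{0<..T}. SUP x. second_moment t x)"
    using T by (intro SUP_upper2[of T] SUP_upper2[of 0]) auto
  ultimately show False
    using fin[OF T] by (simp add: second_moment_def)
qed

end
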